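(* Let $n\ge 3$ and $m\ge 2$. For $\varepsilon\in(0,\frac{4}{n-2})$ let $u_\varepsilon$ be a radial solution of $$-\Delta u_\varepsilon=|u_\varepsilon|^{\frac{4}{n-2}-\varepsilon}u_\varepsilon\ \text{ in }B,\qquad \partial_\nu u_\varepsilon=0\ \text{ on }\partial B,$$ with $m-1$ interior zeros. Let $(\delta_{k,\varepsilon})_{k=1}^m$ be the decreasing sequence of all the critical points of $u_\varepsilon$ in $[0,1]$ and $(\rho_{k,\varepsilon})_{k=1}^{m-1}$ the decreasing sequence of all the zeros of $u_\varepsilon$ in $[0,1]$. Then $$0=\delta_{m,\varepsilon}<\rho_{m-1,\varepsilon}<\delta_{m-1,\varepsilon}<\rho_{m-2,\varepsilon}<\ldots<\rho_{1,\varepsilon}<\delta_{1,\varepsilon}=1$$ and \begin{align*} \lim_{\varepsilon\to0}|u_\varepsilon(\delta_{k,\varepsilon})|\,(\kappa_n\varepsilon)^{\frac{2kn-3n+2}{2n}}&=\widetilde D(k,m) &&\text{for }k\in\{1,\ldots,m\},\\ \lim_{\varepsilon\to0}\delta_{k,\varepsilon}\,(\kappa_n\varepsilon)^{-\frac{2(k-1)}{n-2}}&=\widetilde d(k,m) &&\text{for }k\in\{2,\ldots,m-1\},\\ \lim_{\varepsilon\to0}|u_\varepsilon'(\rho_{k,\varepsilon})|\,(\kappa_n\varepsilon)^{\frac{2kn-3n+4}{2(n-2)}}&=\widetilde Z(k,m) &&\text{for }k\in\{1,\ldots,m-1\},\\ \lim_{\varepsilon\to0}\rho_{k,\varepsilon}\,(\kappa_n\varepsilon)^{-\frac{2kn-2n+2}{n(n-2)}}&=\widetilde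 z(k,m) &&\text{for }k\in\{1,\ldots,m-1\}; \end{align*} in particular (for the same respective ranges of $k$), $$u_\varepsilon(\delta_{k,\varepsilon})\sim\varepsilon^{\frac{n-2}{2n}-(k-1)},\quad \delta_{k,\varepsilon}\sim\varepsilon^{\frac{2(k-1)}{n-2}},\quad u_\varepsilon'(\rho_{k,\varepsilon})\sim\varepsilon^{\frac{n-4}{2(n-2)}-\frac{n(k-1)}{n-2}},\quad \rho_{k,\varepsilon}\sim\varepsilon^{\frac{2}{n(n-2)}+\frac{2(k-1)}{n-2}}.$$ The coefficients are given by \begin{align*} \widetilde D(k,m)&=(n(n-2))^{\frac{n-2}{4}}(m-1)^{\frac12-\frac1n}\frac{\Gamma(m-k+1)}{\Gamma(m)},\\ \widetilde d(k,m)&=(m-1)^{-\frac1n}(m-k)^{\frac1n}\left(\frac{\Gamma(m)}{\Gamma(m-k+1)}\right)^{\frac{2}{n-2}},\\ \widetilde Z(k,m)&=n^{\frac{n-2}{4}}(n-2)^{\frac{n+2}{4}}(m-1)^{\frac12}(m-k)^{-\frac{1}{n-2}}\left(\frac{\Gamma(m-k+1)}{\Gamma(m)}\right)^{\frac{n}{n-2}},\\ \widetilde z(k,m)&=(m-1)^{-\frac1n}(m-k)^{\frac{1}{n-2}}\left(\frac{\Gamma(m)}{\Gamma(m-k+1)}\right)^{\frac{2}{n-2}}. \end{align*}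
   Context: $B\subset\mathbb{R}^n$ is the open unit ball centered at the origin; $\partial_\nu$ is the outer normal derivative; solutions are classical. A radial function $w$ is identified with the function $r\mapsto w(r)$, $w(r)=w(x)$ for $|x|=r$; zeros, critical points and $'$ refer to this function of $r\in[0,1]$. "$w$ has $k$ interior zeros" means that $r\mapsto w(r)$ has exactly $k$ zeros in $(0,1)$. For every $m\ge2$ the radial Neumann solution with exactly $m-1$ interior zeros exists and is unique up to a sign. $\Gamma$ is the Gamma function and $\kappa_n:=\frac{n-2}{4}\frac{\Gamma(n/2)^2}{\Gamma(n)}$. The notation $a_\varepsilon\sim b_\varepsilon$ (with $b_\varepsilon>0$) means that $|a_\varepsilon|/b_\varepsilon$ converges to a positive finite constant as $\varepsilon\to0$. *)

theory Defs
  imports "HOL-Analysis.Analysis"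
begin

section \<open>Classical radial Neumann solutions on the unit ball\<close>

definition C1_on :: "'a::real_normed_vector set \<Rightarrow> ('a \<Rightarrow> 'b::real_normed_vector) \<Rightarrow> bool" where
  "C1_on S f \<longleftrightarrow> (\<exists>f' :: 'a \<Rightarrow> 'a \<Rightarrow>\<^sub>L 'b.
     (\<forall>x\<in>S. (f has_derivative blinfun_apply (f' x)) (at x within S)) \<and> continuous_on S f')"

definition C2_on :: "'a::real_normed_vector set \<Rightarrow> ('a \<Rightarrow> 'b::real_normed_vector) \<Rightarrow> bool" where
  "C2_on S f \<longleftrightarrow> (\<exists>f' :: 'a \<Rightarrow> 'a \<Rightarrow>\<^sub>L 'b.
     (\<forall>x\<in>S. (f has_derivative blinfun_apply (f' x)) (at x within S)) \<and> C1_on S f')"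

definition laplacian :: "('a::euclidean_space \<Rightarrow> real) \<Rightarrow> 'a \<Rightarrow> real" where
  "laplacian f x = (\<Sum>b\<in>Basis. (deriv ^^ 2) (\<lambda>t. f (x + t *\<^sub>R b)) 0)"

text \<open>Classical means $C^2(B) \cap C^1(\overline{B})$. At a point \<open>x\<close> of the unit sphere the outer
  normal is \<open>x\<close> itself; the normal derivative is one-sided, taken from inside the ball.\<close>

definition neumann_solution :: "real \<Rightarrow> ('a::euclidean_space \<Rightarrow> real) \<Rightarrow> bool" where
  "neumann_solution q u \<longleftrightarrow>
     C2_on (ball 0 1) u \<and> C1_on (cball 0 1) u \<and>
     (\<forall>x\<in>ball 0 1. - laplacian u x = \<bar>u x\<bar> powr q * u x) \<and>
     (\<forall>x\<in>sphere 0 1. ((\<lambda>t. u (x + t *\<^sub>R x)) has_real_derivative 0) (at 0 within {..0}))"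

definition radial :: "('a::real_normed_vector \<Rightarrow> real) \<Rightarrow> bool" where
  "radial w \<longleftrightarrow> (\<forall>x\<in>cball 0 1. \<forall>y\<in>cball 0 1. norm x = norm y \<longrightarrow> w x = w y)"

text \<open>The function $r \mapsto w(r)$ with which a radial \<open>w\<close> is identified; only its values on
  $[0,1]$ are meaningful, so derivatives of it are always taken within $[0,1]$.\<close>

definition profile :: "('a::real_normed_vector \<Rightarrow> real) \<Rightarrow> real \<Rightarrow> real" where
  "profile w r = w (SOME x. norm x = r)"

definition profile_deriv :: "('a::real_normed_vector \<Rightarrow> real) \<Rightarrow> real \<Rightarrow> real" where
  "profile_deriv w r = vector_derivative (profile w) (at r within {0..1})"

definition critical_points :: "('a::real_normed_vector \<Rightarrow> real) \<Rightarrow> real set" where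
  "critical_points w =
     {r \<in> {0..1}. (profile w has_real_derivative 0) (at r within {0..1})}"

definition zeros :: "('a::real_normed_vector \<Rightarrow> real) \<Rightarrow> real set" where
  "zeros w = {r \<in> {0..1}. profile w r = 0}"

definition has_interior_zeros :: "('a::real_normed_vector \<Rightarrow> real) \<Rightarrow> nat \<Rightarrow> bool" where
  "has_interior_zeros w k \<longleftrightarrow>
     finite {r \<in> {0<..<1}. profile w r = 0} \<and> card {r \<in> {0<..<1}. profile w r = 0} = k"

text \<open>The \<open>k\<close>-th largest element of a finite set; indices start at 1.\<close>

definition decreasing_enum :: "real set \<Rightarrow> nat \<Rightarrow> real" where
  "decreasing_enum A k = rev (sorted_list_of_set A) ! (k - 1)"

section \<open>Constants and asymptotic equivalence\<close>

text \<open>Unlike the library's asymptotic equivalence, this relation ignores multiplicative constants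
  and the sign of the left-hand side.\<close>

definition sim_order :: "(real \<Rightarrow> real) \<Rightarrow> (real \<Rightarrow> real) \<Rightarrow> bool" where
  "sim_order a b \<longleftrightarrow> (\<exists>c>0. ((\<lambda>\<epsilon>. \<bar>a \<epsilon>\<bar> / b \<epsilon>) \<longlongrightarrow> c) (at_right 0))"

definition kappa :: "nat \<Rightarrow> real" where
  "kappa n = (real n - 2) / 4 * (Gamma (real n / 2) ^ 2 / Gamma (real n))"

definition D_coeff :: "nat \<Rightarrow> nat \<Rightarrow> nat \<Rightarrow> real" where
  "D_coeff n k m =
     (real n * (real n - 2)) powr ((real n - 2) / 4) * (real m - 1) powr (1/2 - 1 / real n) *
     (Gamma (real m - real k + 1) / Gamma (real m))"

definition d_coeff :: "nat \<Rightarrow> nat \<Rightarrow> nat \<Rightarrow> real" where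
  "d_coeff n k m =
     (real m - 1) powr (- (1 / real n)) * (real m - real k) powr (1 / real n) *
     (Gamma (real m) / Gamma (real m - real k + 1)) powr (2 / (real n - 2))"

definition Z_coeff :: "nat \<Rightarrow> nat \<Rightarrow> nat \<Rightarrow> real" where
  "Z_coeff n k m =
     real n powr ((real n - 2) / 4) * (real n - 2) powr ((real n + 2) / 4) *
     (real m - 1) powr (1/2) * (real m - real k) powr (- (1 / (real n - 2))) *
     (Gamma (real m - real k + 1) / Gamma (real m)) powr (real n / (real n - 2))"

definition z_coeff :: "nat \<Rightarrow> nat \<Rightarrow> nat \<Rightarrow> real" where
  "z_coeff n k m =
     (real m - 1) powr (- (1 / real n)) * (real m - real k) powr (1 / (real n - 2)) *
     (Gamma (real m) / Gamma (real m - real k + 1)) powr (2 / (real n - 2))"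

end

(* The flux Y r = - r ^ (n - 1) * w' r of a radial solution is strictly monotone on every nodal
   interval, so the critical points and zeros alternate, and the solution splits into arcs, each
   running from a critical point through a zero to the next critical point. Rescale an arc to
   height 1, with q = 4 / (n - 2) - \<epsilon>, nu = n - 2 and N = n * (n - 2).

   If the rescaled arc starts at \<tau> with \<tau> -> 0, a monotone quotient (whose derivative is a
   nonnegative Pohozaev expression) bounds it from above by explicit bubbles; feeding this bound
   into the flux bounds it from below by bubbles. Hence it converges to (1 + t^2 / N) powr (- nu / 2),
   and dominated convergence gives the limits of the flux and of the energy integral at the zero T.
   The Pohozaev quantity P starts at \<tau> ^ n / (q + 2), grows by \<epsilon> times a constant in each bubble
   and by o(\<epsilon>) on the rest of the arc. After j bubbles P is therefore asymptotic to j times that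
   constant times \<epsilon>; comparing with P T = (Y T)^2 / (2 * T ^ (n - 2)) gives T, comparing harmonic
   functions beyond T gives the height of the next extremum, and P at that extremum gives the
   next \<tau>. Finally, the scale of the whole solution is fixed by the last critical point being 1. *)
theory Submission
  imports Defs
begin

section \<open>One nodal arc\<close>

text \<open>The monotone quotient is \<open>Y * V powr - (n / nu) / t ^ n\<close>. It is nu times
  the derivative of \<open>V powr - (2 / nu)\<close> with respect to \<open>t ^ 2\<close>, and for
  bubbles it is constant, so its value at one early time controls all later times. This stands in
  for continuous dependence on initial data, which is of no direct use here: every arc but the first
  starts at a positive \<tau>, and the rescaled zero escapes to infinity. The constant kappa_n is
  chosen so that one bubble raises P by nu * N powr (n / 2) / (2 * n) times kappa_n * \<epsilon>, to
  leading order. As P starts at \<tau> ^ n / (q + 2) and q + 2 tends to 2 * n / nu, the hypothesis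
  that \<tau> ^ n / (kappa_n * \<epsilon>) tends to j * N powr (n / 2) reproduces itself with j + 1
  in place of j. It holds with j = 0 on the first arc, where \<tau> = 0. The exponents also move
  with \<epsilon>. All amplitudes are comparable to powers of \<epsilon>, so the error is a factor
  exp (O(\<epsilon> ln \<epsilon>)), which tends to 1. Limits are taken along sequences of
  \<epsilon>, the setting of dominated convergence.\<close>

lemma abs_powr_has_real_derivative:
  assumes V: "(V has_real_derivative D) (at t)" and "V t \<noteq> 0"
  shows "((\<lambda>t. \<bar>V t\<bar> powr (q + 2)) has_real_derivative
           (q + 2) * (\<bar>V t\<bar> powr q * V t) * D) (at t)"
proof -
  \<comment> \<open>The rule for \<open>powr\<close> wants a positive base, so near \<open>t\<close>
    the absolute value is replaced by \<open>c * V\<close>, which covers both signs at once.\<close>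
  define c where "c = sgn (V t)"
  have c: "0 < c * V t" "\<bar>V t\<bar> = c * V t" "c * c = 1"
    using assms(2) by (auto simp: c_def sgn_if)
  have dc: "((\<lambda>s. c * V s) has_real_derivative c * D) (at t)"
    by (rule DERIV_cmult[OF V])
  have "((\<lambda>s. (c * V s) powr (q + 2)) has_real_derivative
      (q + 2) * (c * V t) powr (q + 2 - of_nat 1) * (c * D)) (at t)"
    by (rule DERIV_fun_powr[OF dc c(1)])
  moreover have "(c * V t) powr (q + 2 - of_nat 1) = (c * V t) powr q * (c * V t)"
    using powr_mult_base[of "c * V t" q] c(1) by (simp add: add.commute mult.commute)
  moreover have "(q + 2) * (p * (c * V t)) * (c * D) = (q + 2) * (p * V t) * D" for p
  proof -
    have "(q + 2) * (p * (c * V t)) * (c * D) = c * c * ((q + 2) * (p * V t) * D)"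
      by (simp only: mult_ac)
    then show ?thesis by (simp only: c(3) mult_1_left)
  qed
  ultimately have "((\<lambda>s. (c * V s) powr (q + 2)) has_real_derivative
      (q + 2) * (\<bar>V t\<bar> powr q * V t) * D) (at t)"
    by (simp only: c(2))
  moreover have "\<forall>\<^sub>F s in nhds t. (c * V s) powr (q + 2) = \<bar>V s\<bar> powr (q + 2)"
  proof -
    have "((\<lambda>s. c * V s) \<longlongrightarrow> c * V t) (nhds t)"
      using DERIV_isCont[OF dc] tendsto_at_iff_tendsto_nhds[of "\<lambda>s. c * V s" t]
      by (simp add: continuous_at)
    then have "\<forall>\<^sub>F s in nhds t. 0 < c * V s"
      using c(1) by (rule order_tendstoD(1))
    then show ?thesis
      by (rule eventually_mono) (use assms(2) in \<open>auto simp: c_def sgn_if split: if_splits\<close>)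
  qed
  ultimately show ?thesis
    using DERIV_cong_ev[OF refl _ refl] by fastforce
qed

text \<open>With \<open>Y = - t ^ (n - 1) * V'\<close> this is the classical Pohozaev expression,
  whose terms are \<open>t ^ n * V' ^ 2 / 2\<close>, a multiple of
  \<open>t ^ n * \<bar>V\<bar> powr (q + 2)\<close>, and
  \<open>(n - 2) / 2 * t ^ (n - 1) * V * V'\<close>. The weight \<open>c\<close> stays free because
  two values are needed; they coincide at the critical exponent.\<close>

definition pohozaev :: "nat \<Rightarrow> real \<Rightarrow> real \<Rightarrow> (real \<Rightarrow> real) \<Rightarrow> (real \<Rightarrow> real) \<Rightarrow> real \<Rightarrow> real" where
  "pohozaev n q c V Y t =
     (Y t)\<^sup>2 / t ^ (n - 2) / 2 + c * t ^ n * \<bar>V t\<bar> powr (q + 2) - (real n - 2) / 2 * V t * Y t"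

text \<open>The derivative has two terms and each admissible \<open>c\<close> removes one:
  \<open>c = 1 / (q + 2)\<close> the first, which gives the energy balance, and
  \<open>c = (n - 2) / (2 * n)\<close> the second, which gives monotonicity while \<open>V\<close>
  and \<open>Y\<close> are nonnegative.\<close>

lemma pohozaev_has_real_derivative:
  assumes n: "3 \<le> n" and t: "0 < t" and "V t \<noteq> 0"
    and V: "(V has_real_derivative - (Y t / t ^ (n - 1))) (at t)"
    and Y: "(Y has_real_derivative t ^ (n - 1) * (\<bar>V t\<bar> powr q * V t)) (at t)"
  shows "(pohozaev n q c V Y has_real_derivative
      t * Y t * (\<bar>V t\<bar> powr q * V t) * (1 - c * (q + 2)) +
      t ^ (n - 1) * \<bar>V t\<bar> powr (q + 2) * (real n * c - (real n - 2) / 2)) (at t)"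
proof -
  obtain k where k: "n = k + 3"
    using n by (metis add.commute le_Suc_ex)
  have sq: "\<bar>V t\<bar> powr (q + 2) = \<bar>V t\<bar> powr q * V t * V t"
    using assms(3) by (simp add: powr_add powr_numeral power2_eq_square)
  define v where "v = \<bar>V t\<bar> powr q * V t"
  have d1: "((\<lambda>t. (Y t)\<^sup>2 / t ^ (k + 1) / 2) has_real_derivative
      (2 * Y t * (t ^ (k + 2) * v) * t ^ (k + 1) - (Y t)\<^sup>2 * ((real k + 1) * t ^ k)) / (t ^ (k + 1))\<^sup>2 / 2) (at t)"
    by (rule derivative_eq_intros Y refl | use t in \<open>simp; fail\<close>)+
      (use t in \<open>simp add: k v_def power2_eq_square field_simps\<close>)
  have d2: "((\<lambda>t. c * t ^ n * \<bar>V t\<bar> powr (q + 2)) has_real_derivative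
      c * (real n * t ^ (k + 2) * \<bar>V t\<bar> powr (q + 2)
             + t ^ n * ((q + 2) * v * - (Y t / t ^ (n - 1))))) (at t)"
    by (rule DERIV_cong, rule DERIV_mult[OF DERIV_cmult[OF DERIV_pow] abs_powr_has_real_derivative[OF V assms(3)]])
      (simp add: k v_def algebra_simps)
  have d3: "((\<lambda>t. (real n - 2) / 2 * V t * Y t) has_real_derivative
      (real n - 2) / 2 * (V t * (t ^ (k + 2) * v) + - (Y t / t ^ (n - 1)) * Y t)) (at t)"
    by (rule DERIV_cong, rule DERIV_mult[OF DERIV_cmult[OF V] Y])
      (simp add: k v_def algebra_simps)
  note d = DERIV_diff[OF DERIV_add[OF d1 d2] d3]
  have e1: "(2 * Y t * (t ^ (k + 2) * v) * t ^ (k + 1) - (Y t)\<^sup>2 * ((real k + 1) * t ^ k)) / (t ^ (k + 1))\<^sup>2 / 2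
      = t * Y t * v - (Y t)\<^sup>2 * (real k + 1) / (2 * t ^ (k + 2))"
    using t by (simp add: field_simps power2_eq_square power_add)
  have e2: "c * (real n * t ^ (k + 2) * \<bar>V t\<bar> powr (q + 2)
             + t ^ n * ((q + 2) * v * - (Y t / t ^ (n - 1))))
        = c * (real n * t ^ (k + 2) * (v * V t)) - c * (q + 2) * t * v * Y t"
    using t by (simp add: k sq v_def field_simps power_add power3_eq_cube)
  have e3: "(real n - 2) / 2 * (V t * (t ^ (k + 2) * v) + - (Y t / t ^ (n - 1)) * Y t)
     = (real n - 2) / 2 * (t ^ (k + 2) * (v * V t)) - (Y t)\<^sup>2 * (real k + 1) / (2 * t ^ (k + 2))"
    using t by (simp add: k field_simps power2_eq_square)
  have "pohozaev n q c V Y =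
      (\<lambda>t. (Y t)\<^sup>2 / t ^ (k + 1) / 2 + c * t ^ n * \<bar>V t\<bar> powr (q + 2) - (real n - 2) / 2 * V t * Y t)"
    by (simp add: pohozaev_def[abs_def] k)
  moreover have "t ^ (n - 1) * \<bar>V t\<bar> powr (q + 2) = t ^ (k + 2) * (v * V t)"
    by (simp add: k sq v_def)
  ultimately show ?thesis
    unfolding v_def[symmetric]
    by (simp only:) (rule DERIV_cong[OF d], simp only: e1 e2 e3, simp add: algebra_simps)
qed

text \<open>This is the radial harmonic function with constant flux \<open>A\<close>; it is the
  comparison function beyond the zero.\<close>

lemma newton_potential_has_real_derivative:
  assumes n: "3 \<le> n" and t: "0 < t"
  shows "((\<lambda>t. A / ((real n - 2) * t ^ (n - 2))) has_real_derivative - (A / t ^ (n - 1))) (at t)"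
proof -
  obtain k where k: "n = k + 3"
    using n by (metis add.commute le_Suc_ex)
  define d where "d = real n - 2"
  have d: "d \<noteq> 0" "d = real (n - 2)"
    using n by (auto simp: d_def)
  have "((\<lambda>t. A / (d * t ^ (n - 2))) has_real_derivative
      (0 * (d * t ^ (n - 2)) - A * (d * (real (n - 2) * t ^ (n - 2 - Suc 0))))
        / (d * t ^ (n - 2) * (d * t ^ (n - 2)))) (at t)"
    using t d(1) by (intro DERIV_divide DERIV_cmult DERIV_pow DERIV_const) auto
  moreover have "(0 * (d * t ^ (n - 2)) - A * (d * (real (n - 2) * t ^ (n - 2 - Suc 0))))
        / (d * t ^ (n - 2) * (d * t ^ (n - 2))) = - (A / t ^ (n - 1))"
    unfolding d(2)[symmetric] using t d(1) by (simp add: k field_simps)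
  ultimately show ?thesis
    by (simp add: d_def)
qed

text \<open>The flux \<open>Y\<close> is a second unknown, which makes the equation a first order
  system. Derivatives are required only strictly inside, continuity up to the ends, so that
  \<open>\<tau> = 0\<close>, where the system is singular, is allowed.\<close>

locale nodal_arc =
  fixes n :: nat and q :: real and V Y :: "real \<Rightarrow> real" and \<tau> T S :: real
  assumes n_ge: "3 \<le> n" and q_pos: "0 < q" and q_sub: "q \<le> 4 / (real n - 2)"
    and tau_nonneg: "0 \<le> \<tau>" and tau_less: "\<tau> < T" and T_less: "T < S"
    and cont_V: "continuous_on {\<tau>..S} V" and cont_Y: "continuous_on {\<tau>..S} Y"
    and deriv_V: "\<And>t. \<tau> < t \<Longrightarrow> t < S \<Longrightarrow> (V has_real_derivative - (Y t / t ^ (n - 1))) (at t)"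
    and deriv_Y: "\<And>t. \<tau> < t \<Longrightarrow> t < S \<Longrightarrow>
      (Y has_real_derivative t ^ (n - 1) * (\<bar>V t\<bar> powr q * V t)) (at t)"
    and V_tau: "V \<tau> = 1" and Y_tau: "Y \<tau> = 0" and V_T: "V T = 0" and Y_S: "Y S = 0"
    and V_pos: "\<And>t. \<tau> < t \<Longrightarrow> t < T \<Longrightarrow> 0 < V t"
    and V_neg: "\<And>t. T < t \<Longrightarrow> t \<le> S \<Longrightarrow> V t < 0"
begin

section \<open>Elementary bounds between the start of an arc and its zero\<close>

abbreviation \<nu> :: real where "\<nu> \<equiv> real n - 2"

lemma nu_pos: "0 < \<nu>"
  using n_ge by simp

lemma T_pos: "0 < T"
  using tau_nonneg tau_less by simp

lemma cont_V_sub: "\<tau> \<le> a \<Longrightarrow> b \<le> S \<Longrightarrow> continuous_on {a..b} V"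
  and cont_Y_sub: "\<tau> \<le> a \<Longrightarrow> b \<le> S \<Longrightarrow> continuous_on {a..b} Y"
  using continuous_on_subset[OF cont_V] continuous_on_subset[OF cont_Y] by auto

lemma V_nonneg: "\<tau> \<le> t \<Longrightarrow> t \<le> T \<Longrightarrow> 0 \<le> V t"
  using V_pos[of t] V_tau V_T by (cases "t = \<tau> \<or> t = T") auto

lemma V_pos': "\<tau> \<le> t \<Longrightarrow> t < T \<Longrightarrow> 0 < V t"
  using V_pos[of t] V_tau by (cases "t = \<tau>") auto

lemma source_eq:
  assumes "0 \<le> V t"
  shows "\<bar>V t\<bar> powr q * V t = V t powr (q + 1)"
  using assms powr_mult_base[of "V t" q] by (simp add: algebra_simps)

lemma Y_pos:
  assumes "\<tau> < t" "t \<le> T"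
  shows "0 < Y t"
proof -
  have "Y \<tau> < Y t"
  proof (rule DERIV_pos_imp_increasing_open[OF assms(1)])
    fix s assume s: "\<tau> < s" "s < t"
    have "0 < s ^ (n - 1) * (\<bar>V s\<bar> powr q * V s)"
      using s assms V_pos[of s] tau_nonneg by (intro mult_pos_pos zero_less_power) auto
    then show "\<exists>y. (Y has_real_derivative y) (at s) \<and> 0 < y"
      using deriv_Y[of s] s assms T_less by auto
  qed (use assms T_less in \<open>auto intro: cont_Y_sub\<close>)
  then show ?thesis by (simp add: Y_tau)
qed

lemma Y_nonneg: "\<tau> \<le> t \<Longrightarrow> t \<le> T \<Longrightarrow> 0 \<le> Y t"
  using Y_pos[of t] Y_tau by (cases "t = \<tau>") auto

lemma V_antimono:
  assumes "\<tau> \<le> s" "s \<le> t" "t \<le> T"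
  shows "V t \<le> V s"
proof (rule DERIV_nonpos_imp_decreasing_open[OF assms(2)])
  fix x assume x: "s < x" "x < t"
  have "- (Y x / x ^ (n - 1)) \<le> 0"
    using x assms Y_nonneg[of x] tau_nonneg by simp
  then show "\<exists>y. (V has_real_derivative y) (at x) \<and> y \<le> 0"
    using deriv_V[of x] x assms T_less by auto
qed (use assms T_less in \<open>auto intro: cont_V_sub\<close>)

lemma V_le_1: "\<tau> \<le> t \<Longrightarrow> t \<le> T \<Longrightarrow> V t \<le> 1"
  using V_antimono[of \<tau> t] V_tau by simp

text \<open>Since \<open>V \<le> 1\<close>, the source is at most 1.\<close>

lemma Y_le:
  assumes "\<tau> \<le> t" "t \<le> T"
  shows "Y t \<le> t ^ n / n"
proof -
  have "\<tau> ^ n / n - Y \<tau> \<le> t ^ n / n - Y t"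
  proof (rule DERIV_nonneg_imp_increasing_open[OF assms(1)])
    fix x assume x: "\<tau> < x" "x < t"
    have "V x powr (q + 1) \<le> 1 powr (q + 1)"
      using x assms V_nonneg[of x] V_le_1[of x] q_pos by (intro powr_mono2) auto
    then have "0 \<le> x ^ (n - 1) * (1 - V x powr (q + 1))"
      using x tau_nonneg by (intro mult_nonneg_nonneg) auto
    moreover have "((\<lambda>x. x ^ n / n - Y x) has_real_derivative
        real n * x ^ (n - 1) / n - x ^ (n - 1) * (\<bar>V x\<bar> powr q * V x)) (at x)"
      using x assms T_less DERIV_pow[of n x] by (intro DERIV_diff DERIV_cdivide deriv_Y) auto
    moreover have "real n * x ^ (n - 1) / n - x ^ (n - 1) * (\<bar>V x\<bar> powr q * V x)
        = x ^ (n - 1) * (1 - V x powr (q + 1))"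
      using n_ge V_nonneg[of x] x assms by (subst source_eq) (auto simp: algebra_simps)
    ultimately show "\<exists>y. ((\<lambda>x. x ^ n / n - Y x) has_real_derivative y) (at x) \<and> 0 \<le> y"
      by auto
  qed (use assms T_less n_ge in \<open>auto intro!: continuous_intros cont_Y_sub\<close>)
  moreover have "0 \<le> \<tau> ^ n / n"
    using tau_nonneg by simp
  ultimately show ?thesis
    by (simp add: Y_tau)
qed

text \<open>\<open>V\<close> decreases, so up to time \<open>t\<close> the source is at least its
  value at \<open>t\<close>.\<close>

lemma Y_ge:
  assumes "\<tau> \<le> t" "t \<le> T"
  shows "V t powr (q + 1) * (t ^ n - \<tau> ^ n) / n \<le> Y t"
proof -
  define v where "v = V t powr (q + 1)"
  have "Y \<tau> - v * (\<tau> ^ n / n) \<le> Y t - v * (t ^ n / n)"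
  proof (rule DERIV_nonneg_imp_increasing_open[OF assms(1)])
    fix x assume x: "\<tau> < x" "x < t"
    have "v \<le> V x powr (q + 1)"
      unfolding v_def
      using x assms V_nonneg[of t] V_antimono[of x t] q_pos by (intro powr_mono2) auto
    then have "0 \<le> x ^ (n - 1) * (V x powr (q + 1) - v)"
      using x tau_nonneg by (intro mult_nonneg_nonneg) auto
    moreover have "((\<lambda>x. Y x - v * (x ^ n / n)) has_real_derivative
        x ^ (n - 1) * (\<bar>V x\<bar> powr q * V x) - v * (real n * x ^ (n - 1) / n)) (at x)"
      using x assms T_less DERIV_pow[of n x]
      by (intro DERIV_diff DERIV_cmult DERIV_cdivide deriv_Y) auto
    moreover have "x ^ (n - 1) * (\<bar>V x\<bar> powr q * V x) - v * (real n * x ^ (n - 1) / n)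
        = x ^ (n - 1) * (V x powr (q + 1) - v)"
      using n_ge V_nonneg[of x] x assms by (subst source_eq) (auto simp: algebra_simps)
    ultimately show "\<exists>y. ((\<lambda>x. Y x - v * (x ^ n / n)) has_real_derivative y) (at x) \<and> 0 \<le> y"
      by auto
  qed (use assms T_less n_ge in \<open>auto intro!: continuous_intros cont_Y_sub\<close>)
  then show ?thesis
    unfolding v_def[symmetric] by (simp add: Y_tau algebra_simps diff_divide_distrib)
qed

text \<open>Integrating \<open>Y_le\<close> once more: \<open>V\<close> falls at rate at most
  \<open>t / n\<close>. This keeps \<open>V\<close> close to 1 for short times and forces the zero
  to come late.\<close>

lemma V_ge:
  assumes "\<tau> \<le> t" "t \<le> T"
  shows "1 - t\<^sup>2 / (2 * n) \<le> V t"
proof -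
  have "V \<tau> + \<tau>\<^sup>2 / (2 * n) \<le> V t + t\<^sup>2 / (2 * n)"
  proof (rule DERIV_nonneg_imp_increasing_open[OF assms(1)])
    fix x assume x: "\<tau> < x" "x < t"
    have "x > 0" using x tau_nonneg by simp
    have "x ^ n = x * x ^ (n - 1)"
      using n_ge by (cases n) auto
    then have "Y x / x ^ (n - 1) \<le> x / n"
      using Y_le[of x] x assms \<open>x > 0\<close> by (simp add: field_simps)
    moreover have "((\<lambda>x. V x + x\<^sup>2 / (2 * n)) has_real_derivative
        - (Y x / x ^ (n - 1)) + 2 * x / (2 * n)) (at x)"
      using x assms T_less DERIV_pow[of 2 x]
      by (intro DERIV_add DERIV_cdivide deriv_V) auto
    ultimately show "\<exists>y. ((\<lambda>x. V x + x\<^sup>2 / (2 * n)) has_real_derivative y) (at x) \<and> 0 \<le> y"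
      using n_ge by (intro exI[of _ "- (Y x / x ^ (n - 1)) + 2 * x / (2 * n)"]) auto
  qed (use assms T_less n_ge in \<open>auto intro!: continuous_intros cont_V_sub\<close>)
  moreover have "0 \<le> \<tau>\<^sup>2 / (2 * n)" by simp
  ultimately show ?thesis
    unfolding V_tau by linarith
qed

section \<open>Bubble barriers from above and below\<close>

text \<open>For \<open>c = \<nu> / (2 * n)\<close> the functional is nondecreasing because
  \<open>c * (q + 2) \<le> 1\<close>, which is subcriticality. It remains to see that it starts from
  a nonnegative value.\<close>

lemma pohozaev_nonneg:
  assumes t: "\<tau> < t" "t < T"
  shows "0 \<le> pohozaev n q (\<nu> / (2 * real n)) V Y t"
proof -
  define c where "c = \<nu> / (2 * real n)"
  have c: "0 \<le> 1 - c * (q + 2)" "real n * c - \<nu> / 2 = 0" "0 \<le> c"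
    using n_ge q_sub by (auto simp: c_def field_simps)
  have le: "- (\<nu> / 2) * Y s \<le> pohozaev n q c V Y t" if s: "\<tau> < s" "s < t" for s
  proof -
    have "pohozaev n q c V Y s \<le> pohozaev n q c V Y t"
    proof (rule DERIV_nonneg_imp_nondecreasing[where f = "pohozaev n q c V Y"])
      fix x assume x: "s \<le> x" "x \<le> t"
      then have x': "0 < x" "\<tau> < x" "x < T" "x < S"
        using s t tau_nonneg T_less by auto
      have "0 \<le> x * Y x * (\<bar>V x\<bar> powr q * V x) * (1 - c * (q + 2)) +
        x ^ (n - 1) * \<bar>V x\<bar> powr (q + 2) * (real n * c - \<nu> / 2)"
        using x' V_nonneg[of x] Y_nonneg[of x] c by (auto intro!: mult_nonneg_nonneg)
      then show "\<exists>y. (pohozaev n q c V Y has_real_derivative y) (at x) \<and> 0 \<le> y"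
        using pohozaev_has_real_derivative[OF n_ge x'(1) _ deriv_V deriv_Y, of c] x' V_pos[of x]
        by (metis less_irrefl)
    qed (use s in auto)
    moreover have "V s * Y s \<le> 1 * Y s"
      using s t V_le_1[of s] Y_nonneg[of s] by (intro mult_right_mono) auto
    then have "\<nu> / 2 * (V s * Y s) \<le> \<nu> / 2 * Y s"
      using nu_pos by (intro mult_left_mono) auto
    moreover have "0 \<le> (Y s)\<^sup>2 / s ^ (n - 2) / 2 + c * s ^ n * \<bar>V s\<bar> powr (q + 2)"
      using c s tau_nonneg by (intro add_nonneg_nonneg mult_nonneg_nonneg divide_nonneg_nonneg) auto
    ultimately show "- (\<nu> / 2) * Y s \<le> pohozaev n q c V Y t"
      unfolding pohozaev_def mult.assoc by linarith
  qed
  \<comment> \<open>If \<tau> = 0 the term \<open>Y ^ 2 / t ^ (n - 2)\<close> cannot simply be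
    evaluated at the start. The bound \<open>le\<close> has dropped it by sign, so only continuity
    of \<open>Y\<close> is needed for the limit.\<close>
  have "(Y \<longlongrightarrow> Y \<tau>) (at_right \<tau>)"
    using cont_Y tau_less T_less
    by (metis continuous_on_def at_within_Icc_at_right atLeastAtMost_iff less_eq_real_def order_less_trans)
  then have "((\<lambda>s. - (\<nu> / 2) * Y s) \<longlongrightarrow> - (\<nu> / 2) * Y \<tau>) (at_right \<tau>)"
    by (intro tendsto_intros)
  moreover have "\<forall>\<^sub>F s in at_right \<tau>. - (\<nu> / 2) * Y s \<le> pohozaev n q c V Y t"
    using le t by (auto simp: eventually_at_right[OF t(1)])
  ultimately have "- (\<nu> / 2) * Y \<tau> \<le> pohozaev n q c V Y t"
    by (rule tendsto_upperbound) simp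
  then show ?thesis
    by (simp add: c_def Y_tau)
qed

text \<open>For the bubble \<open>(1 + t\<^sup>2 / (n * \<nu>)) powr - (\<nu> / 2)\<close> the
  quotient is the constant \<open>1 / n\<close>.\<close>

lemma quotient_mono:
  assumes "\<tau> < a" "a \<le> t" "t < T"
  shows "Y a * V a powr - (real n / \<nu>) / a ^ n
    \<le> Y t * V t powr - (real n / \<nu>) / t ^ n"
proof (rule DERIV_nonneg_imp_nondecreasing[OF assms(2)])
  fix x assume x: "a \<le> x" "x \<le> t"
  then have x': "0 < x" "\<tau> < x" "x < T" "x < S"
    using assms tau_nonneg T_less by auto
  obtain k where k: "n = k + 3"
    using n_ge by (metis add.commute le_Suc_ex)
  define r where "r = - (real n / \<nu>)"
  have r: "r * \<nu> = - real n"
    using nu_pos by (simp add: r_def)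
  define p where "p = pohozaev n q (\<nu> / (2 * real n)) V Y x"
  have Vx: "0 < V x" using V_pos x' by simp
  define v w z where "v = \<bar>V x\<bar> powr q * V x" and "w = V x powr r" and "z = x ^ k"
  have z: "0 < z" using x' by (simp add: z_def)
  have p: "p = (Y x)\<^sup>2 / (z * x) / 2 + \<nu> / (2 * real n) * (z * x ^ 3) * (v * V x)
      - \<nu> / 2 * V x * Y x"
  proof -
    have "\<bar>V x\<bar> powr (q + 2) = v * V x"
      using Vx by (simp add: v_def powr_add powr_numeral power2_eq_square)
    moreover have "x ^ (n - 2) = z * x" "x ^ n = z * x ^ 3"
      by (simp_all add: k z_def power_add)
    ultimately show ?thesis
      unfolding p_def pohozaev_def by simp
  qed
  have deriv: "((\<lambda>t. Y t * V t powr r / t ^ n) has_real_derivative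
      ((x ^ (n - 1) * v * w + r * V x powr (r - of_nat 1) * - (Y x / x ^ (n - 1)) * Y x) * x ^ n
        - Y x * w * (real n * x ^ (n - Suc 0))) / (x ^ n * x ^ n)) (at x)"
    unfolding v_def w_def using x'
    by (intro DERIV_divide DERIV_mult DERIV_fun_powr deriv_V deriv_Y DERIV_pow Vx) auto
  have e1: "V x powr (r - of_nat 1) = w / V x"
    using Vx by (simp add: w_def powr_diff)
  \<comment> \<open>The derivative of the quotient is a positive factor times the Pohozaev
    functional \<open>p\<close>; this dictates the exponent \<open>r\<close>.\<close>
  have e2: "((x ^ (n - 1) * v * w + r * (w / V x) * - (Y x / x ^ (n - 1)) * Y x) * x ^ n
        - Y x * w * (real n * x ^ (n - Suc 0))) / (x ^ n * x ^ n)
      = w / V x / (z * x ^ 4) * (2 * real n / \<nu>) * p"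
  proof -
    have 1: "x ^ (n - 1) = z * x ^ 2" "x ^ n = z * x ^ 3" "x ^ (n - Suc 0) = z * x ^ 2"
      by (auto simp: k z_def power_add power2_eq_square)
    have "w / V x / (z * x ^ 4) * (2 * real n / \<nu>) * p
        = w / V x / (z * x ^ 4) * (- r * (Y x)\<^sup>2 / (z * x) + z * x ^ 3 * (v * V x) - real n * V x * Y x)"
    proof -
      define d N where "d = real n - 2" and "N = real n"
      have "d \<noteq> 0" "N \<noteq> 0" using nu_pos n_ge by (auto simp: d_def N_def)
      then have "2 * N / d * ((Y x)\<^sup>2 / (z * x) / 2 + d / (2 * N) * (z * x ^ 3) * (v * V x) - d / 2 * V x * Y x)
          = N / d * (Y x)\<^sup>2 / (z * x) + z * x ^ 3 * (v * V x) - N * V x * Y x"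
        by (simp add: algebra_simps)
      then show ?thesis
        unfolding p r_def d_def N_def by (simp only: mult.assoc minus_minus)
    qed
    also have "\<dots> = ((z * x ^ 2 * v * w + r * (w / V x) * - (Y x / (z * x ^ 2)) * Y x) * (z * x ^ 3)
        - Y x * w * (real n * (z * x ^ 2))) / ((z * x ^ 3) * (z * x ^ 3))"
    proof -
      have "x \<noteq> 0" "z \<noteq> 0" "V x \<noteq> 0" using Vx z x'(1) by auto
      then show ?thesis
        unfolding power2_eq_square power3_eq_cube power4_eq_xxxx by (simp add: field_simps)
    qed
    finally show ?thesis unfolding 1 by simp
  qed
  have "0 \<le> w / V x / (z * x ^ 4) * (2 * real n / \<nu>) * p"
    using Vx z x' nu_pos pohozaev_nonneg[of x] unfolding p_def[symmetric]
    by (intro mult_nonneg_nonneg divide_nonneg_nonneg) (auto simp: w_def)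
  then show "\<exists>y. ((\<lambda>t. Y t * V t powr - (real n / \<nu>) / t ^ n) has_real_derivative y) (at x) \<and> 0 \<le> y"
    using deriv[unfolded e1 e2] unfolding r_def by blast
qed

text \<open>\<open>V powr - (2 / \<nu>)\<close> has derivative \<open>2 * t / \<nu>\<close> times
  the quotient, and the quotient is at least \<open>g * \<nu>\<close> from time \<open>a\<close> on.
  Hence it grows at least like \<open>g * t\<^sup>2\<close>, and a power of this gives a bubble.
  Before \<open>a\<close> the bound holds because its right side is at least 1.\<close>

lemma V_upper:
  assumes a: "\<tau> < a" "a < T" and g: "0 \<le> g" "g * a\<^sup>2 < 1" "g * \<nu> \<le> Y a / a ^ n"
    and t: "\<tau> \<le> t" "t < T"
  shows "V t \<le> (1 - g * a\<^sup>2 + g * t\<^sup>2) powr - (\<nu> / 2)"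
proof (cases "a \<le> t")
  case False
  have t0: "0 \<le> t" using t tau_nonneg by simp
  have le: "1 - g * a\<^sup>2 + g * t\<^sup>2 \<le> 1"
    using False g t0 by (simp add: mult_left_mono)
  have "0 < 1 - g * a\<^sup>2 + g * t\<^sup>2"
    using g by (intro add_pos_nonneg) auto
  then have "1 powr - (\<nu> / 2) \<le> (1 - g * a\<^sup>2 + g * t\<^sup>2) powr - (\<nu> / 2)"
    using le nu_pos by (intro powr_mono2') auto
  then show ?thesis
    using V_le_1[of t] t by simp
next
  case True
  define f where "f s = V s powr - (2 / \<nu>) - g * s\<^sup>2" for s
  have one_le: "1 \<le> V a powr r" if "r \<le> 0" for r
    using powr_mono2'[OF that, of "V a" 1] V_le_1[of a] V_pos[of a] a that by simp
  have "f a \<le> f t"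
  proof (rule DERIV_nonneg_imp_nondecreasing[OF True])
    fix x assume x: "a \<le> x" "x \<le> t"
    then have x': "0 < x" "\<tau> < x" "x < T" "x < S"
      using a t tau_nonneg T_less by auto
    have Vx: "0 < V x" using V_pos x' by simp
    define Q where "Q = Y x * V x powr - (real n / \<nu>) / x ^ n"
    have "g * \<nu> \<le> Y a / a ^ n" by fact
    also have "Y a / a ^ n * 1 \<le> Y a / a ^ n * V a powr - (real n / \<nu>)"
      using nu_pos Y_nonneg[of a] a tau_nonneg by (intro mult_left_mono one_le) auto
    then have "Y a / a ^ n \<le> Y a * V a powr - (real n / \<nu>) / a ^ n"
      by simp
    also have "\<dots> \<le> Q"
      using quotient_mono[of a x] a x t by (simp add: Q_def)
    finally have Q: "g * \<nu> \<le> Q" .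
    have "((\<lambda>s. V s powr - (2 / \<nu>) - g * s\<^sup>2) has_real_derivative
        - (2 / \<nu>) * V x powr (- (2 / \<nu>) - of_nat 1) * - (Y x / x ^ (n - 1))
          - g * (real 2 * x ^ (2 - Suc 0))) (at x)"
      using x' by (intro DERIV_diff DERIV_fun_powr deriv_V DERIV_cmult DERIV_pow Vx) auto
    moreover have "- (2 / \<nu>) - of_nat 1 = - (real n / \<nu>)"
      using nu_pos by (simp add: field_simps)
    moreover have "- (2 / \<nu>) * V x powr - (real n / \<nu>) * - (Y x / x ^ (n - 1))
        = 2 * x * Q / \<nu>"
    proof -
      have "x ^ n = x * x ^ (n - 1)" using n_ge by (cases n) auto
      then show ?thesis
        unfolding Q_def using x'(1) nu_pos by (simp add: field_simps)
    qed
    moreover have "g * (real 2 * x ^ (2 - Suc 0)) \<le> 2 * x * Q / \<nu>"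
      using mult_left_mono[OF Q, of "2 * x"] nu_pos x'(1) by (simp add: field_simps)
    ultimately show "\<exists>y. (f has_real_derivative y) (at x) \<and> 0 \<le> y"
      unfolding f_def[abs_def] by auto
  qed
  moreover have "1 \<le> V a powr - (2 / \<nu>)"
    using one_le nu_pos by simp
  ultimately have le: "1 - g * a\<^sup>2 + g * t\<^sup>2 \<le> V t powr - (2 / \<nu>)"
    by (simp add: f_def)
  have "0 < 1 - g * a\<^sup>2 + g * t\<^sup>2"
    using g by (intro add_pos_nonneg) auto
  then have "(V t powr - (2 / \<nu>)) powr - (\<nu> / 2)
      \<le> (1 - g * a\<^sup>2 + g * t\<^sup>2) powr - (\<nu> / 2)"
    using le nu_pos by (intro powr_mono2') auto
  moreover have "(V t powr - (2 / \<nu>)) powr - (\<nu> / 2) = V t"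
  proof -
    have "- (2 / \<nu>) * - (\<nu> / 2) = 1"
      using nu_pos by simp
    then show ?thesis
      using V_pos'[of t] t by (simp only: powr_powr) simp
  qed
  ultimately show ?thesis by simp
qed

text \<open>The upper barrier bounds the source, hence the flux, hence the decrease of
  \<open>V\<close>; both integrations are explicit. With \<open>b = 1\<close>,
  \<open>g = 1 / (n * \<nu>)\<close> and critical \<open>q\<close> the left side is exactly the
  bubble at \<open>R\<close>, so nothing is lost in the limit.\<close>

lemma V_lower:
  assumes upper: "\<And>s. \<tau> \<le> s \<Longrightarrow> s < T \<Longrightarrow> V s \<le> (b + g * s\<^sup>2) powr - (\<nu> / 2)"
    and b: "0 < b" and g: "0 < g" and t: "\<tau> \<le> t" "t \<le> T" "t \<le> R"
  shows "1 - (b + g * R\<^sup>2) powr ((4 / \<nu> - q) * \<nu> / 2) / (real n * \<nu> * b * g)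
          * (b powr - (\<nu> / 2) - (b + g * R\<^sup>2) powr - (\<nu> / 2)) \<le> V t"
proof -
  define e where "e = (4 / \<nu> - q) * \<nu> / 2"
  have e: "e = 2 - q * \<nu> / 2"
    using nu_pos by (simp add: e_def field_simps)
  have e0: "0 \<le> e"
    using q_sub nu_pos by (simp add: e_def)
  define D where "D s = b + g * s\<^sup>2" for s
  have D: "0 < D s" for s
    using b g by (simp add: D_def add_pos_nonneg)
  have D_mono: "D s \<le> D r" if "0 \<le> s" "s \<le> r" for s r
    using that g by (simp add: D_def power_mono)
  have dD: "(D has_real_derivative 2 * g * s) (at s)" for s
    unfolding D_def[abs_def] by (auto intro!: derivative_eq_intros)
  \<comment> \<open>The source of the barrier is \<open>D powr (- n / 2 - 1)\<close> times
    \<open>D powr e\<close>, where \<open>e\<close> measures the distance to the critical exponent.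
    Freezing \<open>D powr e\<close> at \<open>R\<close> leaves a function with an elementary
    antiderivative.\<close>
  define K where "K = D R powr e / (real n * b)"
  have K: "0 \<le> K" using b by (simp add: K_def)
  have n0: "0 < real n" using n_ge by simp
  have Y: "Y s \<le> K * (s ^ n * D s powr - (real n / 2))" if s: "\<tau> \<le> s" "s \<le> T" "s \<le> R" for s
  proof -
    have "K * (\<tau> ^ n * D \<tau> powr - (real n / 2)) - Y \<tau> \<le> K * (s ^ n * D s powr - (real n / 2)) - Y s"
    proof (rule DERIV_nonneg_imp_increasing_open[OF s(1)])
      fix x assume x: "\<tau> < x" "x < s"
      then have x': "0 < x" "\<tau> < x" "x < T" "x < S" "x \<le> R"
        using s tau_nonneg T_less by auto
      have deriv: "((\<lambda>s. K * (s ^ n * D s powr - (real n / 2)) - Y s) has_real_derivative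
          K * (real n * x ^ (n - Suc 0) * D x powr - (real n / 2)
            + - (real n / 2) * D x powr (- (real n / 2) - of_nat 1) * (2 * g * x) * x ^ n)
          - x ^ (n - 1) * (\<bar>V x\<bar> powr q * V x)) (at x)"
        using x' by (intro DERIV_diff DERIV_cmult DERIV_mult DERIV_pow DERIV_fun_powr dD deriv_Y D) auto
      \<comment> \<open>The terms combine because \<open>D x - g * x\<^sup>2 = b\<close>.\<close>
      have e1: "real n * x ^ (n - Suc 0) * D x powr - (real n / 2)
            + - (real n / 2) * D x powr (- (real n / 2) - of_nat 1) * (2 * g * x) * x ^ n
          = real n * b * (x ^ (n - 1) * D x powr (- (real n / 2) - 1))"
      proof -
        have 1: "D x powr - (real n / 2) = D x powr (- (real n / 2) - 1) * D x"
          using D[of x] by (simp add: powr_diff)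
        have 2: "x ^ n = x * x ^ (n - 1)"
          using n_ge by (cases n) auto
        show ?thesis
          unfolding 1 2 by (simp add: D_def algebra_simps power2_eq_square)
      qed
      have e2: "K * (real n * b * (x ^ (n - 1) * D x powr (- (real n / 2) - 1)))
          = x ^ (n - 1) * (D R powr e * D x powr (- (real n / 2) - 1))"
        using b n0 by (simp add: K_def)
      have "\<bar>V x\<bar> powr q * V x \<le> D R powr e * D x powr (- (real n / 2) - 1)"
      proof -
        have "\<bar>V x\<bar> powr q * V x = V x powr (q + 1)"
          using V_pos[of x] x' by (intro source_eq) auto
        also have "\<dots> \<le> (D x powr - (\<nu> / 2)) powr (q + 1)"
          using V_pos[of x] x' upper[of x] q_pos by (intro powr_mono2) (auto simp: D_def)
        also have "\<dots> = D x powr e * D x powr (- (real n / 2) - 1)"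
          unfolding powr_powr powr_add[symmetric] e
          by (rule arg_cong[where f = "\<lambda>r. D x powr r"]) (simp add: field_simps)
        also have "\<dots> \<le> D R powr e * D x powr (- (real n / 2) - 1)"
          using D_mono[of x R] x' D[of x] e0 by (intro mult_right_mono powr_mono2) auto
        finally show ?thesis .
      qed
      then have "0 \<le> x ^ (n - 1) * (D R powr e * D x powr (- (real n / 2) - 1))
          - x ^ (n - 1) * (\<bar>V x\<bar> powr q * V x)"
        using x'(1) by (simp add: mult_left_mono)
      then show "\<exists>y. ((\<lambda>s. K * (s ^ n * D s powr - (real n / 2)) - Y s) has_real_derivative y) (at x) \<and> 0 \<le> y"
        using deriv[unfolded e1 e2] by blast
    next
      show "continuous_on {\<tau>..s} (\<lambda>s. K * (s ^ n * D s powr - (real n / 2)) - Y s)"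
        using s T_less less_imp_neq[OF D, symmetric] unfolding D_def
        by (intro continuous_intros cont_Y_sub) auto
    qed
    moreover have "0 \<le> K * (\<tau> ^ n * D \<tau> powr - (real n / 2))"
      using K tau_nonneg by simp
    ultimately show ?thesis
      by (simp add: Y_tau)
  qed
  define L where "L = K / (\<nu> * g)"
  have L: "0 \<le> L" using K g nu_pos by (simp add: L_def)
  have "V \<tau> - L * D \<tau> powr - (\<nu> / 2) \<le> V t - L * D t powr - (\<nu> / 2)"
  proof (rule DERIV_nonneg_imp_increasing_open[OF t(1)])
    fix x assume x: "\<tau> < x" "x < t"
    then have x': "0 < x" "\<tau> < x" "x < T" "x < S" "x \<le> R"
      using t tau_nonneg T_less by auto
    have "((\<lambda>s. V s - L * D s powr - (\<nu> / 2)) has_real_derivative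
        - (Y x / x ^ (n - 1)) - L * (- (\<nu> / 2) * D x powr (- (\<nu> / 2) - of_nat 1) * (2 * g * x))) (at x)"
      using x' by (intro DERIV_diff DERIV_cmult DERIV_fun_powr dD deriv_V D) auto
    moreover have "- (\<nu> / 2) - of_nat 1 = - (real n / 2)"
      by (simp add: field_simps)
    moreover have "L * (- (\<nu> / 2) * D x powr - (real n / 2) * (2 * g * x))
        = - (K * x * D x powr - (real n / 2))"
      using nu_pos g by (simp add: L_def field_simps)
    moreover have "Y x / x ^ (n - 1) \<le> K * x * D x powr - (real n / 2)"
    proof -
      have "x ^ n = x * x ^ (n - 1)"
        using n_ge by (cases n) auto
      then show ?thesis
        using Y[of x] x' t by (simp add: field_simps)
    qed
    ultimately have "((\<lambda>s. V s - L * D s powr - (\<nu> / 2)) has_real_derivative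
        - (Y x / x ^ (n - 1)) - - (K * x * D x powr - (real n / 2))) (at x)"
      and "0 \<le> - (Y x / x ^ (n - 1)) - - (K * x * D x powr - (real n / 2))"
      by (simp_all only: diff_minus_eq_add)
    then show "\<exists>y. ((\<lambda>s. V s - L * D s powr - (\<nu> / 2)) has_real_derivative y) (at x) \<and> 0 \<le> y"
      by blast
  next
    show "continuous_on {\<tau>..t} (\<lambda>s. V s - L * D s powr - (\<nu> / 2))"
      using t T_less less_imp_neq[OF D, symmetric] unfolding D_def
      by (intro continuous_intros cont_V_sub) auto
  qed
  then have "1 - L * (D \<tau> powr - (\<nu> / 2) - D t powr - (\<nu> / 2)) \<le> V t"
    by (simp add: V_tau algebra_simps)
  moreover have "D \<tau> powr - (\<nu> / 2) \<le> b powr - (\<nu> / 2)"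
    using b g nu_pos D_mono[of 0 \<tau>] tau_nonneg by (intro powr_mono2') (auto simp: D_def)
  moreover have "D R powr - (\<nu> / 2) \<le> D t powr - (\<nu> / 2)"
    using D[of t] nu_pos D_mono[of t R] tau_nonneg t by (intro powr_mono2') auto
  ultimately have "1 - L * (b powr - (\<nu> / 2) - D R powr - (\<nu> / 2)) \<le> V t"
    using mult_left_mono[OF _ L, of "D \<tau> powr - (\<nu> / 2) - D t powr - (\<nu> / 2)"
        "b powr - (\<nu> / 2) - D R powr - (\<nu> / 2)"] by linarith
  then show ?thesis
    by (simp add: L_def K_def D_def e_def mult_ac)
qed

section \<open>Pohozaev balance up to the zero\<close>

text \<open>Only the quotient term at \<open>t = 0\<close> is delicate. There \<open>Y\<close>
  vanishes to order \<open>n\<close>, so the quotient tends to 0, which agrees with the default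
  value of \<open>0 / 0\<close>.\<close>

lemma pohozaev_cont: "continuous_on {\<tau>..S} (pohozaev n q c V Y)"
proof -
  have "continuous_on {\<tau>..S} (\<lambda>t. (Y t)\<^sup>2 / t ^ (n - 2))"
    unfolding continuous_on_def
  proof
    fix x assume x: "x \<in> {\<tau>..S}"
    have lim: "(Y \<longlongrightarrow> Y x) (at x within {\<tau>..S})"
      using cont_Y x unfolding continuous_on_def by auto
    show "((\<lambda>t. (Y t)\<^sup>2 / t ^ (n - 2)) \<longlongrightarrow> (Y x)\<^sup>2 / x ^ (n - 2)) (at x within {\<tau>..S})"
    proof (cases "x = 0")
      case False
      then show ?thesis
        using lim by (intro tendsto_intros) auto
    next
      case True
      then have tau: "\<tau> = 0" using x tau_nonneg by simp
      have "((\<lambda>t. (Y t)\<^sup>2 / t ^ (n - 2)) \<longlongrightarrow> 0) (at_right 0)"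
      proof (rule tendsto_sandwich[of "\<lambda>_. 0" _ _ "\<lambda>t. t ^ (n + 2)"])
        have "(Y t)\<^sup>2 / t ^ (n - 2) \<le> t ^ (n + 2)" if "0 < t" "t < T" for t
        proof -
          have "Y t \<le> t ^ n / real n" "0 \<le> Y t"
            using Y_le[of t] Y_nonneg[of t] that tau by auto
          moreover have "t ^ n / real n \<le> t ^ n"
            using that n_ge by (simp add: divide_le_eq mult_left_le)
          ultimately have "(Y t)\<^sup>2 \<le> (t ^ n)\<^sup>2"
            by (intro power_mono) auto
          also have "(t ^ n)\<^sup>2 = t ^ (n + 2) * t ^ (n - 2)"
            unfolding power_mult[symmetric] power_add[symmetric]
            using n_ge by (intro arg_cong[where f = "\<lambda>i. t ^ i"]) simp
          finally show ?thesis
            using that by (simp add: divide_le_eq)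
        qed
        then show "\<forall>\<^sub>F t in at_right 0. (Y t)\<^sup>2 / t ^ (n - 2) \<le> t ^ (n + 2)"
          using T_pos by (auto simp: eventually_at_right[OF T_pos])
        show "\<forall>\<^sub>F t in at_right 0. 0 \<le> (Y t)\<^sup>2 / t ^ (n - 2)"
          by (auto simp: eventually_at_right[OF T_pos] intro!: exI[of _ T] T_pos)
        show "((\<lambda>t::real. t ^ (n + 2)) \<longlongrightarrow> 0) (at_right 0)"
          by (auto intro!: tendsto_eq_intros)
      qed simp
      moreover have "at (0::real) within {0..S} = at_right 0"
        using T_pos T_less by (intro at_within_Icc_at_right) simp
      ultimately show ?thesis
        using True tau Y_tau by simp
    qed
  qed
  moreover have "continuous_on {\<tau>..S} (\<lambda>t. \<bar>V t\<bar> powr (q + 2))"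
    using q_pos cont_V by (intro continuous_on_powr' continuous_intros) auto
  moreover have "continuous_on {\<tau>..S} (\<lambda>t. c * t ^ n)"
    and "continuous_on {\<tau>..S} (\<lambda>t. \<nu> / 2 * V t * Y t)"
    by (intro continuous_intros cont_V cont_Y; simp)+
  ultimately show ?thesis
    unfolding pohozaev_def[abs_def]
    by (intro continuous_on_diff continuous_on_add continuous_on_mult[of _ "\<lambda>t. c * t ^ n"]
        continuous_on_divide[of _ "\<lambda>t. (Y t)\<^sup>2 / t ^ (n - 2)"] continuous_on_const) auto
qed

lemma pohozaev_deriv_standard:
  assumes t: "\<tau> < t" "t < S" "V t \<noteq> 0"
  shows "(pohozaev n q (1 / (q + 2)) V Y has_real_derivative
     (real n / (q + 2) - \<nu> / 2) * (t ^ (n - 1) * \<bar>V t\<bar> powr (q + 2))) (at t)"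
  using pohozaev_has_real_derivative[OF n_ge _ t(3) deriv_V[OF t(1,2)] deriv_Y[OF t(1,2)], of "1 / (q + 2)"]
    t tau_nonneg q_pos by (simp add: mult.commute)

text \<open>At \<tau> the flux vanishes and \<open>V = 1\<close>; at \<open>T\<close> the function
  vanishes. So the functional reduces to one term at each end.\<close>

lemma pohozaev_inner_integral:
  "((\<lambda>t. (real n / (q + 2) - \<nu> / 2) * (t ^ (n - 1) * \<bar>V t\<bar> powr (q + 2))) has_integral
      ((Y T)\<^sup>2 / T ^ (n - 2) / 2 - \<tau> ^ n / (q + 2))) {\<tau>..T}"
proof -
  have "((\<lambda>t. (real n / (q + 2) - \<nu> / 2) * (t ^ (n - 1) * \<bar>V t\<bar> powr (q + 2))) has_integral
      (pohozaev n q (1 / (q + 2)) V Y T - pohozaev n q (1 / (q + 2)) V Y \<tau>)) {\<tau>..T}"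
  proof (rule fundamental_theorem_of_calculus_interior)
    show "continuous_on {\<tau>..T} (pohozaev n q (1 / (q + 2)) V Y)"
      using T_less by (intro continuous_on_subset[OF pohozaev_cont]) auto
    show "(pohozaev n q (1 / (q + 2)) V Y has_vector_derivative
       (real n / (q + 2) - \<nu> / 2) * (t ^ (n - 1) * \<bar>V t\<bar> powr (q + 2))) (at t)"
      if "t \<in> {\<tau><..<T}" for t
      using pohozaev_deriv_standard[of t] V_pos[of t] that T_less
      by (auto simp: has_real_derivative_iff_has_vector_derivative)
  qed (use tau_less in simp)
  then show ?thesis
    using q_pos by (simp add: pohozaev_def V_T V_tau Y_tau)
qed

lemma flux_integral:
  "((\<lambda>t. t ^ (n - 1) * (\<bar>V t\<bar> powr q * V t)) has_integral Y T) {\<tau>..T}"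
proof -
  have "((\<lambda>t. t ^ (n - 1) * (\<bar>V t\<bar> powr q * V t)) has_integral (Y T - Y \<tau>)) {\<tau>..T}"
    using tau_less T_less deriv_Y
    by (intro fundamental_theorem_of_calculus_interior cont_Y_sub)
      (auto simp flip: has_real_derivative_iff_has_vector_derivative)
  then show ?thesis by (simp add: Y_tau)
qed

section \<open>The part of an arc beyond its zero\<close>

lemma Y_outer_antimono:
  assumes "T \<le> s" "s \<le> t" "t \<le> S"
  shows "Y t \<le> Y s"
proof (rule DERIV_nonpos_imp_decreasing_open[OF assms(2)])
  fix x assume x: "s < x" "x < t"
  have "x ^ (n - 1) * (\<bar>V x\<bar> powr q * V x) \<le> 0"
    using x assms V_neg[of x] T_pos by (intro mult_nonneg_nonpos) auto
  then show "\<exists>y. (Y has_real_derivative y) (at x) \<and> y \<le> 0"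
    using deriv_Y[of x] x assms tau_less by auto
qed (use assms tau_less in \<open>auto intro: cont_Y_sub\<close>)

lemma Y_outer_nonneg: "T \<le> t \<Longrightarrow> t \<le> S \<Longrightarrow> 0 \<le> Y t"
  using Y_outer_antimono[of t S] Y_S by simp

lemma V_outer_antimono:
  assumes "T \<le> s" "s \<le> t" "t \<le> S"
  shows "V t \<le> V s"
proof (rule DERIV_nonpos_imp_decreasing_open[OF assms(2)])
  fix x assume x: "s < x" "x < t"
  have "- (Y x / x ^ (n - 1)) \<le> 0"
    using x assms Y_outer_nonneg[of x] T_pos by simp
  then show "\<exists>y. (V has_real_derivative y) (at x) \<and> y \<le> 0"
    using deriv_V[of x] x assms tau_less by auto
qed (use assms tau_less in \<open>auto intro: cont_V_sub\<close>)

lemma V_outer_bound: "T < t \<Longrightarrow> t \<le> S \<Longrightarrow> \<bar>V t\<bar> \<le> \<bar>V S\<bar>"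
  using V_outer_antimono[of t S] V_neg[of t] V_neg[of S] T_less by simp

lemma outer_source_eq:
  assumes "T < t" "t \<le> S"
  shows "\<bar>V t\<bar> powr q * V t = - (\<bar>V t\<bar> powr (q + 1))"
  using V_neg[OF assms] powr_mult_base[of "\<bar>V t\<bar>" q] by (simp add: algebra_simps)

text \<open>Past \<open>T\<close> the flux only decreases, so \<open>- V\<close> stays below the
  harmonic function that keeps the flux \<open>Y T\<close> out to infinity.\<close>

lemma outer_amplitude_le: "\<bar>V S\<bar> \<le> Y T / (\<nu> * T ^ (n - 2))"
proof -
  define f where "f t = - V t + Y T / (\<nu> * t ^ (n - 2))" for t
  have "f S \<le> f T"
  proof (rule DERIV_nonpos_imp_decreasing_open[where f = f])
    fix x assume x: "T < x" "x < S"
    have x0: "0 < x" using x T_pos by simp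
    have "(f has_real_derivative - (- (Y x / x ^ (n - 1))) + - (Y T / x ^ (n - 1))) (at x)"
      unfolding f_def[abs_def] using x x0 tau_less
      by (intro DERIV_add DERIV_minus deriv_V newton_potential_has_real_derivative n_ge) auto
    moreover have "- (- (Y x / x ^ (n - 1))) + - (Y T / x ^ (n - 1)) = (Y x - Y T) / x ^ (n - 1)"
      by (simp add: diff_divide_distrib)
    moreover have "(Y x - Y T) / x ^ (n - 1) \<le> 0"
      using Y_outer_antimono[of T x] x x0 by (simp add: divide_le_0_iff)
    ultimately show "\<exists>y. (f has_real_derivative y) (at x) \<and> y \<le> 0"
      by auto
  next
    show "continuous_on {T..S} f"
      unfolding f_def[abs_def] using T_pos tau_less nu_pos
      by (intro continuous_intros cont_V_sub) auto
  qed (use T_less in simp)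
  moreover have "0 \<le> Y T / (\<nu> * S ^ (n - 2))"
    using Y_nonneg[of T] tau_less T_pos T_less nu_pos by simp
  ultimately show ?thesis
    using V_neg[of S] T_less by (simp add: f_def V_T)
qed

text \<open>The flux lost between \<open>T\<close> and \<open>t\<close> is controlled by the largest
  source, which is the one at \<open>S\<close>.\<close>

lemma Y_outer_ge:
  assumes "T \<le> t" "t \<le> S"
  shows "Y T - \<bar>V S\<bar> powr (q + 1) * t ^ n / n \<le> Y t"
proof -
  define v where "v = \<bar>V S\<bar> powr (q + 1)"
  have "Y T + v * (T ^ n / n) \<le> Y t + v * (t ^ n / n)"
  proof (rule DERIV_nonneg_imp_increasing_open[OF assms(1)])
    fix x assume x: "T < x" "x < t"
    have "\<bar>V x\<bar> powr (q + 1) \<le> v"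
      unfolding v_def
      using x assms V_outer_bound[of x] q_pos by (intro powr_mono2) auto
    then have "0 \<le> x ^ (n - 1) * (v - \<bar>V x\<bar> powr (q + 1))"
      using x T_pos by (intro mult_nonneg_nonneg) auto
    moreover have "((\<lambda>x. Y x + v * (x ^ n / n)) has_real_derivative
        x ^ (n - 1) * (\<bar>V x\<bar> powr q * V x) + v * (real n * x ^ (n - 1) / n)) (at x)"
      using x assms tau_less DERIV_pow[of n x]
      by (intro DERIV_add DERIV_cmult DERIV_cdivide deriv_Y) auto
    moreover have "x ^ (n - 1) * (\<bar>V x\<bar> powr q * V x) + v * (real n * x ^ (n - 1) / n)
        = x ^ (n - 1) * (v - \<bar>V x\<bar> powr (q + 1))"
      using n_ge x assms by (subst outer_source_eq) (auto simp: algebra_simps)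
    ultimately show "\<exists>y. ((\<lambda>x. Y x + v * (x ^ n / n)) has_real_derivative y) (at x) \<and> 0 \<le> y"
      by auto
  qed (use assms tau_less n_ge in \<open>auto intro!: continuous_intros cont_Y_sub\<close>)
  moreover have "0 \<le> v * (T ^ n / n)"
    using T_pos by (simp add: v_def)
  ultimately show ?thesis
    unfolding v_def[symmetric] by simp
qed

text \<open>Up to radius \<open>R\<close> the flux is at least \<open>Y T\<close> minus the possible
  loss, and a harmonic function with that constant flux lies below \<open>- V\<close>.\<close>

lemma outer_amplitude_ge:
  assumes R: "T \<le> R" and small: "\<bar>V S\<bar> powr (q + 1) * R ^ n / n < Y T"
  shows "(Y T - \<bar>V S\<bar> powr (q + 1) * R ^ n / n) * (1 / T ^ (n - 2) - 1 / R ^ (n - 2))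
    \<le> \<nu> * \<bar>V S\<bar>"
proof -
  define A where "A = Y T - \<bar>V S\<bar> powr (q + 1) * R ^ n / n"
  \<comment> \<open>If \<open>S\<close> came before \<open>R\<close>, too little flux would have
    been lost for it to vanish at \<open>S\<close>.\<close>
  have RS: "R \<le> S"
  proof (rule ccontr)
    assume "\<not> R \<le> S"
    then have "S ^ n \<le> R ^ n"
      using T_pos T_less by (intro power_mono) auto
    then have "\<bar>V S\<bar> powr (q + 1) * S ^ n / n \<le> \<bar>V S\<bar> powr (q + 1) * R ^ n / n"
      by (intro divide_right_mono mult_left_mono) auto
    then show False
      using Y_outer_ge[of S] Y_S T_less small by simp
  qed
  define f where "f t = - V t + A / (\<nu> * t ^ (n - 2))" for t
  have "f T \<le> f R"
  proof (rule DERIV_nonneg_imp_increasing_open[OF R])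
    fix x assume x: "T < x" "x < R"
    have x0: "0 < x" using x T_pos by simp
    have "(f has_real_derivative - (- (Y x / x ^ (n - 1))) + - (A / x ^ (n - 1))) (at x)"
      unfolding f_def[abs_def] using x x0 tau_less RS
      by (intro DERIV_add DERIV_minus deriv_V newton_potential_has_real_derivative n_ge) auto
    moreover have "- (- (Y x / x ^ (n - 1))) + - (A / x ^ (n - 1)) = (Y x - A) / x ^ (n - 1)"
      by (simp add: diff_divide_distrib)
    moreover have "0 \<le> (Y x - A) / x ^ (n - 1)"
    proof -
      have "x ^ n \<le> R ^ n"
        using x x0 by (intro power_mono) auto
      then have "\<bar>V S\<bar> powr (q + 1) * x ^ n / n \<le> \<bar>V S\<bar> powr (q + 1) * R ^ n / n"
        by (intro divide_right_mono mult_left_mono) auto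
      then show ?thesis
        using Y_outer_ge[of x] x RS x0 by (simp add: A_def)
    qed
    ultimately show "\<exists>y. (f has_real_derivative y) (at x) \<and> 0 \<le> y"
      by auto
  next
    show "continuous_on {T..R} f"
      unfolding f_def[abs_def] using T_pos tau_less nu_pos RS
      by (intro continuous_intros cont_V_sub) auto
  qed
  moreover have "- V R \<le> \<bar>V S\<bar>"
    using V_outer_antimono[of R S] R RS by simp
  ultimately have "A / (\<nu> * T ^ (n - 2)) - A / (\<nu> * R ^ (n - 2)) \<le> \<bar>V S\<bar>"
    by (simp add: f_def V_T)
  moreover have "A / (\<nu> * T ^ (n - 2)) - A / (\<nu> * R ^ (n - 2))
      = A * (1 / T ^ (n - 2) - 1 / R ^ (n - 2)) / \<nu>"
  proof -
    define d where "d = real n - 2"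
    have "d \<noteq> 0" using nu_pos by (simp add: d_def)
    then show ?thesis
      unfolding d_def[symmetric] using T_pos R by (simp add: field_simps)
  qed
  ultimately show ?thesis
    using nu_pos by (simp add: A_def divide_le_eq mult.commute)
qed

text \<open>The first bound is monotonicity. For the second,
  \<open>\<bar>V\<bar> \<le> \<bar>V S\<bar>\<close> bounds the growth of the functional by
  \<open>k * \<bar>V S\<bar>\<close> times the loss of flux, and the whole flux \<open>Y T\<close>
  is lost by \<open>S\<close>.\<close>

lemma pohozaev_outer:
  defines "k \<equiv> real n / (q + 2) - \<nu> / 2"
  shows "(Y T)\<^sup>2 / T ^ (n - 2) / 2 \<le> S ^ n * \<bar>V S\<bar> powr (q + 2) / (q + 2)"
    and "S ^ n * \<bar>V S\<bar> powr (q + 2) / (q + 2) \<le> (Y T)\<^sup>2 / T ^ (n - 2) / 2 + k * \<bar>V S\<bar> * Y T"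
proof -
  have k: "0 \<le> k"
    using q_sub q_pos nu_pos by (simp add: k_def field_simps)
  define P where "P = pohozaev n q (1 / (q + 2)) V Y"
  have PT: "P T = (Y T)\<^sup>2 / T ^ (n - 2) / 2"
    using q_pos by (simp add: P_def pohozaev_def V_T)
  have PS: "P S = S ^ n * \<bar>V S\<bar> powr (q + 2) / (q + 2)"
    by (simp add: P_def pohozaev_def Y_S)
  have contP: "continuous_on {T..S} P"
    unfolding P_def using tau_less by (intro continuous_on_subset[OF pohozaev_cont]) auto
  have dP: "(P has_real_derivative k * (x ^ (n - 1) * \<bar>V x\<bar> powr (q + 2))) (at x)" if "T < x" "x < S" for x
    using pohozaev_deriv_standard[of x] V_neg[of x] that tau_less by (auto simp: P_def k_def)
  have "P T \<le> P S"
  proof (rule DERIV_nonneg_imp_increasing_open[where f = P])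
    fix x assume x: "T < x" "x < S"
    have "0 \<le> k * (x ^ (n - 1) * \<bar>V x\<bar> powr (q + 2))"
      using k x T_pos by (intro mult_nonneg_nonneg) auto
    then show "\<exists>y. (P has_real_derivative y) (at x) \<and> 0 \<le> y"
      using dP[OF x] by auto
  qed (use T_less contP in auto)
  then show "(Y T)\<^sup>2 / T ^ (n - 2) / 2 \<le> S ^ n * \<bar>V S\<bar> powr (q + 2) / (q + 2)"
    unfolding PT PS .
  have "P S + k * \<bar>V S\<bar> * Y S \<le> P T + k * \<bar>V S\<bar> * Y T"
  proof (rule DERIV_nonpos_imp_decreasing_open[where f = "\<lambda>x. P x + k * \<bar>V S\<bar> * Y x"])
    fix x assume x: "T < x" "x < S"
    have "((\<lambda>x. P x + k * \<bar>V S\<bar> * Y x) has_real_derivative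
        k * (x ^ (n - 1) * \<bar>V x\<bar> powr (q + 2)) + k * \<bar>V S\<bar> * (x ^ (n - 1) * (\<bar>V x\<bar> powr q * V x))) (at x)"
      using x tau_less by (intro DERIV_add DERIV_cmult dP deriv_Y) auto
    moreover have "k * (x ^ (n - 1) * \<bar>V x\<bar> powr (q + 2)) + k * \<bar>V S\<bar> * (x ^ (n - 1) * (\<bar>V x\<bar> powr q * V x))
        = k * x ^ (n - 1) * \<bar>V x\<bar> powr (q + 1) * (\<bar>V x\<bar> - \<bar>V S\<bar>)"
    proof -
      have "\<bar>V x\<bar> powr (q + 2) = \<bar>V x\<bar> powr (q + 1) * \<bar>V x\<bar>"
        using powr_mult_base[of "\<bar>V x\<bar>" "q + 1"] by (simp add: algebra_simps)
      moreover have "\<bar>V x\<bar> powr q * V x = - (\<bar>V x\<bar> powr (q + 1))"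
        using x by (intro outer_source_eq) auto
      ultimately show ?thesis
        by (simp only:) (simp add: algebra_simps)
    qed
    moreover have "k * x ^ (n - 1) * \<bar>V x\<bar> powr (q + 1) * (\<bar>V x\<bar> - \<bar>V S\<bar>) \<le> 0"
      using k x T_pos V_outer_bound[of x] by (intro mult_nonneg_nonpos mult_nonneg_nonneg) auto
    ultimately show "\<exists>y. ((\<lambda>x. P x + k * \<bar>V S\<bar> * Y x) has_real_derivative y) (at x) \<and> y \<le> 0"
      by auto
  qed (use T_less tau_less contP in \<open>auto intro!: continuous_intros cont_Y_sub\<close>)
  then show "S ^ n * \<bar>V S\<bar> powr (q + 2) / (q + 2) \<le> (Y T)\<^sup>2 / T ^ (n - 2) / 2 + k * \<bar>V S\<bar> * Y T"
    unfolding PT PS Y_S by simp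
qed

end

section \<open>Asymptotics of one arc\<close>

text \<open>The integrable majorant for dominated convergence.\<close>

lemma integrable_inverse_one_plus_square: "(\<lambda>t::real. C / (1 + t\<^sup>2)) integrable_on {0..}"
proof -
  have ftc: "((\<lambda>t::real. 1 / (1 + t\<^sup>2)) has_integral (arctan y - arctan 0)) {0..y}" if "0 \<le> y" for y
    using that
    by (intro fundamental_theorem_of_calculus)
      (auto simp: inverse_eq_divide simp flip: has_real_derivative_iff_has_vector_derivative
        intro!: derivative_eq_intros)
  have "((\<lambda>t::real. 1 / (1 + t\<^sup>2)) has_integral (pi / 2)) {0..}"
  proof (rule has_integral_to_inf)
    show "(\<lambda>t::real. 1 / (1 + t\<^sup>2)) integrable_on {0..y}" for y
      using ftc[of y] by (cases "0 \<le> y") auto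
    have "\<forall>\<^sub>F y in at_top. arctan y = integral {0..y} (\<lambda>t::real. 1 / (1 + t\<^sup>2))"
      using eventually_ge_at_top[of 0] by eventually_elim (use ftc in \<open>auto simp: has_integral_iff\<close>)
    then show "((\<lambda>y. integral {0..y} (\<lambda>t::real. 1 / (1 + t\<^sup>2))) \<longlongrightarrow> pi / 2) at_top"
      by (rule Lim_transform_eventually[OF tendsto_arctan_at_top])
  qed simp
  then have "((\<lambda>t::real. C * (1 / (1 + t\<^sup>2))) has_integral (C * (pi / 2))) {0..}"
    by (rule has_integral_mult_right)
  then show ?thesis
    by (auto simp: integrable_on_def)
qed

section \<open>Integrals of the standard bubble\<close>

lemma bubble_base_pos: "0 < N \<Longrightarrow> 0 < 1 + t\<^sup>2 / N" for t N :: real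
  by (simp add: add_pos_nonneg)

text \<open>This is the total flux of the bubble. The antiderivative is explicit because the
  integrand is itself the source of the bubble equation; it is the \<open>F\<close> below.\<close>

lemma bubble_mass_has_integral:
  fixes N :: real
  assumes n: "1 \<le> n" and N: "0 < N"
  shows "((\<lambda>t. t ^ (n - 1) * (1 + t\<^sup>2 / N) powr - (real (n + 2) / 2)) has_integral (N powr (n / 2) / n)) {0..}"
proof -
  define F where "F t = t ^ n * (1 + t\<^sup>2 / N) powr - (n / 2) / n" for t
  have n0: "real n \<noteq> 0" using n by simp
  have dF: "(F has_real_derivative t ^ (n - 1) * (1 + t\<^sup>2 / N) powr - (real (n + 2) / 2)) (at t)" for t
  proof -
    define B where "B = 1 + t\<^sup>2 / N"
    have B: "0 < B" using bubble_base_pos[OF N] by (simp add: B_def)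
    have "((\<lambda>t. 1 + t\<^sup>2 / N) has_real_derivative 2 * t / N) (at t)"
      using N by (auto intro!: derivative_eq_intros)
    then have d: "(F has_real_derivative
        (real n * t ^ (n - Suc 0) * B powr - (n / 2)
          + - (n / 2) * B powr (- (n / 2) - of_nat 1) * (2 * t / N) * t ^ n) / n) (at t)"
      unfolding F_def[abs_def] B_def
      by (intro DERIV_cdivide DERIV_mult DERIV_pow DERIV_fun_powr bubble_base_pos N)
    have 1: "B powr - (n / 2) = B powr (- (n / 2) - 1) * B"
      using B by (simp add: powr_diff)
    have 2: "t ^ n = t * t ^ (n - 1)"
      using n by (cases n) auto
    have 3: "- (real (n + 2) / 2) = - (n / 2) - 1"
      by (simp add: field_simps)
    have "(real n * t ^ (n - Suc 0) * B powr - (n / 2)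
          + - (n / 2) * B powr (- (n / 2) - of_nat 1) * (2 * t / N) * t ^ n) / n
       = t ^ (n - 1) * B powr - (real (n + 2) / 2)"
      unfolding 1 2 3 using n0 N
      by (simp add: B_def field_simps power2_eq_square)
    with d show ?thesis by (simp add: B_def)
  qed
  have ftc: "((\<lambda>t. t ^ (n - 1) * (1 + t\<^sup>2 / N) powr - (real (n + 2) / 2)) has_integral (F y - F 0)) {0..y}"
    if "0 \<le> y" for y
    using that dF
    by (intro fundamental_theorem_of_calculus)
      (auto simp flip: has_real_derivative_iff_has_vector_derivative intro: has_field_derivative_at_within)
  have F0: "F 0 = 0" using n by (simp add: F_def)
  have Flim: "(F \<longlongrightarrow> N powr (n / 2) / n) at_top"
  proof -
    have "((\<lambda>y::real. (1 / y\<^sup>2 + 1 / N) powr - (n / 2) / n) \<longlongrightarrow> (0 + 1 / N) powr - (n / 2) / n) at_top"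
      using N n0
      by (intro tendsto_intros tendsto_divide_0[OF tendsto_const] filterlim_pow_at_top
          filterlim_at_top_imp_at_infinity filterlim_ident) auto
    moreover have "(0 + 1 / N) powr - (n / 2) = N powr (n / 2)"
      using N by (simp add: powr_minus_divide powr_divide)
    moreover have "\<forall>\<^sub>F y in at_top. (1 / y\<^sup>2 + 1 / N) powr - (n / 2) / n = F y"
      using eventually_gt_at_top[of 0]
    proof eventually_elim
      case (elim y)
      have "1 + y\<^sup>2 / N = y\<^sup>2 * (1 / y\<^sup>2 + 1 / N)"
        using elim by (simp add: field_simps)
      moreover have "(y\<^sup>2) powr - (n / 2) = y powr - real n"
      proof -
        have "y\<^sup>2 = y powr 2" using elim by simp
        then show ?thesis by (simp only: powr_powr) simp
      qed
      ultimately have "(1 + y\<^sup>2 / N) powr - (n / 2) = y powr - real n * (1 / y\<^sup>2 + 1 / N) powr - (n / 2)"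
        using elim N by (simp add: powr_mult)
      then show ?case
        using elim by (simp add: F_def powr_minus powr_realpow)
    qed
    ultimately show ?thesis
      using Lim_transform_eventually by fastforce
  qed
  show ?thesis
  proof (rule has_integral_to_inf)
    show "(\<lambda>t. t ^ (n - 1) * (1 + t\<^sup>2 / N) powr - (real (n + 2) / 2)) integrable_on {0..y}" for y
      using ftc[of y] by (cases "0 \<le> y") auto
    have "\<forall>\<^sub>F y in at_top. F y = integral {0..y} (\<lambda>t. t ^ (n - 1) * (1 + t\<^sup>2 / N) powr - (real (n + 2) / 2))"
      using eventually_ge_at_top[of 0] by eventually_elim (use ftc F0 in \<open>auto simp: has_integral_iff\<close>)
    then show "((\<lambda>y. integral {0..y} (\<lambda>t. t ^ (n - 1) * (1 + t\<^sup>2 / N) powr - (real (n + 2) / 2)))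
        \<longlongrightarrow> N powr (n / 2) / n) at_top"
      by (rule Lim_transform_eventually[OF Flim])
  qed auto
qed

text \<open>The substitution \<open>s = t\<^sup>2 / (N + t\<^sup>2)\<close> maps the half line to
  \<open>[0, 1)\<close> and turns the integral into the Beta integral with both parameters
  \<open>n / 2\<close>. This is where the Gamma quotient in \<open>kappa\<close> comes from.\<close>

lemma bubble_energy_has_integral:
  fixes N :: real
  assumes n: "3 \<le> n" and N: "0 < N"
  shows "((\<lambda>t. t ^ (n - 1) * (1 + t\<^sup>2 / N) powr - real n) has_integral
      (N powr (n / 2) / 2 * (Gamma (n / 2) ^ 2 / Gamma n))) {0..}"
proof -
  define s where "s t = t\<^sup>2 / (N + t\<^sup>2)" for t :: real
  define f where "f x = x powr (n / 2 - 1) * (1 - x) powr (n / 2 - 1)" for x :: real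
  define C where "C = N powr (n / 2) / 2"
  have pos: "0 < N + t\<^sup>2" for t using N by (simp add: add_pos_nonneg)
  have ds: "(s has_real_derivative 2 * t * N / (N + t\<^sup>2)\<^sup>2) (at t)" for t
    unfolding s_def[abs_def] using pos[of t]
    by (auto intro!: derivative_eq_intros simp: field_simps power2_eq_square)
  have s01: "s t \<in> {0..1}" for t
    using pos[of t] N by (auto simp: s_def divide_le_eq)
  have s0: "s 0 = 0" by (simp add: s_def)
  have contf: "continuous_on {0..1} f"
    unfolding f_def[abs_def] using n by (intro continuous_intros continuous_on_powr') auto
  have intf: "f integrable_on {0..1}"
    by (rule integrable_continuous_interval[OF contf])
  have eq: "C * ((2 * t * N / (N + t\<^sup>2)\<^sup>2) *\<^sub>R f (s t)) = t ^ (n - 1) * (1 + t\<^sup>2 / N) powr - real n"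
    if "0 \<le> t" for t
  proof (cases "t = 0")
    case True
    then show ?thesis using n by simp
  next
    case False
    with that have t: "0 < t" by simp
    define P where "P = N + t\<^sup>2"
    have P: "0 < P" using pos by (simp add: P_def)
    have "1 - s t = N / P"
      using P by (simp add: s_def P_def[symmetric] field_simps)
    moreover have "s t = t powr 2 / P"
      using t by (simp add: s_def P_def)
    moreover have "1 + t\<^sup>2 / N = P / N"
      using N by (simp add: P_def field_simps)
    moreover have "t ^ (n - 1) = t powr (real n - 1)"
      using t n by (simp flip: powr_realpow add: of_nat_diff)
    moreover have "2 * t * N / (N + t\<^sup>2)\<^sup>2 = 2 * t * N * P powr - 2"
      using P by (simp add: P_def[symmetric] powr_minus_divide)
    ultimately have "C * ((2 * t * N / (N + t\<^sup>2)\<^sup>2) *\<^sub>R f (s t)) =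
        (N powr (n / 2) / 2) * (2 * t * N * P powr - 2 *
          ((t powr 2 / P) powr (n / 2 - 1) * (N / P) powr (n / 2 - 1)))"
      by (simp add: C_def f_def)
    also have "(t powr 2 / P) powr (n / 2 - 1) = t powr (real n - 2) * P powr - (n / 2 - 1)"
    proof -
      have "2 * (n / 2 - 1) = real n - 2" by simp
      then show ?thesis
        using t P by (simp only: powr_divide powr_powr powr_ge_zero less_imp_le powr_minus_divide) simp
    qed
    also have "(N / P) powr (n / 2 - 1) = N powr (n / 2 - 1) * P powr - (n / 2 - 1)"
      using N P by (simp only: powr_divide less_imp_le powr_minus_divide) simp
    also have "(N powr (n / 2) / 2) * (2 * t * N * P powr - 2 *
          (t powr (real n - 2) * P powr - (n / 2 - 1) * (N powr (n / 2 - 1) * P powr - (n / 2 - 1))))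
      = (t * t powr (real n - 2)) * (N powr (n / 2) * N * N powr (n / 2 - 1))
          * (P powr - 2 * (P powr - (n / 2 - 1) * P powr - (n / 2 - 1)))"
      by (simp only: mult_ac) simp
    also have "t * t powr (real n - 2) = t powr (real n - 1)"
      using t powr_mult_base[of t "real n - 2"] by simp
    also have "N powr (n / 2) * N * N powr (n / 2 - 1) = N powr n"
      using N powr_mult_base[of N "n / 2 - 1"] by (simp add: mult.assoc flip: powr_add)
    also have "P powr - 2 * (P powr - (n / 2 - 1) * P powr - (n / 2 - 1)) = P powr - n"
      by (simp flip: powr_add)
    also have "t powr (real n - 1) * N powr n * P powr - n = t powr (real n - 1) * (P / N) powr - n"
      using N P by (simp add: powr_divide powr_minus_divide)
    finally show ?thesis
      using \<open>1 + t\<^sup>2 / N = P / N\<close> \<open>t ^ (n - 1) = t powr (real n - 1)\<close> by simp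
  qed
  have int: "((\<lambda>t. t ^ (n - 1) * (1 + t\<^sup>2 / N) powr - real n) has_integral (C * integral {0..s y} f)) {0..y}"
    if "0 \<le> y" for y
  proof -
    have "((\<lambda>t. (2 * t * N / (N + t\<^sup>2)\<^sup>2) *\<^sub>R f (s t)) has_integral (integral {s 0..s y} f)) {0..y}"
      using that s01 contf s0
      by (intro has_integral_substitution[where c = 0 and d = 1])
        (auto intro: has_field_derivative_at_within ds)
    then have "((\<lambda>t. C * ((2 * t * N / (N + t\<^sup>2)\<^sup>2) *\<^sub>R f (s t))) has_integral (C * integral {0..s y} f)) {0..y}"
      by (intro has_integral_mult_right) (simp add: s_def)
    then show ?thesis
      by (rule has_integral_eq[rotated]) (use eq in auto)
  qed
  have lim: "((\<lambda>y. C * integral {0..s y} f) \<longlongrightarrow> C * integral {0..1} f) at_top"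
  proof (intro tendsto_mult tendsto_const)
    have "continuous_on {0..1} (\<lambda>x. integral {0..x} f)"
      by (rule indefinite_integral_continuous_1[OF intf])
    then have c: "((\<lambda>x. integral {0..x} f) \<longlongrightarrow> integral {0..1} f) (at 1 within {0..1})"
      by (simp add: continuous_on_def)
    have "((\<lambda>y::real. 1 - N / (N + y\<^sup>2)) \<longlongrightarrow> 1 - 0) at_top"
      by (intro tendsto_intros tendsto_divide_0[OF tendsto_const] filterlim_at_top_imp_at_infinity
          filterlim_tendsto_add_at_top[OF tendsto_const] filterlim_pow_at_top filterlim_ident) auto
    moreover have "1 - N / (N + y\<^sup>2) = s y" for y
      using pos[of y] by (simp add: s_def field_simps)
    ultimately have "(s \<longlongrightarrow> 1) at_top"
      by simp
    moreover have "s y \<noteq> 1" for y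
      using pos[of y] N by (simp add: s_def)
    ultimately have "filterlim s (at 1 within {0..1}) at_top"
      using s01 by (auto simp: filterlim_at)
    then show "((\<lambda>y. integral {0..s y} f) \<longlongrightarrow> integral {0..1} f) at_top"
      by (rule filterlim_compose[OF c])
  qed
  have "integral {0..1} f = Gamma (n / 2) ^ 2 / Gamma n"
    using has_integral_Beta_real[of "n / 2" "n / 2"] n
    by (simp add: f_def[abs_def] has_integral_iff Beta_def power2_eq_square)
  with lim have lim: "((\<lambda>y. C * integral {0..s y} f) \<longlongrightarrow> C * (Gamma (n / 2) ^ 2 / Gamma n)) at_top"
    by simp
  show ?thesis
    unfolding C_def[symmetric]
  proof (rule has_integral_to_inf)
    show "(\<lambda>t. t ^ (n - 1) * (1 + t\<^sup>2 / N) powr - real n) integrable_on {0..y}" for y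
      using int[of y] by (cases "0 \<le> y") auto
    have "\<forall>\<^sub>F y in at_top. C * integral {0..s y} f = integral {0..y} (\<lambda>t. t ^ (n - 1) * (1 + t\<^sup>2 / N) powr - real n)"
      using eventually_ge_at_top[of 0] by eventually_elim (use int in \<open>auto simp: has_integral_iff\<close>)
    then show "((\<lambda>y. integral {0..y} (\<lambda>t. t ^ (n - 1) * (1 + t\<^sup>2 / N) powr - real n))
        \<longlongrightarrow> C * (Gamma (n / 2) ^ 2 / Gamma n)) at_top"
      by (rule Lim_transform_eventually[OF lim])
  qed auto
qed

lemma kappa_pos: "3 \<le> n \<Longrightarrow> 0 < kappa n"
  unfolding kappa_def
  by (intro mult_pos_pos divide_pos_pos zero_less_power Gamma_real_pos) auto

lemma abs_mult_ln_le:
  fixes x :: real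
  assumes "0 < x" "x \<le> 1"
  shows "\<bar>x * ln x\<bar> \<le> 2 * sqrt x"
proof -
  have "ln (1 / sqrt x) \<le> 1 / sqrt x"
    using assms by (intro ln_bound) auto
  then have "- ln x \<le> 2 / sqrt x"
    using assms by (simp add: ln_div ln_sqrt)
  then have "x * - ln x \<le> x * (2 / sqrt x)"
    using assms by (intro mult_left_mono) auto
  also have "x * (2 / sqrt x) = 2 * sqrt x"
    using assms by (simp add: field_simps)
  finally show ?thesis
    using assms by (simp add: abs_mult ln_le_zero_iff)
qed

lemma tendsto_mult_ln_zero:
  fixes x :: "nat \<Rightarrow> real"
  assumes "\<And>i. 0 < x i" and lim: "x \<longlonglongrightarrow> 0"
  shows "(\<lambda>i. x i * ln (x i)) \<longlonglongrightarrow> 0"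
proof (rule Lim_null_comparison)
  show "\<forall>\<^sub>F i in sequentially. norm (x i * ln (x i)) \<le> 2 * sqrt (x i)"
    using order_tendstoD(2)[OF lim, of 1] by (auto elim!: eventually_mono intro!: abs_mult_ln_le assms)
  show "(\<lambda>i. 2 * sqrt (x i)) \<longlonglongrightarrow> 0"
    using lim by (auto intro!: tendsto_eq_intros)
qed

text \<open>Here \<open>j\<close> is the number of bubbles passed before the arc begins, and the
  last assumption says how far the Pohozaev functional has grown by then. All limits below depend on
  the past only through \<open>j\<close>.\<close>

locale nodal_sequence =
  fixes n :: nat and \<epsilon> :: "nat \<Rightarrow> real" and V Y :: "nat \<Rightarrow> real \<Rightarrow> real"
    and \<tau> T S :: "nat \<Rightarrow> real" and j :: real
  assumes arc: "\<And>i. nodal_arc n (4 / (real n - 2) - \<epsilon> i) (V i) (Y i) (\<tau> i) (T i) (S i)"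
    and eps_pos: "\<And>i. 0 < \<epsilon> i" and eps_lim: "\<epsilon> \<longlonglongrightarrow> 0"
    and j_nonneg: "0 \<le> j"
    and tau_lim: "(\<lambda>i. \<tau> i ^ n / (kappa n * \<epsilon> i)) \<longlonglongrightarrow> j * (real n * (real n - 2)) powr (n / 2)"
begin

section \<open>Convergence of the rescaled arcs to the bubble\<close>

abbreviation nu :: real where "nu \<equiv> real n - 2"
abbreviation N :: real where "N \<equiv> real n * (real n - 2)"
abbreviation q :: "nat \<Rightarrow> real" where "q i \<equiv> 4 / (real n - 2) - \<epsilon> i"
abbreviation \<eta> :: "nat \<Rightarrow> real" where "\<eta> i \<equiv> kappa n * \<epsilon> i"
abbreviation amp :: "nat \<Rightarrow> real" where "amp i \<equiv> \<bar>V i (S i)\<bar>"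
abbreviation bubble :: "real \<Rightarrow> real" where "bubble t \<equiv> (1 + t\<^sup>2 / N) powr - (nu / 2)"

lemma n_ge: "3 \<le> n"
  using nodal_arc.n_ge[OF arc[of 0]] .

lemma nu_pos: "0 < nu" and nu_ge: "1 \<le> nu" and N_pos: "0 < N" and n_pos: "0 < real n"
  using n_ge by auto

text \<open>At the zero, \<open>V_ge\<close> forces the square of \<open>T i\<close> to be at least
  \<open>2 * n\<close>.\<close>

lemma T_gt_1: "1 < T i"
proof -
  interpret nodal_arc n "q i" "V i" "Y i" "\<tau> i" "T i" "S i" by (rule arc)
  have "1 - (T i)\<^sup>2 / (2 * n) \<le> 0"
    using V_ge[of "T i"] V_T tau_less by simp
  then have "2 * real n \<le> (T i)\<^sup>2"
    using n_pos by (simp add: field_simps)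
  then have "1\<^sup>2 < (T i)\<^sup>2"
    using n_ge by simp
  then show ?thesis
    using T_pos by (intro power_less_imp_less_base[of 1 2 "T i"]) auto
qed

lemma tau_nonneg: "0 \<le> \<tau> i"
  using nodal_arc.tau_nonneg[OF arc] .

lemma kappa_eps_lim: "(\<lambda>i. \<eta> i) \<longlonglongrightarrow> 0"
  using eps_lim by (auto intro!: tendsto_eq_intros)

lemma kappa_eps_pos: "0 < \<eta> i"
  using kappa_pos[OF n_ge] eps_pos by simp

lemma tau_to_0: "\<tau> \<longlonglongrightarrow> 0"
proof -
  have "(\<lambda>i. \<tau> i ^ n / \<eta> i * \<eta> i) \<longlonglongrightarrow> j * N powr (n / 2) * 0"
    by (intro tendsto_mult tau_lim kappa_eps_lim)
  moreover have "x / y * y = x" if "0 < y" for x y :: real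
    using that by simp
  note this[OF kappa_eps_pos]
  ultimately have "(\<lambda>i. \<tau> i ^ n) \<longlonglongrightarrow> 0"
    by simp
  then have "(\<lambda>i. root n (\<tau> i ^ n)) \<longlonglongrightarrow> root n 0"
    by (rule tendsto_real_root)
  then show ?thesis
    using n_pos tau_nonneg by (simp add: real_root_power_cancel)
qed

text \<open>The time \<open>a i\<close> tends to \<open>0\<close> but is large compared with \<open>\<tau> i\<close>, so that at \<open>a i\<close> the flux is
  asymptotically \<open>t ^ n / n\<close>, as for the standard bubble.\<close>

definition a :: "nat \<Rightarrow> real" where "a i = sqrt (\<tau> i) + \<epsilon> i"

text \<open>A computable lower bound for \<open>Y / (nu * t ^ n)\<close> at the time
  \<open>a i\<close>, obtained from \<open>Y_ge\<close> and \<open>V_ge\<close>; it is the bubble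
  parameter to be fed into \<open>V_upper\<close>.\<close>

definition g :: "nat \<Rightarrow> real" where
  "g i = (1 - (a i)\<^sup>2 / (2 * n)) powr (q i + 1) * (1 - (\<tau> i / a i) ^ n) / N"

definition b :: "nat \<Rightarrow> real" where "b i = 1 - g i * (a i)\<^sup>2"

lemma a_pos: "0 < a i"
  using eps_pos[of i] tau_nonneg[of i] by (simp add: a_def add_nonneg_pos)

lemma a_lim: "a \<longlonglongrightarrow> 0"
  unfolding a_def[abs_def] using tau_to_0 eps_lim by (auto intro!: tendsto_eq_intros)

lemma q_lim: "q \<longlonglongrightarrow> 4 / nu"
  using eps_lim by (auto intro!: tendsto_eq_intros)

lemma tau_div_a_lim: "(\<lambda>i. \<tau> i / a i) \<longlonglongrightarrow> 0"
proof (rule tendsto_sandwich[of "\<lambda>_. 0" _ _ "\<lambda>i. sqrt (\<tau> i)"])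
  have "\<tau> i / a i \<le> sqrt (\<tau> i)" for i
  proof -
    have "\<tau> i = sqrt (\<tau> i) * sqrt (\<tau> i)"
      using tau_nonneg[of i] by simp
    also have "\<dots> \<le> sqrt (\<tau> i) * a i"
      using eps_pos[of i] tau_nonneg[of i] by (intro mult_left_mono) (auto simp: a_def)
    finally show ?thesis
      using a_pos[of i] by (simp add: divide_le_eq)
  qed
  then show "\<forall>\<^sub>F i in sequentially. \<tau> i / a i \<le> sqrt (\<tau> i)"
    by simp
  show "\<forall>\<^sub>F i in sequentially. 0 \<le> \<tau> i / a i"
    using tau_nonneg a_pos by (simp add: less_imp_le)
  show "(\<lambda>i. sqrt (\<tau> i)) \<longlonglongrightarrow> 0"
    using tau_to_0 by (auto intro!: tendsto_eq_intros)
qed simp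

lemma g_lim: "g \<longlonglongrightarrow> 1 / N"
proof -
  have "(\<lambda>i. (1 - (a i)\<^sup>2 / (2 * n)) powr (q i + 1) * (1 - (\<tau> i / a i) ^ n) / N) \<longlonglongrightarrow>
      (1 - 0\<^sup>2 / (2 * n)) powr (4 / nu + 1) * (1 - 0 ^ n) / N"
    using N_pos n_pos by (intro tendsto_intros a_lim q_lim tau_div_a_lim) auto
  then show ?thesis
    unfolding g_def[abs_def] using n_pos by (simp add: zero_power)
qed

lemma b_lim: "b \<longlonglongrightarrow> 1"
  unfolding b_def[abs_def] using g_lim a_lim by (auto intro!: tendsto_eq_intros)

lemma eventually_upper:
  "\<forall>\<^sub>F i in sequentially. 0 < b i \<and> 0 < g i \<and>
     (\<forall>t. \<tau> i \<le> t \<longrightarrow> t < T i \<longrightarrow> V i t \<le> (b i + g i * t\<^sup>2) powr - (nu / 2))"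
proof -
  have 1: "\<forall>\<^sub>F i in sequentially. 0 < b i"
    using order_tendstoD(1)[OF b_lim, of 0] by simp
  have 2: "\<forall>\<^sub>F i in sequentially. 0 < g i"
    using order_tendstoD(1)[OF g_lim, of 0] N_pos by simp
  have 3: "\<forall>\<^sub>F i in sequentially. a i < 1"
    using order_tendstoD(2)[OF a_lim, of 1] by simp
  have 4: "\<forall>\<^sub>F i in sequentially. \<tau> i / a i < 1"
    using order_tendstoD(2)[OF tau_div_a_lim, of 1] by simp
  show ?thesis
    using 1 2 3 4
  proof eventually_elim
    case (elim i)
    interpret nodal_arc n "q i" "V i" "Y i" "\<tau> i" "T i" "S i" by (rule arc)
    have a0: "0 < a i" by (rule a_pos)
    have a: "\<tau> i < a i" "a i < T i"
      using elim a0 T_gt_1[of i] by (auto simp: divide_less_eq)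
    have "(a i)\<^sup>2 \<le> 1"
      using elim a0 by (simp add: power_le_one)
    then have v: "0 \<le> 1 - (a i)\<^sup>2 / (2 * n)"
      using n_ge by (simp add: field_simps)
    have "g i * nu = (1 - (a i)\<^sup>2 / (2 * n)) powr (q i + 1) * (1 - (\<tau> i / a i) ^ n) / n"
      using nu_pos by (simp add: g_def)
    also have "\<dots> \<le> V i (a i) powr (q i + 1) * (1 - (\<tau> i / a i) ^ n) / n"
    proof (intro divide_right_mono mult_right_mono powr_mono2)
      show "0 \<le> 1 - (\<tau> i / a i) ^ n"
        using elim a0 tau_nonneg by (simp add: power_le_one)
    qed (use v V_ge[of "a i"] a q_pos in auto)
    also have "\<dots> = V i (a i) powr (q i + 1) * (a i ^ n - \<tau> i ^ n) / n / a i ^ n"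
      using a0 by (simp add: power_divide field_simps)
    also have "\<dots> \<le> Y i (a i) / a i ^ n"
      using Y_ge[of "a i"] a a0 by (intro divide_right_mono) auto
    finally have "g i * nu \<le> Y i (a i) / a i ^ n" .
    then have "V i t \<le> (1 - g i * (a i)\<^sup>2 + g i * t\<^sup>2) powr - (nu / 2)" if "\<tau> i \<le> t" "t < T i" for t
      using V_upper[of "a i" "g i" t] a that elim by (simp add: b_def)
    then show ?case
      using elim by (simp add: b_def)
  qed
qed

text \<open>The left side of \<open>V_lower\<close> for the parameters \<open>b i\<close> and
  \<open>g i\<close>, where the exponent defect \<open>4 / nu - q i\<close> equals
  \<open>\<epsilon> i\<close>.\<close>

definition lower :: "real \<Rightarrow> nat \<Rightarrow> real" where
  "lower R i = 1 - (b i + g i * R\<^sup>2) powr (\<epsilon> i * nu / 2) / (N * b i * g i)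
          * (b i powr - (nu / 2) - (b i + g i * R\<^sup>2) powr - (nu / 2))"

lemma lower_lim: "lower R \<longlonglongrightarrow> bubble R"
proof -
  have pos: "1 + 1 / N * R\<^sup>2 \<noteq> 0"
    using bubble_base_pos[OF N_pos, of R] by simp
  have "lower R \<longlonglongrightarrow> 1 - (1 + 1 / N * R\<^sup>2) powr (0 * nu / 2) / (N * 1 * (1 / N))
          * (1 powr - (nu / 2) - (1 + 1 / N * R\<^sup>2) powr - (nu / 2))"
    unfolding lower_def[abs_def] using N_pos n_pos pos
    by (intro tendsto_intros b_lim g_lim eps_lim) auto
  moreover have "x * 1 * (1 / x) = 1" if "0 < x" for x :: real
    using that by simp
  note this[OF N_pos]
  moreover have "(1 + 1 / N * R\<^sup>2) powr (0 * nu / 2) = 1"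
    using pos by simp
  ultimately show ?thesis
    using n_pos by simp
qed

lemma eventually_lower:
  "\<forall>\<^sub>F i in sequentially. \<forall>t. \<tau> i \<le> t \<longrightarrow> t \<le> T i \<longrightarrow> t \<le> R \<longrightarrow> lower R i \<le> V i t"
  using eventually_upper
proof eventually_elim
  case (elim i)
  interpret nodal_arc n "q i" "V i" "Y i" "\<tau> i" "T i" "S i" by (rule arc)
  have "4 / nu - q i = \<epsilon> i" by simp
  then show ?case
    using V_lower[of "b i" "g i" _ R] elim by (auto simp: lower_def)
qed

text \<open>Up to \<open>R\<close> the lower barrier is eventually positive, so the zero cannot
  occur there.\<close>

lemma eventually_T_gt: "\<forall>\<^sub>F i in sequentially. R < T i"
proof -
  have "0 < bubble R"
    using bubble_base_pos[OF N_pos, of R] by simp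
  then have "\<forall>\<^sub>F i in sequentially. 0 < lower R i"
    using order_tendstoD(1)[OF lower_lim] by blast
  then show ?thesis
    using eventually_lower[of R]
  proof eventually_elim
    case (elim i)
    interpret nodal_arc n "q i" "V i" "Y i" "\<tau> i" "T i" "S i" by (rule arc)
    show ?case
      using elim(1) elim(2)[rule_format, of "T i"] V_T tau_less by force
  qed
qed

lemma T_at_top: "filterlim T at_top sequentially"
  unfolding filterlim_at_top_dense using eventually_T_gt by blast

lemma V_lim:
  assumes "0 < t"
  shows "(\<lambda>i. V i t) \<longlonglongrightarrow> bubble t"
proof (rule tendsto_sandwich[of "lower t" _ _ "\<lambda>i. (b i + g i * t\<^sup>2) powr - (nu / 2)"])
  have tau: "\<forall>\<^sub>F i in sequentially. \<tau> i < t"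
    using order_tendstoD(2)[OF tau_to_0 assms] .
  show "\<forall>\<^sub>F i in sequentially. lower t i \<le> V i t"
    using eventually_lower[of t] eventually_T_gt[of t] tau by eventually_elim auto
  show "\<forall>\<^sub>F i in sequentially. V i t \<le> (b i + g i * t\<^sup>2) powr - (nu / 2)"
    using eventually_upper eventually_T_gt[of t] tau by eventually_elim auto
  have "1 + 1 / N * t\<^sup>2 \<noteq> 0"
    using bubble_base_pos[OF N_pos, of t] by simp
  then have "(\<lambda>i. (b i + g i * t\<^sup>2) powr - (nu / 2)) \<longlonglongrightarrow> (1 + 1 / N * t\<^sup>2) powr - (nu / 2)"
    by (intro tendsto_intros b_lim g_lim) auto
  then show "(\<lambda>i. (b i + g i * t\<^sup>2) powr - (nu / 2)) \<longlonglongrightarrow> bubble t"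
    by simp
qed (rule lower_lim)

text \<open>The upper barrier decays like \<open>t powr - nu\<close>, so its power
  \<open>q i + 1\<close> decays like \<open>t\<close> to the power
  \<open>- (n + 2) + \<epsilon> i * nu\<close>. Giving up one power of \<open>t\<close> absorbs the
  last summand, and the factor \<open>t ^ (n - 1)\<close> leaves a decay of order
  \<open>t ^ 2\<close>. Larger \<open>r\<close> are allowed because
  \<open>V \<le> 1\<close>.\<close>

lemma eventually_dominated:
  defines "c \<equiv> 1 / (2 * N)"
  shows "\<forall>\<^sub>F i in sequentially. \<forall>t r. \<tau> i \<le> t \<longrightarrow> t \<le> T i \<longrightarrow> q i + 1 \<le> r \<longrightarrow>
      t ^ (n - 1) * V i t powr r \<le> c powr - (real (n + 2) / 2) / (1 + t\<^sup>2)"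
proof -
  \<comment> \<open>The limits of \<open>b\<close> and \<open>g\<close> are 1 and
    \<open>1 / N\<close>; both exceed \<open>c\<close>.\<close>
  have c: "0 < c" "c < 1"
    using N_pos n_ge mult_mono[of 3 "real n" 1 nu] by (auto simp: c_def)
  have 1: "\<forall>\<^sub>F i in sequentially. c < b i"
    using order_tendstoD(1)[OF b_lim c(2)] .
  have "c < 1 / N" using N_pos by (simp add: c_def field_simps)
  then have 2: "\<forall>\<^sub>F i in sequentially. c < g i"
    using order_tendstoD(1)[OF g_lim] by blast
  have 3: "\<forall>\<^sub>F i in sequentially. \<epsilon> i < 1 / nu"
    using order_tendstoD(2)[OF eps_lim, of "1 / nu"] nu_pos by simp
  show ?thesis
    using 1 2 3 eventually_upper
  proof (eventually_elim, intro allI impI)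
    fix i t r
    assume e: "c < b i" "c < g i" "\<epsilon> i < 1 / nu"
      and up: "0 < b i \<and> 0 < g i \<and>
        (\<forall>t. \<tau> i \<le> t \<longrightarrow> t < T i \<longrightarrow> V i t \<le> (b i + g i * t\<^sup>2) powr - (nu / 2))"
      and t: "\<tau> i \<le> t" "t \<le> T i" and r: "q i + 1 \<le> r"
    interpret nodal_arc n "q i" "V i" "Y i" "\<tau> i" "T i" "S i" by (rule arc)
    define D where "D = 1 + t\<^sup>2"
    have D: "1 \<le> D" by (simp add: D_def)
    have t0: "0 \<le> t" using t tau_nonneg by simp
    show "t ^ (n - 1) * V i t powr r \<le> c powr - (real (n + 2) / 2) / (1 + t\<^sup>2)"
    proof (cases "t = T i")
      case True
      then show ?thesis
        using V_T D r q_pos c by (simp add: D_def)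
    next
      case False
      have V0: "0 < V i t" and V1: "V i t \<le> 1"
        using V_pos'[of t] V_le_1[of t] t False by auto
      have "c * D \<le> b i + g i * t\<^sup>2"
        using e mult_right_mono[of c "g i" "t\<^sup>2"] by (simp add: D_def distrib_left)
      then have "(b i + g i * t\<^sup>2) powr - (nu / 2) \<le> (c * D) powr - (nu / 2)"
        using c D nu_pos by (intro powr_mono2') auto
      then have V: "V i t \<le> (c * D) powr - (nu / 2)"
        using up t False by force
      have "V i t powr r \<le> V i t powr (q i + 1)"
        using V0 V1 r by (intro powr_mono') auto
      also have "\<dots> \<le> ((c * D) powr - (nu / 2)) powr (q i + 1)"
        using V V0 q_pos by (intro powr_mono2) auto
      also have "\<dots> = c powr - (nu / 2 * (q i + 1)) * D powr - (nu / 2 * (q i + 1))"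
        using c D by (simp add: powr_powr powr_mult)
      also have "\<dots> \<le> c powr - (real (n + 2) / 2) * D powr - (real (n + 1) / 2)"
      proof (intro mult_mono)
        have *: "nu / 2 * (q i + 1) = real (n + 2) / 2 - \<epsilon> i * nu / 2"
          using nu_pos by (simp add: field_simps)
        have **: "\<epsilon> i * nu \<le> 1"
          using e nu_pos by (simp add: field_simps)
        show "c powr - (nu / 2 * (q i + 1)) \<le> c powr - (real (n + 2) / 2)"
          unfolding * using c eps_pos[of i] nu_pos by (intro powr_mono') auto
        show "D powr - (nu / 2 * (q i + 1)) \<le> D powr - (real (n + 1) / 2)"
          unfolding * using D ** by (intro powr_mono) (simp_all add: field_simps)
      qed auto
      finally have "t ^ (n - 1) * V i t powr r
          \<le> D powr ((n - 1) / 2) * (c powr - (real (n + 2) / 2) * D powr - (real (n + 1) / 2))"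
      proof (intro mult_mono)
        have "t \<le> D powr (1 / 2)"
          using t0 by (simp add: powr_half_sqrt D_def real_le_rsqrt)
        then have "t ^ (n - 1) \<le> (D powr (1 / 2)) ^ (n - 1)"
          using t0 by (intro power_mono)
        also have "\<dots> = D powr ((n - 1) / 2)"
          using D by (simp add: powr_power)
        finally show "t ^ (n - 1) \<le> D powr ((n - 1) / 2)" .
      qed auto
      also have "\<dots> = c powr - (real (n + 2) / 2) * D powr ((n - 1) / 2 + - (real (n + 1) / 2))"
        by (simp only: powr_add mult_ac)
      also have "(n - 1) / 2 + - (real (n + 1) / 2) = -1"
        using n_ge by (simp add: of_nat_diff field_simps)
      finally show ?thesis
        using D by (simp add: D_def powr_minus_divide)
    qed
  qed
qed

text \<open>One statement serves both the flux, with exponent \<open>q i + 1\<close>, and the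
  energy, with exponent \<open>q i + 2\<close>.\<close>

lemma moment_lim:
  assumes int: "\<And>i. ((\<lambda>t. t ^ (n - 1) * V i t powr r i) has_integral I i) {\<tau> i..T i}"
    and r: "\<And>i. q i + 1 \<le> r i" and r_lim: "r \<longlonglongrightarrow> r'"
    and J: "((\<lambda>t. t ^ (n - 1) * bubble t powr r') has_integral J) {0..}"
  shows "I \<longlonglongrightarrow> J"
proof -
  define C where "C = (1 / (2 * N)) powr - (real (n + 2) / 2)"
  obtain K where K: "\<And>i t s. K \<le> i \<Longrightarrow> \<tau> i \<le> t \<Longrightarrow> t \<le> T i \<Longrightarrow> q i + 1 \<le> s \<Longrightarrow>
      t ^ (n - 1) * V i t powr s \<le> C / (1 + t\<^sup>2)"
    using eventually_dominated unfolding C_def[symmetric] eventually_sequentially by blast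
  \<comment> \<open>Extension by zero gives all integrands the same domain; the shift by
    \<open>K\<close> makes the domination hold for every index, not just eventually.\<close>
  define f where "f i t = (if t \<in> {\<tau> (i + K)..T (i + K)}
      then t ^ (n - 1) * V (i + K) t powr r (i + K) else 0)" for i t
  have f: "(f i has_integral I (i + K)) {0..}" for i
    unfolding f_def[abs_def]
    by (subst has_integral_restrict) (use tau_nonneg[of "i + K"] int in auto)
  have "(\<lambda>i. integral {0..} (f i)) \<longlonglongrightarrow> integral {0..} (\<lambda>t. t ^ (n - 1) * bubble t powr r')"
  proof (rule dominated_convergence)
    show "f i integrable_on {0..}" for i
      using f by (auto simp: integrable_on_def)
    show "(\<lambda>t::real. C / (1 + t\<^sup>2)) integrable_on {0..}"
      by (rule integrable_inverse_one_plus_square)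
    show "norm (f i t) \<le> C / (1 + t\<^sup>2)" if "t \<in> {0..}" for i t
      using that K[of "i + K" t "r (i + K)"] r[of "i + K"] by (auto simp: f_def C_def)
    show "(\<lambda>i. f i t) \<longlonglongrightarrow> t ^ (n - 1) * bubble t powr r'" if "t \<in> {0..}" for t
    \<comment> \<open>At the origin there is no information on \<open>V i\<close>, but the weight
      \<open>t ^ (n - 1)\<close> vanishes.\<close>
    proof (cases "t = 0")
      case True
      have z: "(0::real) ^ (n - 1) = 0"
        using n_ge by (intro zero_power) simp
      then have "f i 0 = 0" for i
        by (simp add: f_def)
      then show ?thesis
        unfolding True by (simp only: z mult_zero_left tendsto_const)
    next
      case False
      with that have t: "0 < t" by simp
      have "\<forall>\<^sub>F i in sequentially. t ^ (n - 1) * V i t powr r i =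
          (if t \<in> {\<tau> i..T i} then t ^ (n - 1) * V i t powr r i else 0)"
        using eventually_T_gt[of t] order_tendstoD(2)[OF tau_to_0 t] by eventually_elim auto
      moreover have "bubble t \<noteq> 0"
        using bubble_base_pos[OF N_pos, of t] by simp
      then have "(\<lambda>i. t ^ (n - 1) * V i t powr r i) \<longlonglongrightarrow> t ^ (n - 1) * bubble t powr r'"
        by (intro tendsto_intros V_lim[OF t] r_lim) auto
      ultimately have "(\<lambda>i. if t \<in> {\<tau> i..T i} then t ^ (n - 1) * V i t powr r i else 0)
          \<longlonglongrightarrow> t ^ (n - 1) * bubble t powr r'"
        by (rule Lim_transform_eventually[rotated])
      then show ?thesis
        unfolding f_def by (rule LIMSEQ_ignore_initial_segment)
    qed
  qed
  then have "(\<lambda>i. I (i + K)) \<longlonglongrightarrow> J"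
    using f J by (simp add: has_integral_iff)
  then show ?thesis
    by (rule LIMSEQ_offset)
qed

lemma flux_lim: "(\<lambda>i. Y i (T i)) \<longlonglongrightarrow> N powr (n / 2) / n"
proof (rule moment_lim[where r = "\<lambda>i. q i + 1" and r' = "4 / nu + 1"])
  fix i
  interpret nodal_arc n "q i" "V i" "Y i" "\<tau> i" "T i" "S i" by (rule arc)
  show "((\<lambda>t. t ^ (n - 1) * V i t powr (q i + 1)) has_integral Y i (T i)) {\<tau> i..T i}"
    by (rule has_integral_eq[OF _ flux_integral]) (use source_eq V_nonneg in auto)
next
  show "(\<lambda>i. q i + 1) \<longlonglongrightarrow> 4 / nu + 1"
    by (intro tendsto_intros q_lim)
  have "- (nu / 2) * (4 / nu + 1) = - (real (n + 2) / 2)"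
    using nu_pos by (simp add: field_simps)
  then show "((\<lambda>t. t ^ (n - 1) * bubble t powr (4 / nu + 1)) has_integral N powr (n / 2) / n) {0..}"
    using bubble_mass_has_integral[of n N] N_pos n_ge by (simp add: powr_powr)
qed simp

section \<open>Energy balance and the position of the zero\<close>

definition rate :: "nat \<Rightarrow> real" where "rate i = real n / (q i + 2) - nu / 2"

lemma q_pos: "0 < q i"
  using nodal_arc.q_pos[OF arc] .

lemma rate_eq: "rate i = nu * \<epsilon> i / (2 * (q i + 2))"
proof -
  define Q where "Q = q i + 2"
  have "Q \<noteq> 0"
    using q_pos[of i] by (simp add: Q_def)
  then have "(real n / Q - nu / 2) * (2 * Q) = 2 * n - nu * Q"
    by (simp add: field_simps)
  then have "rate i * (2 * (q i + 2)) = 2 * n - nu * (q i + 2)"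
    unfolding rate_def Q_def .
  also have "\<dots> = nu * \<epsilon> i"
    using nu_pos by (simp add: field_simps)
  finally show ?thesis
    using q_pos[of i] by (simp add: eq_divide_eq)
qed

text \<open>The coefficient in the derivative of the Pohozaev functional; its positivity allows
  dividing by it below.\<close>

lemma rate_pos: "0 < rate i"
  using q_pos[of i] nu_pos eps_pos[of i] by (simp add: rate_eq)

lemma q2_lim: "(\<lambda>i. q i + 2) \<longlonglongrightarrow> 2 * n / nu"
proof -
  have "(\<lambda>i. q i + 2) \<longlonglongrightarrow> 4 / nu + 2"
    by (intro tendsto_intros q_lim)
  moreover have "4 / nu + 2 = 2 * n / nu"
    using nu_pos by (simp add: field_simps)
  ultimately show ?thesis by simp
qed

lemma rate_lim: "(\<lambda>i. rate i / \<epsilon> i) \<longlonglongrightarrow> nu\<^sup>2 / (4 * n)"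
proof -
  have "(\<lambda>i. nu / (2 * (q i + 2))) \<longlonglongrightarrow> nu / (2 * (2 * n / nu))"
    using nu_pos n_pos by (intro tendsto_intros q2_lim) auto
  moreover have "rate i / \<epsilon> i = nu / (2 * (q i + 2))" for i
    using eps_pos[of i] by (simp add: rate_eq)
  ultimately show ?thesis
    by (simp add: power2_eq_square)
qed

definition energy :: "nat \<Rightarrow> real" where "energy i = (Y i (T i))\<^sup>2 / T i ^ (n - 2) / 2"

text \<open>The initial value \<open>\<tau> ^ n / (q + 2)\<close> contributes \<open>j\<close> equal
  portions and the bubble of this arc one more. That the portions are equal is the normalization of
  \<open>kappa\<close>.\<close>

lemma energy_lim: "(\<lambda>i. energy i / \<eta> i) \<longlonglongrightarrow> (j + 1) * (nu * N powr (n / 2) / (2 * n))"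
proof -
  define G where "G = Gamma (n / 2) ^ 2 / Gamma n"
  have G: "0 < G"
    using n_ge by (auto simp: G_def intro!: divide_pos_pos zero_less_power Gamma_real_pos)
  have kappa: "kappa n = nu / 4 * G"
    by (simp add: kappa_def G_def)
  have "(\<lambda>i. (energy i - \<tau> i ^ n / (q i + 2)) / rate i) \<longlonglongrightarrow> N powr (n / 2) / 2 * G"
  proof (rule moment_lim[where r = "\<lambda>i. q i + 2" and r' = "2 * n / nu"])
    fix i
    interpret nodal_arc n "q i" "V i" "Y i" "\<tau> i" "T i" "S i" by (rule arc)
    have "((\<lambda>t. 1 / rate i * (rate i * (t ^ (n - 1) * \<bar>V i t\<bar> powr (q i + 2)))) has_integral
        1 / rate i * (energy i - \<tau> i ^ n / (q i + 2))) {\<tau> i..T i}"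
      unfolding rate_def energy_def by (intro has_integral_mult_right pohozaev_inner_integral)
    then have "((\<lambda>t. 1 / rate i * (rate i * (t ^ (n - 1) * \<bar>V i t\<bar> powr (q i + 2)))) has_integral
        (energy i - \<tau> i ^ n / (q i + 2)) / rate i) {\<tau> i..T i}"
      by simp
    then show "((\<lambda>t. t ^ (n - 1) * V i t powr (q i + 2)) has_integral
        (energy i - \<tau> i ^ n / (q i + 2)) / rate i) {\<tau> i..T i}"
      by (rule has_integral_eq[rotated]) (use V_nonneg rate_pos[of i] in auto)
  next
    show "(\<lambda>i. q i + 2) \<longlonglongrightarrow> 2 * n / nu"
      by (rule q2_lim)
    have "- (nu / 2) * (2 * n / nu) = - real n"
      using nu_pos by simp
    then show "((\<lambda>t. t ^ (n - 1) * bubble t powr (2 * n / nu)) has_integral N powr (n / 2) / 2 * G) {0..}"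
      using bubble_energy_has_integral[of n N] N_pos n_ge by (simp only: powr_powr G_def)
  qed simp
  then have "(\<lambda>i. (energy i - \<tau> i ^ n / (q i + 2)) / rate i * (rate i / \<epsilon> i) / kappa n
      + \<tau> i ^ n / \<eta> i / (q i + 2))
      \<longlonglongrightarrow> N powr (n / 2) / 2 * G * (nu\<^sup>2 / (4 * n)) / kappa n + j * N powr (n / 2) / (2 * n / nu)"
    using nu_pos n_pos kappa_pos[OF n_ge]
    by (intro tendsto_add tendsto_divide tendsto_mult rate_lim tau_lim q2_lim tendsto_const) auto
  moreover have "(energy i - \<tau> i ^ n / (q i + 2)) / rate i * (rate i / \<epsilon> i) / kappa n
      + \<tau> i ^ n / \<eta> i / (q i + 2) = energy i / \<eta> i" for i
  proof -
    have "(energy i - \<tau> i ^ n / (q i + 2)) / rate i * (rate i / \<epsilon> i) / kappa n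
      = (energy i - \<tau> i ^ n / (q i + 2)) / \<eta> i"
      using rate_pos[of i] by simp
    then show ?thesis
      by (simp add: diff_divide_distrib)
  qed
  moreover have "N powr (n / 2) / 2 * G * (nu\<^sup>2 / (4 * n)) / kappa n + j * N powr (n / 2) / (2 * n / nu)
      = (j + 1) * (nu * N powr (n / 2) / (2 * n))"
  proof -
    define d X where "d = nu" and "X = N powr (n / 2)"
    have "d \<noteq> 0" "G \<noteq> 0" "n \<noteq> 0"
      using nu_pos G n_ge by (auto simp: d_def)
    then show ?thesis
      unfolding kappa d_def[symmetric] X_def[symmetric] by (simp add: field_simps power2_eq_square)
  qed
  ultimately show ?thesis by simp
qed

lemma N_powr_half: "N powr (n / 2) = N powr (nu / 2) * N"
proof -
  have "real n / 2 = nu / 2 + 1" by (simp add: diff_divide_distrib)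
  then have "N powr (n / 2) = N powr (nu / 2 + 1)" by (rule arg_cong)
  also have "\<dots> = N powr (nu / 2) * N" using N_pos by (simp only: powr_add) simp
  finally show ?thesis .
qed

text \<open>\<open>energy i\<close> contains \<open>T i\<close> explicitly, and the flux at the zero
  has a known limit, so the energy limit can be solved for \<open>T i\<close>.\<close>

theorem zero_lim: "(\<lambda>i. T i ^ (n - 2) * \<eta> i) \<longlonglongrightarrow> N powr (nu / 2) / (j + 1)"
proof -
  define d X where "d = nu" and "X = N powr (nu / 2)"
  have pos: "0 < d" "0 < X" using nu_pos N_pos by (auto simp: d_def X_def)
  have "(\<lambda>i. (Y i (T i))\<^sup>2 / (2 * (energy i / \<eta> i))) \<longlonglongrightarrow>
      (N powr (n / 2) / n)\<^sup>2 / (2 * ((j + 1) * (nu * N powr (n / 2) / (2 * n))))"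
    using nu_pos n_pos N_pos j_nonneg
    by (intro tendsto_intros flux_lim energy_lim) auto
  moreover have "(Y i (T i))\<^sup>2 / (2 * (energy i / \<eta> i)) = T i ^ (n - 2) * \<eta> i" for i
  proof -
    interpret nodal_arc n "q i" "V i" "Y i" "\<tau> i" "T i" "S i" by (rule arc)
    have "Y i (T i) \<noteq> 0"
      using Y_pos[of "T i"] tau_less by simp
    then show ?thesis
      using T_pos by (simp add: energy_def)
  qed
  moreover have "(N powr (n / 2) / n)\<^sup>2 / (2 * ((j + 1) * (nu * N powr (n / 2) / (2 * n))))
      = N powr (nu / 2) / (j + 1)"
    unfolding N_powr_half unfolding X_def[symmetric] d_def[symmetric]
    using pos n_pos j_nonneg by (simp add: power2_eq_square)
  ultimately show ?thesis by simp
qed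


section \<open>The height of the next extremum and the start of the next arc\<close>

lemma amp_scaled_le: "amp i * T i ^ (n - 2) \<le> Y i (T i) / nu"
proof -
  interpret nodal_arc n "q i" "V i" "Y i" "\<tau> i" "T i" "S i" by (rule arc)
  show ?thesis
    using mult_right_mono[OF outer_amplitude_le, of "T i ^ (n - 2)"] T_pos by simp
qed

text \<open>This is the flux that may be lost up to the radius whose power \<open>n\<close> is
  \<open>T i ^ (n + 1)\<close>. Since \<open>amp i\<close> is at most of order
  \<open>T i powr - nu\<close> and \<open>nu * (q i + 1)\<close> tends to \<open>n + 2\<close>,
  almost a full power of \<open>T i\<close> is gained; half a power is kept.\<close>

lemma amp_small:
  "(\<lambda>i. amp i powr (q i + 1) * T i ^ (n + 1) / n) \<longlonglongrightarrow> 0"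
proof (rule tendsto_sandwich[of "\<lambda>_. 0" _ _ "\<lambda>i. (Y i (T i) / nu) powr (q i + 1) * T i powr - (1 / 2) / n"])
  have "\<forall>\<^sub>F i in sequentially. \<epsilon> i < 1 / (2 * nu)"
    using order_tendstoD(2)[OF eps_lim, of "1 / (2 * nu)"] nu_pos by simp
  then show "\<forall>\<^sub>F i in sequentially. amp i powr (q i + 1) * T i ^ (n + 1) / n
      \<le> (Y i (T i) / nu) powr (q i + 1) * T i powr - (1 / 2) / n"
  proof eventually_elim
    case (elim i)
    have T1: "1 < T i" by (rule T_gt_1)
    have "amp i powr (q i + 1) * (T i ^ (n - 2)) powr (q i + 1)
        = (amp i * T i ^ (n - 2)) powr (q i + 1)"
      using T1 by (simp add: powr_mult)
    also have "\<dots> \<le> (Y i (T i) / nu) powr (q i + 1)"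
      using amp_scaled_le[of i] q_pos[of i] T1 by (intro powr_mono2) auto
    finally have 1: "amp i powr (q i + 1) * (T i ^ (n - 2)) powr (q i + 1) \<le> (Y i (T i) / nu) powr (q i + 1)" .
    have "\<epsilon> i * nu \<le> 1 / 2"
      using elim nu_pos by (simp add: field_simps)
    moreover have "nu * (q i + 1) = real n + 2 - \<epsilon> i * nu"
      using nu_pos by (simp add: field_simps)
    ultimately have "T i powr (real n + 1) \<le> T i powr (nu * (q i + 1) + - (1 / 2))"
      using T1 by (intro powr_mono) auto
    also have "\<dots> = (T i ^ (n - 2)) powr (q i + 1) * T i powr - (1 / 2)"
    proof -
      have "T i ^ (n - 2) = T i powr nu"
        using T1 n_ge by (simp add: of_nat_diff flip: powr_realpow)
      then show ?thesis
        by (simp only: powr_powr powr_add[symmetric])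
    qed
    finally have "T i ^ (n + 1) \<le> (T i ^ (n - 2)) powr (q i + 1) * T i powr - (1 / 2)"
      using T1 powr_realpow[of "T i" "n + 1"] by (simp only: of_nat_add of_nat_1 less_trans[OF zero_less_one])
    then have "amp i powr (q i + 1) * T i ^ (n + 1)
        \<le> amp i powr (q i + 1) * ((T i ^ (n - 2)) powr (q i + 1) * T i powr - (1 / 2))"
      by (intro mult_left_mono) auto
    also have "\<dots> \<le> (Y i (T i) / nu) powr (q i + 1) * T i powr - (1 / 2)"
      using mult_right_mono[OF 1, of "T i powr - (1 / 2)"] by (simp only: mult.assoc) simp
    finally show ?case
      by (intro divide_right_mono) auto
  qed
  show "\<forall>\<^sub>F i in sequentially. 0 \<le> amp i powr (q i + 1) * T i ^ (n + 1) / n"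
  proof (intro always_eventually allI)
    show "0 \<le> amp i powr (q i + 1) * T i ^ (n + 1) / n" for i
      using T_gt_1[of i] by simp
  qed
  have "(\<lambda>i. T i powr - (1 / 2)) \<longlonglongrightarrow> 0"
    by (rule tendsto_neg_powr[OF _ T_at_top]) simp
  then have "(\<lambda>i. (Y i (T i) / nu) powr (q i + 1) * T i powr - (1 / 2) / n)
      \<longlonglongrightarrow> (N powr (n / 2) / n / nu) powr (4 / nu + 1) * 0 / n"
    using nu_pos n_pos N_pos
    by (intro tendsto_mult tendsto_divide tendsto_powr tendsto_add flux_lim q_lim tendsto_const) auto
  then show "(\<lambda>i. (Y i (T i) / nu) powr (q i + 1) * T i powr - (1 / 2) / n) \<longlonglongrightarrow> 0"
    by simp
qed simp

text \<open>For the lower bound the comparison radius must be much larger than \<open>T i\<close>,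
  so that nearly the whole harmonic drop takes place, but small enough that the flux is still
  intact. The power \<open>1 + 1 / n\<close> of \<open>T i\<close> meets both demands.\<close>

lemma amp_scaled_lim: "(\<lambda>i. amp i * T i ^ (n - 2)) \<longlonglongrightarrow> N powr (n / 2) / n / nu"
proof (rule tendsto_sandwich[of "\<lambda>i. (Y i (T i) - amp i powr (q i + 1) * T i ^ (n + 1) / n)
      * (1 - T i powr - (nu / n)) / nu" _ _ "\<lambda>i. Y i (T i) / nu"])
  have "(\<lambda>i. Y i (T i) - amp i powr (q i + 1) * T i ^ (n + 1) / n) \<longlonglongrightarrow> N powr (n / 2) / n - 0"
    by (intro tendsto_diff flux_lim amp_small)
  then have "\<forall>\<^sub>F i in sequentially. 0 < Y i (T i) - amp i powr (q i + 1) * T i ^ (n + 1) / n"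
  proof (rule order_tendstoD(1))
    have "0 < N powr (n / 2)"
      using n_ge by simp
    then show "0 < N powr (n / 2) / n - 0"
      using n_pos by simp
  qed
  then show "\<forall>\<^sub>F i in sequentially. (Y i (T i) - amp i powr (q i + 1) * T i ^ (n + 1) / n)
      * (1 - T i powr - (nu / n)) / nu \<le> amp i * T i ^ (n - 2)"
  proof eventually_elim
    case (elim i)
    interpret nodal_arc n "q i" "V i" "Y i" "\<tau> i" "T i" "S i" by (rule arc)
    have T1: "1 < T i" by (rule T_gt_1)
    \<comment> \<open>The comparison radius lies between \<open>T i\<close> and the next critical point.\<close>
    define R where "R = T i powr (1 + 1 / n)"
    have R: "T i \<le> R"
      using T1 powr_mono[of 1 "1 + 1 / n" "T i"] by (simp add: R_def)
    have "R ^ n = T i powr ((1 + 1 / n) * n)"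
      using T1 n_pos by (simp add: R_def powr_power mult.commute)
    also have "(1 + 1 / n) * real n = real (n + 1)"
      using n_pos by (simp add: field_simps)
    finally have Rn: "R ^ n = T i ^ (n + 1)"
      using T1 by (simp only: powr_realpow)
    have "T i ^ (n - 2) / R ^ (n - 2) = T i powr - (nu / n)"
    proof -
      have "R ^ (n - 2) = T i powr ((1 + 1 / n) * nu)"
        using T1 n_ge by (simp add: R_def powr_power of_nat_diff mult.commute)
      moreover have "T i ^ (n - 2) = T i powr nu"
        using T1 n_ge by (simp add: of_nat_diff flip: powr_realpow)
      moreover have "d - (1 + 1 / x) * d = - (d / x)" for d x :: real
        by (simp add: algebra_simps)
      ultimately show ?thesis
        by (simp only: powr_diff[symmetric])
    qed
    then have "(1 / T i ^ (n - 2) - 1 / R ^ (n - 2)) * T i ^ (n - 2) = 1 - T i powr - (nu / n)"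
      using T1 by (simp add: left_diff_distrib)
    moreover have "(Y i (T i) - amp i powr (q i + 1) * T i ^ (n + 1) / n)
        * (1 / T i ^ (n - 2) - 1 / R ^ (n - 2)) \<le> nu * amp i"
      using outer_amplitude_ge[OF R] elim unfolding Rn by simp
    then have "(Y i (T i) - amp i powr (q i + 1) * T i ^ (n + 1) / n)
        * (1 / T i ^ (n - 2) - 1 / R ^ (n - 2)) * T i ^ (n - 2) \<le> nu * amp i * T i ^ (n - 2)"
      using T1 by (intro mult_right_mono) auto
    ultimately have "(Y i (T i) - amp i powr (q i + 1) * T i ^ (n + 1) / n)
        * (1 - T i powr - (nu / n)) \<le> nu * amp i * T i ^ (n - 2)"
      by (simp only: mult.assoc)
    then show ?case
      using nu_pos by (simp add: divide_le_eq mult_ac)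
  qed
  have "(\<lambda>i. T i powr - (nu / n)) \<longlonglongrightarrow> 0"
    by (rule tendsto_neg_powr[OF _ T_at_top]) (use nu_pos n_pos in simp)
  then have "(\<lambda>i. (Y i (T i) - amp i powr (q i + 1) * T i ^ (n + 1) / n)
      * (1 - T i powr - (nu / n)) / nu) \<longlonglongrightarrow> (N powr (n / 2) / n - 0) * (1 - 0) / nu"
    using nu_pos by (intro tendsto_mult tendsto_divide tendsto_diff flux_lim amp_small tendsto_const) auto
  then show "(\<lambda>i. (Y i (T i) - amp i powr (q i + 1) * T i ^ (n + 1) / n)
      * (1 - T i powr - (nu / n)) / nu) \<longlonglongrightarrow> N powr (n / 2) / n / nu"
    by simp
  show "(\<lambda>i. Y i (T i) / nu) \<longlonglongrightarrow> N powr (n / 2) / n / nu"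
    using nu_pos by (intro tendsto_divide flux_lim tendsto_const) auto
  show "\<forall>\<^sub>F i in sequentially. amp i * T i ^ (n - 2) \<le> Y i (T i) / nu"
    using amp_scaled_le by simp
qed

theorem amplitude_lim: "(\<lambda>i. amp i / \<eta> i) \<longlonglongrightarrow> j + 1"
proof -
  have "(\<lambda>i. amp i * T i ^ (n - 2) / (T i ^ (n - 2) * \<eta> i)) \<longlonglongrightarrow>
      N powr (n / 2) / n / nu / (N powr (nu / 2) / (j + 1))"
    using N_pos n_pos j_nonneg by (intro tendsto_divide amp_scaled_lim zero_lim) auto
  moreover have "amp i * T i ^ (n - 2) / (T i ^ (n - 2) * \<eta> i) = amp i / \<eta> i" for i
    using T_gt_1[of i] by simp
  moreover have "N powr (n / 2) / n / nu / (N powr (nu / 2) / (j + 1)) = j + 1"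
  proof -
    define d X where "d = nu" and "X = N powr (nu / 2)"
    have pos: "0 < d" "0 < X" using nu_pos N_pos by (auto simp: d_def X_def)
    show ?thesis
      unfolding N_powr_half unfolding X_def[symmetric] d_def[symmetric]
      using pos n_pos j_nonneg by simp
  qed
  ultimately show ?thesis by simp
qed

lemma amp_lim: "(\<lambda>i. amp i) \<longlonglongrightarrow> 0"
proof -
  have "(\<lambda>i. amp i / \<eta> i * \<eta> i) \<longlonglongrightarrow> (j + 1) * 0"
    by (intro tendsto_mult amplitude_lim kappa_eps_lim)
  moreover have "x / y * y = x" if "0 < y" for x y :: real
    using that by simp
  note this[OF kappa_eps_pos]
  ultimately show ?thesis by simp
qed

lemma amp_pos: "0 < amp i"
proof -
  interpret nodal_arc n "q i" "V i" "Y i" "\<tau> i" "T i" "S i" by (rule arc)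
  show ?thesis
    using V_neg[of "S i"] T_less by simp
qed

text \<open>Divided by \<open>q i + 2\<close>, the left quantity before normalization is the
  Pohozaev functional at \<open>S i\<close>. By \<open>pohozaev_outer\<close> it differs from
  \<open>energy i\<close> by at most \<open>rate i * amp i * Y i (T i)\<close>, which is
  o(\<epsilon>) because \<open>amp i\<close> tends to 0.\<close>

lemma outer_energy_lim:
  "(\<lambda>i. S i ^ n * amp i powr (q i + 2) / \<eta> i) \<longlonglongrightarrow> (j + 1) * N powr (n / 2)"
proof -
  define P where "P i = S i ^ n * amp i powr (q i + 2) / (q i + 2)" for i
  have "(\<lambda>i. P i / \<eta> i) \<longlonglongrightarrow> (j + 1) * (nu * N powr (n / 2) / (2 * n))"
  proof (rule tendsto_sandwich[of "\<lambda>i. energy i / \<eta> i" _ _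
        "\<lambda>i. energy i / \<eta> i + rate i / \<epsilon> i * amp i * Y i (T i) / kappa n"])
    have le: "energy i \<le> P i" "P i \<le> energy i + rate i * amp i * Y i (T i)" for i
    proof -
      interpret nodal_arc n "q i" "V i" "Y i" "\<tau> i" "T i" "S i" by (rule arc)
      show "energy i \<le> P i" "P i \<le> energy i + rate i * amp i * Y i (T i)"
        using pohozaev_outer unfolding energy_def P_def rate_def by auto
    qed
    show "\<forall>\<^sub>F i in sequentially. energy i / \<eta> i \<le> P i / \<eta> i"
      using le(1) less_imp_le[OF kappa_eps_pos] by (intro always_eventually allI divide_right_mono)
    have "P i / \<eta> i \<le> energy i / \<eta> i + rate i / \<epsilon> i * amp i * Y i (T i) / kappa n" for i
    proof -
      have "P i / \<eta> i \<le> (energy i + rate i * amp i * Y i (T i)) / \<eta> i"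
        using le(2)[of i] less_imp_le[OF kappa_eps_pos[of i]] by (intro divide_right_mono)
      then show ?thesis
        by (simp add: add_divide_distrib mult_ac)
    qed
    then show "\<forall>\<^sub>F i in sequentially. P i / \<eta> i \<le>
        energy i / \<eta> i + rate i / \<epsilon> i * amp i * Y i (T i) / kappa n"
      by simp
    have "(\<lambda>i. energy i / \<eta> i + rate i / \<epsilon> i * amp i * Y i (T i) / kappa n) \<longlonglongrightarrow>
       (j + 1) * (nu * N powr (n / 2) / (2 * n)) + nu\<^sup>2 / (4 * n) * 0 * (N powr (n / 2) / n) / kappa n"
      using kappa_pos[OF n_ge]
      by (intro tendsto_add tendsto_mult tendsto_divide energy_lim rate_lim amp_lim flux_lim tendsto_const) auto
    then show "(\<lambda>i. energy i / \<eta> i + rate i / \<epsilon> i * amp i * Y i (T i) / kappa n) \<longlonglongrightarrow>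
       (j + 1) * (nu * N powr (n / 2) / (2 * n))"
      by simp
  qed (rule energy_lim)
  then have "(\<lambda>i. P i / \<eta> i * (q i + 2)) \<longlonglongrightarrow> (j + 1) * (nu * N powr (n / 2) / (2 * n)) * (2 * n / nu)"
    by (intro tendsto_mult q2_lim)
  moreover have "P i / \<eta> i * (q i + 2) = S i ^ n * amp i powr (q i + 2) / \<eta> i" for i
  proof -
    define Q where "Q = q i + 2"
    have "Q \<noteq> 0"
      using q_pos[of i] by (simp add: Q_def)
    then show ?thesis
      unfolding P_def Q_def[symmetric] by simp
  qed
  moreover have "(j + 1) * (nu * N powr (n / 2) / (2 * n)) * (2 * n / nu) = (j + 1) * N powr (n / 2)"
    using nu_pos n_pos by simp
  ultimately show ?thesis by (simp only:)
qed

text \<open>\<open>amp i\<close> is comparable to \<open>\<eta> i\<close>, so the logarithm is of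
  order \<epsilon> ln \<epsilon>.\<close>

lemma amp_powr_eps_lim: "(\<lambda>i. amp i powr (- (\<epsilon> i * nu / 2))) \<longlonglongrightarrow> 1"
proof -
  note x = kappa_eps_pos
  have "(\<lambda>i. (amp i / \<eta> i) powr (- (\<epsilon> i * nu / 2)) * exp (- (nu / 2 / kappa n) * (\<eta> i * ln (\<eta> i))))
      \<longlonglongrightarrow> (j + 1) powr (- (0 * nu / 2)) * exp (- (nu / 2 / kappa n) * 0)"
    using j_nonneg x kappa_eps_lim less_imp_neq[OF x, symmetric]
    by (intro tendsto_mult tendsto_powr tendsto_exp tendsto_const tendsto_minus tendsto_divide
        eps_lim amplitude_lim tendsto_mult_ln_zero) auto
  moreover have "(amp i / \<eta> i) powr (- (\<epsilon> i * nu / 2)) * exp (- (nu / 2 / kappa n) * (\<eta> i * ln (\<eta> i)))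
      = amp i powr (- (\<epsilon> i * nu / 2))" for i
  proof -
    have "exp (- (nu / 2 / kappa n) * (\<eta> i * ln (\<eta> i))) = \<eta> i powr (- (\<epsilon> i * nu / 2))"
      using x[of i] kappa_pos[OF n_ge] eps_pos[of i] by (simp add: powr_def)
    moreover have "amp i powr p = (amp i / \<eta> i) powr p * \<eta> i powr p" for p
      using x[of i] eps_pos[of i] kappa_pos[OF n_ge] by (simp add: powr_divide)
    ultimately show ?thesis by simp
  qed
  ultimately show ?thesis
    using j_nonneg by simp
qed

text \<open>The base of the power is the start of the next arc after rescaling it to height 1, so
  this is the hypothesis \<open>tau_lim\<close> for \<open>j + 1\<close>. It follows from
  \<open>outer_energy_lim\<close> because \<open>q i / 2 * n\<close> and \<open>q i + 2\<close>
  differ by \<open>\<epsilon> i * nu / 2\<close>.\<close>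

theorem next_tau_lim:
  "(\<lambda>i. (amp i powr (q i / 2) * S i) ^ n / \<eta> i) \<longlonglongrightarrow> (j + 1) * N powr (n / 2)"
proof -
  have "(\<lambda>i. S i ^ n * amp i powr (q i + 2) / \<eta> i * amp i powr (- (\<epsilon> i * nu / 2)))
      \<longlonglongrightarrow> (j + 1) * N powr (n / 2) * 1"
    by (intro tendsto_mult outer_energy_lim amp_powr_eps_lim)
  moreover have "S i ^ n * amp i powr (q i + 2) / \<eta> i * amp i powr (- (\<epsilon> i * nu / 2))
      = (amp i powr (q i / 2) * S i) ^ n / \<eta> i" for i
  proof -
    have "q i + 2 + - (\<epsilon> i * nu / 2) = q i / 2 * n"
      using nu_pos by (simp add: field_simps)
    moreover have "(amp i powr (q i / 2)) ^ n = amp i powr (q i / 2 * n)"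
      using amp_pos[of i] by (simp add: powr_power mult.commute)
    ultimately have "(amp i powr (q i / 2)) ^ n
        = amp i powr (q i + 2) * amp i powr (- (\<epsilon> i * nu / 2))"
      by (simp only: powr_add[symmetric])
    then show ?thesis
      by (simp add: power_mult_distrib mult_ac)
  qed
  ultimately show ?thesis by (simp only: mult_1_right)
qed

end

section \<open>From the equation to the arcs of the profile\<close>

lemma has_field_derivative_eq_on:
  assumes "(f has_field_derivative D) (at x within s)" "x \<in> s" "\<And>y. y \<in> s \<Longrightarrow> g y = f y"
  shows "(g has_field_derivative D) (at x within s)"
  using assms has_derivative_transform unfolding has_field_derivative_def by blast

lemma profile_norm:
  fixes w :: "'a::real_normed_vector \<Rightarrow> real"
  assumes "radial w" "x \<in> cball 0 1"
  shows "profile w (norm x) = w x"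
proof -
  have "norm (SOME y :: 'a. norm y = norm x) = norm x"
    by (rule someI[of "\<lambda>y :: 'a. norm y = norm x" x]) simp
  then show ?thesis
    using assms unfolding radial_def profile_def by (metis mem_cball_0)
qed

lemma profile_scaleR:
  assumes "radial w" "norm e = 1" "0 \<le> r" "r \<le> 1"
  shows "profile w r = w (r *\<^sub>R e)"
  using profile_norm[OF assms(1), of "r *\<^sub>R e"] assms by simp

lemma profile_C1:
  fixes u :: "'a::euclidean_space \<Rightarrow> real"
  assumes rad: "radial u" and C1: "C1_on (cball 0 1) u"
  obtains w' where "\<And>r. r \<in> {0..1} \<Longrightarrow> (profile u has_real_derivative w' r) (at r within {0..1})"
    "continuous_on {0..1} w'" "w' 0 = 0"
proof -
  obtain e :: 'a where e: "e \<in> Basis" using nonempty_Basis by blast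
  then have e1: "norm e = 1" by simp
  obtain f' where f': "\<And>x. x \<in> cball 0 1 \<Longrightarrow> (u has_derivative blinfun_apply (f' x)) (at x within cball 0 1)"
    and cont: "continuous_on (cball 0 1) f'"
    using C1 unfolding C1_on_def by blast
  define w' where "w' r = blinfun_apply (f' (r *\<^sub>R e)) e" for r
  have img: "(\<lambda>r. r *\<^sub>R e) ` {0..1} \<subseteq> cball 0 1"
    using e1 by auto
  have line: "((\<lambda>r. u (r *\<^sub>R e)) has_real_derivative w' r) (at r within A)"
    if "(u has_derivative blinfun_apply (f' (r *\<^sub>R e))) (at (r *\<^sub>R e) within ((\<lambda>r. r *\<^sub>R e) ` A))" for r A
  proof -
    have "((\<lambda>r. r *\<^sub>R e) has_derivative (\<lambda>h. h *\<^sub>R e)) (at r within A)"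
      by (auto intro!: derivative_eq_intros)
    from diff_chain_within[OF this that]
    have "((\<lambda>r. u (r *\<^sub>R e)) has_derivative (\<lambda>h. h * w' r)) (at r within A)"
      by (simp add: o_def w'_def blinfun.scaleR_right)
    then show ?thesis
      by (simp add: has_field_derivative_def mult_commute_abs)
  qed
  have "(profile u has_real_derivative w' r) (at r within {0..1})" if r: "r \<in> {0..1}" for r
  proof -
    have "((\<lambda>r. u (r *\<^sub>R e)) has_real_derivative w' r) (at r within {0..1})"
      using r e1 by (intro line has_derivative_subset[OF f' img]) auto
    then show ?thesis
      by (rule has_field_derivative_eq_on) (use r profile_scaleR[OF rad e1] in auto)
  qed
  moreover have "continuous_on {0..1} w'"
    unfolding w'_def
    by (intro continuous_intros continuous_on_compose2[OF cont _ img])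
  moreover have "w' 0 = 0"
  proof -
    \<comment> \<open>On a line through the origin \<open>u\<close> is even, so its derivative there
      vanishes.\<close>
    have "at (0::'a) within cball 0 1 = at 0"
      by (rule at_within_interior) (simp add: interior_cball)
    then have "(u has_derivative blinfun_apply (f' 0)) (at 0)"
      using f'[of 0] by simp
    then have d: "((\<lambda>r. u (r *\<^sub>R e)) has_real_derivative w' 0) (at 0)"
      by (intro line) (auto intro: has_derivative_at_withinI)
    then have "((\<lambda>r. u ((- r) *\<^sub>R e)) has_real_derivative - w' 0) (at 0)"
      using DERIV_mirror[of "\<lambda>r. u (r *\<^sub>R e)" "w' 0" 0] by simp
    moreover have "\<forall>\<^sub>F r in nhds 0. u ((- r) *\<^sub>R e) = u (r *\<^sub>R e)"
    proof -
      have "\<forall>\<^sub>F r::real in nhds 0. r \<in> ball 0 1"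
        by (intro eventually_nhds_in_open) auto
      then show ?thesis
        using rad e1 by (auto elim!: eventually_mono simp: radial_def)
    qed
    ultimately have "((\<lambda>r. u (r *\<^sub>R e)) has_real_derivative - w' 0) (at 0)"
      by (subst (asm) DERIV_cong_ev[OF refl _ refl])
    with d have "w' 0 = - w' 0" by (rule DERIV_unique)
    then show ?thesis by simp
  qed
  ultimately show ?thesis using that by blast
qed

text \<open>On the segment from the center to a boundary point, both numbers are the derivative of
  the same function at the same end of an interval.\<close>

lemma profile_deriv_1:
  fixes u :: "'a::euclidean_space \<Rightarrow> real"
  assumes rad: "radial u"
    and d: "(profile u has_real_derivative D) (at 1 within {0..1})"
    and neumann: "\<forall>x\<in>sphere 0 1. ((\<lambda>t. u (x + t *\<^sub>R x)) has_real_derivative 0) (at 0 within {..0})"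
  shows "D = 0"
proof -
  obtain e :: 'a where e: "e \<in> Basis" using nonempty_Basis by blast
  then have e1: "norm e = 1" by simp
  have "((\<lambda>t. u (e + t *\<^sub>R e)) has_real_derivative 0) (at 0 within {..0})"
    using neumann e1 by simp
  then have "((\<lambda>t. u (e + t *\<^sub>R e)) has_real_derivative 0) (at 0 within {-1..0})"
    by (rule has_field_derivative_subset) auto
  then have "((\<lambda>t. profile u (1 + t)) has_real_derivative 0) (at 0 within {-1..0})"
    by (rule has_field_derivative_eq_on)
      (use profile_scaleR[OF rad e1] in \<open>auto simp: scaleR_left_distrib\<close>)
  moreover have "((\<lambda>t. profile u (1 + t)) has_real_derivative D) (at 0 within {-1..0})"
  proof -
    have img: "(\<lambda>t. 1 + t) ` {-1..0} = {0..1::real}"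
      by (auto simp: image_iff intro: bexI[of _ "x - 1" for x])
    have "((\<lambda>t. 1 + t) has_real_derivative 1) (at 0 within {-1..0})"
      by (auto intro!: derivative_eq_intros)
    from DERIV_image_chain[OF _ this, of "profile u" D] d img show ?thesis
      by (simp add: o_def)
  qed
  ultimately show ?thesis
    using vector_derivative_unique_within_closed_interval[of "-1" 0 0 "\<lambda>t. profile u (1 + t)"]
    by (simp add: has_real_derivative_iff_has_vector_derivative)
qed

lemma profile_C2:
  fixes u :: "'a::euclidean_space \<Rightarrow> real"
  assumes rad: "radial u" and C2: "C2_on (ball 0 1) u"
    and w': "\<And>r. r \<in> {0..1} \<Longrightarrow> (profile u has_real_derivative w' r) (at r within {0..1})"
    and r: "0 < r" "r < 1" and e: "e \<in> Basis" and xe: "x = r *\<^sub>R e"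
  shows "(w' has_real_derivative laplacian u x - (real DIM('a) - 1) / r * w' r) (at r)"
proof -
  from e have e1: "norm e = 1" by simp
  obtain f' where f': "\<And>x. x \<in> ball 0 1 \<Longrightarrow> (u has_derivative blinfun_apply (f' x)) (at x within ball 0 1)"
    and C1: "C1_on (ball 0 1) f'"
    using C2 unfolding C2_on_def by blast
  obtain f'' where f'': "\<And>x. x \<in> ball 0 1 \<Longrightarrow> (f' has_derivative blinfun_apply (f'' x)) (at x within ball 0 1)"
    using C1 unfolding C1_on_def by blast
  have ball: "at y within ball 0 1 = at y" if "y \<in> ball 0 1" for y :: 'a
    using that by (intro at_within_open) auto
  have w'_int: "(profile u has_real_derivative w' s) (at s)" if "0 < s" "s < 1" for s
  proof -
    have "at s within {0..1} = at s"
      using that by (intro at_within_interior) simp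
    then show ?thesis using w'[of s] that by simp
  qed
  have w'_eq: "w' s = blinfun_apply (f' (s *\<^sub>R e)) e" if "0 < s" "s < 1" for s
  proof -
    have in_ball: "s *\<^sub>R e \<in> ball 0 1" using that e1 by simp
    have "((\<lambda>r. r *\<^sub>R e) has_derivative (\<lambda>h. h *\<^sub>R e)) (at s)"
      by (auto intro!: derivative_eq_intros)
    from diff_chain_at[OF this f'[OF in_ball, unfolded ball[OF in_ball]]]
    have "((\<lambda>r. u (r *\<^sub>R e)) has_real_derivative blinfun_apply (f' (s *\<^sub>R e)) e) (at s)"
      by (simp add: o_def blinfun.scaleR_right has_field_derivative_def mult_commute_abs)
    moreover have "\<forall>\<^sub>F r in nhds s. u (r *\<^sub>R e) = profile u r"
    proof -
      have "\<forall>\<^sub>F r in nhds s. r \<in> {0<..<1}"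
        using that by (intro eventually_nhds_in_open) auto
      then show ?thesis
        by eventually_elim (use profile_scaleR[OF rad e1] in auto)
    qed
    ultimately have "(profile u has_real_derivative blinfun_apply (f' (s *\<^sub>R e)) e) (at s)"
      by (subst (asm) DERIV_cong_ev[OF refl _ refl])
    then show ?thesis
      using w'_int[OF that] DERIV_unique by blast
  qed
  obtain D where D: "(w' has_real_derivative D) (at r)"
  proof -
    have in_ball: "r *\<^sub>R e \<in> ball 0 1" using r e1 by simp
    have "((\<lambda>r. r *\<^sub>R e) has_derivative (\<lambda>h. h *\<^sub>R e)) (at r)"
      by (auto intro!: derivative_eq_intros)
    from diff_chain_at[OF this f''[OF in_ball, unfolded ball[OF in_ball]]]
    have "((\<lambda>r. f' (r *\<^sub>R e)) has_derivative (\<lambda>h. h *\<^sub>R blinfun_apply (f'' (r *\<^sub>R e)) e)) (at r)"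
      by (simp add: o_def blinfun.scaleR_right)
    then have "((\<lambda>r. blinfun_apply (f' (r *\<^sub>R e)) e) has_derivative
        (\<lambda>h. blinfun_apply (h *\<^sub>R blinfun_apply (f'' (r *\<^sub>R e)) e) e)) (at r)"
      by (rule bounded_linear.has_derivative[OF blinfun.bounded_linear_left])
    then have "((\<lambda>r. blinfun_apply (f' (r *\<^sub>R e)) e) has_real_derivative
        blinfun_apply (blinfun_apply (f'' (r *\<^sub>R e)) e) e) (at r)"
      by (simp add: blinfun.scaleR_left has_field_derivative_def mult_commute_abs)
    moreover have "\<forall>\<^sub>F s in nhds r. blinfun_apply (f' (s *\<^sub>R e)) e = w' s"
    proof -
      have "\<forall>\<^sub>F s in nhds r. s \<in> {0<..<1}"
        using r by (intro eventually_nhds_in_open) auto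
      then show ?thesis
        by eventually_elim (use w'_eq in auto)
    qed
    ultimately have "(w' has_real_derivative blinfun_apply (blinfun_apply (f'' (r *\<^sub>R e)) e) e) (at r)"
      by (subst (asm) DERIV_cong_ev[OF refl _ refl])
    then show ?thesis by (rule that)
  qed
  have second: "(deriv ^^ 2) f 0 = E"
    if "\<forall>\<^sub>F t in nhds 0. (f has_real_derivative f1 t) (at t)" "(f1 has_real_derivative E) (at 0)" for f f1 :: "real \<Rightarrow> real" and E
  proof -
    have "\<forall>\<^sub>F t in nhds 0. deriv f t = f1 t"
      using that(1) by eventually_elim (rule DERIV_imp_deriv)
    then have "deriv (deriv f) 0 = deriv f1 0"
      by (rule deriv_cong_ev) simp
    also have "\<dots> = E"
      using that(2) by (rule DERIV_imp_deriv)
    finally show ?thesis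
      by (simp add: eval_nat_numeral)
  qed
  have radial_dir: "(deriv ^^ 2) (\<lambda>t. u (x + t *\<^sub>R e)) 0 = D"
  proof (rule second)
    have "\<forall>\<^sub>F t in nhds 0. t \<in> {- r<..<1 - r}"
      using r by (intro eventually_nhds_in_open) auto
    then show "\<forall>\<^sub>F t in nhds 0. ((\<lambda>t. u (x + t *\<^sub>R e)) has_real_derivative w' (r + t)) (at t)"
    proof eventually_elim
      case (elim t)
      have "((\<lambda>t. profile u (r + t)) has_real_derivative w' (r + t)) (at t)"
        using DERIV_shift[of "profile u" "w' (r + t)" t r] w'_int[of "r + t"] elim by (simp add: add.commute)
      moreover have "\<forall>\<^sub>F s in nhds t. profile u (r + s) = u (x + s *\<^sub>R e)"
      proof -
        have "\<forall>\<^sub>F s in nhds t. s \<in> {- r<..<1 - r}"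
          using elim by (intro eventually_nhds_in_open) auto
        then show ?thesis
          by eventually_elim (use profile_scaleR[OF rad e1, of "r + s" for s] xe in \<open>auto simp: scaleR_left_distrib\<close>)
      qed
      ultimately show ?case
        by (subst (asm) DERIV_cong_ev[OF refl _ refl])
    qed
    show "((\<lambda>t. w' (r + t)) has_real_derivative D) (at 0)"
      using D DERIV_shift[of w' D 0 r] by (simp add: add.commute)
  qed
  have tangential: "(deriv ^^ 2) (\<lambda>t. u (x + t *\<^sub>R b)) 0 = w' r / r" if b: "b \<in> Basis - {e}" for b
  proof -
    \<comment> \<open>The distance to the origin along a tangential line; its first derivative at 0
      is 0 and its second is \<open>1 / r\<close>.\<close>
    define \<rho> where "\<rho> t = sqrt (r\<^sup>2 + t\<^sup>2)" for t
    have \<rho>_pos: "0 < \<rho> t" for t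
      using r by (simp add: \<rho>_def add_pos_nonneg)
    have \<rho>0: "\<rho> 0 = r" using r by (simp add: \<rho>_def)
    have d\<rho>: "(\<rho> has_real_derivative t / \<rho> t) (at t)" for t
    proof -
      have "0 < r\<^sup>2 + t\<^sup>2" using r by (simp add: add_pos_nonneg)
      then show ?thesis
        unfolding \<rho>_def[abs_def] by (auto intro!: derivative_eq_intros simp: field_simps)
    qed
    have norm_eq: "norm (x + t *\<^sub>R b) = \<rho> t" for t
    proof -
      have "e \<bullet> b = 0"
        using e b by (auto simp: inner_Basis)
      then have "(norm (x + t *\<^sub>R b))\<^sup>2 = r\<^sup>2 + t\<^sup>2"
        using e b unfolding xe power2_norm_eq_inner
        by (simp add: inner_add_left inner_add_right inner_commute inner_same_Basis power2_eq_square)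
      then show ?thesis
        unfolding \<rho>_def by (metis norm_ge_zero real_sqrt_unique)
    qed
    have "isCont \<rho> 0" using d\<rho> by (rule DERIV_isCont)
    then have "(\<rho> \<longlongrightarrow> \<rho> 0) (nhds 0)"
      unfolding continuous_at by (simp only: tendsto_at_iff_tendsto_nhds)
    then have "\<forall>\<^sub>F t in nhds 0. \<rho> t < 1"
      using r \<rho>0 by (intro order_tendstoD(2)) auto
    \<comment> \<open>To differentiate at \<open>t\<close> the representation by the profile must
      hold in a neighbourhood of \<open>t\<close>, hence the nested form.\<close>
    then have ev: "\<forall>\<^sub>F t in nhds 0. \<forall>\<^sub>F s in nhds t. \<rho> s < 1"
      by (simp add: eventually_eventually)
    show ?thesis
    proof (rule second)
      show "\<forall>\<^sub>F t in nhds 0. ((\<lambda>t. u (x + t *\<^sub>R b)) has_real_derivative w' (\<rho> t) * (t / \<rho> t)) (at t)"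
        using ev
      proof eventually_elim
        case (elim t)
        then have "\<rho> t < 1" by (rule eventually_nhds_x_imp_x)
        then have "((\<lambda>t. profile u (\<rho> t)) has_real_derivative w' (\<rho> t) * (t / \<rho> t)) (at t)"
          using \<rho>_pos by (intro DERIV_chain2[OF w'_int d\<rho>])
        moreover have "\<forall>\<^sub>F s in nhds t. profile u (\<rho> s) = u (x + s *\<^sub>R b)"
          using elim by eventually_elim (use profile_norm[OF rad] norm_eq in \<open>metis less_imp_le mem_cball_0\<close>)
        ultimately show ?case
          by (subst (asm) DERIV_cong_ev[OF refl _ refl])
      qed
      have "((\<lambda>t. w' (\<rho> t) * (t / \<rho> t)) has_real_derivative
          D * (0 / \<rho> 0) * (0 / \<rho> 0) + (1 * \<rho> 0 - 0 * (0 / \<rho> 0)) / (\<rho> 0 * \<rho> 0) * w' (\<rho> 0)) (at 0)"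
        using \<rho>_pos[of 0] D \<rho>0
        by (intro DERIV_mult DERIV_chain2[of w'] d\<rho> DERIV_divide DERIV_ident) auto
      then show "((\<lambda>t. w' (\<rho> t) * (t / \<rho> t)) has_real_derivative w' r / r) (at 0)"
        using r by (simp add: \<rho>0)
    qed
  qed
  have "laplacian u x = (deriv ^^ 2) (\<lambda>t. u (x + t *\<^sub>R e)) 0
      + (\<Sum>b\<in>Basis - {e}. (deriv ^^ 2) (\<lambda>t. u (x + t *\<^sub>R b)) 0)"
    unfolding laplacian_def using e by (intro sum.remove) auto
  also have "(\<Sum>b\<in>Basis - {e}. (deriv ^^ 2) (\<lambda>t. u (x + t *\<^sub>R b)) 0) = (\<Sum>b\<in>Basis - {e}. w' r / r)"
    by (intro sum.cong refl tangential)
  also have "\<dots> = (real DIM('a) - 1) / r * w' r"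
    using e by (simp add: card_Diff_singleton of_nat_diff)
  finally have "D = laplacian u x - (real DIM('a) - 1) / r * w' r"
    by (simp add: radial_dir)
  with D show ?thesis by simp
qed

text \<open>The equation is invariant under dividing the function by \<open>a\<close> and
  multiplying the radius by \<open>a powr (q / 2)\<close>. \<open>s\<close> holds extrema,
  \<open>z\<close> zeros, \<open>a\<close> heights and \<open>d\<close> absolute slopes at zeros;
  the last conjunct is the slope with the scaling undone. The rescaled functions themselves are
  hidden.\<close>

definition rescaled_arc ::
  "nat \<Rightarrow> real \<Rightarrow> (nat \<Rightarrow> real) \<Rightarrow> (nat \<Rightarrow> real) \<Rightarrow> (nat \<Rightarrow> real) \<Rightarrow> (nat \<Rightarrow> real) \<Rightarrow> nat \<Rightarrow> bool" where
  "rescaled_arc n q a s z d i \<longleftrightarrow> (\<exists>V Y. nodal_arc n q V Y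
      (a i powr (q / 2) * s i) (a i powr (q / 2) * z (Suc i)) (a i powr (q / 2) * s (Suc i)) \<and>
    \<bar>V (a i powr (q / 2) * s (Suc i))\<bar> = a (Suc i) / a i \<and>
    d (Suc i) = Y (a i powr (q / 2) * z (Suc i)) / (a i powr (q / 2) * z (Suc i)) ^ (n - 1)
      * a i * a i powr (q / 2))"

section \<open>Nodal structure of a radial profile\<close>

locale radial_profile =
  fixes n k :: nat and q :: real and w w' :: "real \<Rightarrow> real"
  assumes n_ge: "3 \<le> n" and q_pos: "0 < q" and q_sub: "q \<le> 4 / (real n - 2)"
    and deriv_w: "\<And>r. r \<in> {0..1} \<Longrightarrow> (w has_real_derivative w' r) (at r within {0..1})"
    and cont_w': "continuous_on {0..1} w'" and w'_0: "w' 0 = 0" and w'_1: "w' 1 = 0"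
    and deriv_w': "\<And>r. 0 < r \<Longrightarrow> r < 1 \<Longrightarrow>
      (w' has_real_derivative - (\<bar>w r\<bar> powr q * w r) - (real n - 1) / r * w' r) (at r)"
    and k_ge: "1 \<le> k"
    and finite_zeros: "finite {r \<in> {0<..<1}. w r = 0}" and card_zeros: "card {r \<in> {0<..<1}. w r = 0} = k"
begin

definition Y :: "real \<Rightarrow> real" where "Y r = - (r ^ (n - 1) * w' r)"

lemma cont_w: "continuous_on {0..1} w"
  using deriv_w by (meson DERIV_continuous_on)

lemma cont_Y: "continuous_on {0..1} Y"
  unfolding Y_def[abs_def] by (intro continuous_intros cont_w')

lemma deriv_w_at:
  assumes "0 < r" "r < 1"
  shows "(w has_real_derivative w' r) (at r)"
proof -
  have "at r within {0..1} = at r"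
    using assms by (intro at_within_interior) simp
  then show ?thesis using deriv_w[of r] assms by simp
qed

lemma deriv_Y:
  assumes "0 < r" "r < 1"
  shows "(Y has_real_derivative r ^ (n - 1) * (\<bar>w r\<bar> powr q * w r)) (at r)"
proof -
  obtain l where l: "n = l + 3"
    using n_ge by (metis add.commute le_Suc_ex)
  have "(Y has_real_derivative - ((real (n - 1) * r ^ (n - 1 - Suc 0)) * w' r
      + (- (\<bar>w r\<bar> powr q * w r) - (real n - 1) / r * w' r) * r ^ (n - 1))) (at r)"
    unfolding Y_def[abs_def] by (intro DERIV_minus DERIV_mult DERIV_pow deriv_w' assms)
  moreover have "- ((real (n - 1) * r ^ (n - 1 - Suc 0)) * w' r
      + (- (\<bar>w r\<bar> powr q * w r) - (real n - 1) / r * w' r) * r ^ (n - 1))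
      = r ^ (n - 1) * (\<bar>w r\<bar> powr q * w r)"
    using assms by (simp add: l field_simps)
  ultimately show ?thesis by simp
qed

definition Z :: "real set" where "Z = {r \<in> {0<..<1}. w r = 0}"

text \<open>The zeros in increasing order at indices \<open>1\<close> to \<open>k\<close>, with
  sentinels 0 and 1, so that the nodal intervals are uniformly \<open>z i\<close> to
  \<open>z (Suc i)\<close> for \<open>i \<le> k\<close>.\<close>

definition z :: "nat \<Rightarrow> real" where
  "z i = (if i = 0 then 0 else if i \<le> k then sorted_list_of_set Z ! (i - 1) else 1)"

lemma finite_Z: "finite Z" and card_Z: "card Z = k"
  using finite_zeros card_zeros by (auto simp: Z_def)

lemma z_0: "z 0 = 0" and z_last: "z (Suc k) = 1"
  by (auto simp: z_def)

lemma Z_eq: "Z = z ` {1..k}"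
proof -
  have "Z = set (sorted_list_of_set Z)"
    using finite_Z by simp
  also have "\<dots> = (\<lambda>i. sorted_list_of_set Z ! i) ` {..<k}"
    using card_Z by (auto simp: set_conv_nth image_def)
  also have "\<dots> = (\<lambda>i. sorted_list_of_set Z ! (i - 1)) ` {1..k}"
  proof -
    have "{..<k} = (\<lambda>i. i - 1) ` {1..k}"
      by (auto simp: image_iff intro!: bexI[of _ "Suc x" for x])
    then show ?thesis by (simp add: image_image)
  qed
  also have "\<dots> = z ` {1..k}"
    by (intro image_cong) (auto simp: z_def)
  finally show ?thesis .
qed

lemma z_in: "1 \<le> i \<Longrightarrow> i \<le> k \<Longrightarrow> z i \<in> Z"
  using Z_eq by auto

lemma z_bounds: "1 \<le> i \<Longrightarrow> i \<le> k \<Longrightarrow> 0 < z i \<and> z i < 1 \<and> w (z i) = 0"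
  using z_in by (auto simp: Z_def)

lemma z_less:
  assumes "i < l" "l \<le> Suc k"
  shows "z i < z l"
proof -
  have "sorted_wrt (<) (sorted_list_of_set Z)"
    by simp
  then have "sorted_list_of_set Z ! a < sorted_list_of_set Z ! b" if "a < b" "b < k" for a b
    using that card_Z by (simp add: sorted_wrt_nth_less)
  then have "z i < z l" if "1 \<le> i" "l \<le> k"
    using that assms by (simp add: z_def)
  moreover have "z i < z l" if "i = 0" "l \<le> k"
    using that assms z_bounds[of l] z_0 by simp
  moreover have "z i < z l" if "l = Suc k"
    using that assms z_bounds[of i] z_0 z_last by (cases "i = 0") auto
  ultimately show ?thesis
    using assms by (cases "l = Suc k"; cases "i = 0") auto
qed

lemma z_le: "i \<le> l \<Longrightarrow> l \<le> Suc k \<Longrightarrow> z i \<le> z l"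
  using z_less[of i l] by (cases "i = l") auto

lemma z_unit: "i \<le> Suc k \<Longrightarrow> 0 \<le> z i \<and> z i \<le> 1"
  using z_le[of 0 i] z_le[of i "Suc k"] z_0 z_last by simp

lemma w_nonzero:
  assumes "i \<le> k" "z i < r" "r < z (Suc i)"
  shows "w r \<noteq> 0"
proof
  assume "w r = 0"
  moreover have "0 < r" "r < 1"
    using assms z_unit[of i] z_unit[of "Suc i"] by auto
  ultimately have "r \<in> Z" by (simp add: Z_def)
  then obtain l where l: "l \<in> {1..k}" "r = z l"
    using Z_eq by blast
  then show False
    using assms z_le[of l i] z_le[of "Suc i" l] by (cases "l \<le> i") auto
qed

definition sg :: "nat \<Rightarrow> real" where "sg i = sgn (w ((z i + z (Suc i)) / 2))"

lemma sg_w_pos: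
  assumes "i \<le> k" "z i < r" "r < z (Suc i)"
  shows "0 < sg i * w r"
proof -
  define m where "m = (z i + z (Suc i)) / 2"
  have m: "z i < m" "m < z (Suc i)"
    using z_less[of i "Suc i"] assms by (auto simp: m_def)
  \<comment> \<open>By connectedness the sign at the midpoint is the sign on the whole nodal
    interval.\<close>
  have "connected (w ` {z i<..<z (Suc i)})"
    using z_unit[of i] z_unit[of "Suc i"] assms
    by (intro connected_continuous_image continuous_on_subset[OF cont_w]) auto
  moreover have "0 \<notin> w ` {z i<..<z (Suc i)}"
    using w_nonzero[OF assms(1)] by auto
  moreover have "w m \<in> w ` {z i<..<z (Suc i)}" "w r \<in> w ` {z i<..<z (Suc i)}"
    using m assms by auto
  ultimately have "\<not> (w m \<le> 0 \<and> 0 \<le> w r)" "\<not> (w r \<le> 0 \<and> 0 \<le> w m)"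
    using connectedD_interval by metis+
  then show ?thesis
    unfolding sg_def m_def[symmetric] by (auto simp: sgn_if not_le)
qed

lemma sg_cases: "i \<le> k \<Longrightarrow> sg i = 1 \<or> sg i = -1"
  using sg_w_pos[of i "(z i + z (Suc i)) / 2"] z_less[of i "Suc i"]
  by (auto simp: sg_def sgn_if split: if_splits)

text \<open>The source has the sign of \<open>w\<close>, so the signed flux is strictly increasing
  and vanishes at most once on each nodal interval.\<close>

lemma sg_Y_less:
  assumes i: "i \<le> k" and "z i \<le> a" "a < b" "b \<le> z (Suc i)"
  shows "sg i * Y a < sg i * Y b"
proof (rule DERIV_pos_imp_increasing_open[OF assms(3)])
  fix r assume r: "a < r" "r < b"
  then have r': "0 < r" "r < 1" "z i < r" "r < z (Suc i)"
    using assms z_unit[of i] z_unit[of "Suc i"] by auto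
  have "((\<lambda>r. sg i * Y r) has_real_derivative sg i * (r ^ (n - 1) * (\<bar>w r\<bar> powr q * w r))) (at r)"
    using r' by (intro DERIV_cmult deriv_Y)
  moreover have "0 < r ^ (n - 1) * \<bar>w r\<bar> powr q"
    using r' w_nonzero[OF i r'(3,4)] by (intro mult_pos_pos) auto
  then have "0 < r ^ (n - 1) * \<bar>w r\<bar> powr q * (sg i * w r)"
    using sg_w_pos[OF i r'(3,4)] by (rule mult_pos_pos)
  ultimately show "\<exists>y. ((\<lambda>r. sg i * Y r) has_real_derivative y) (at r) \<and> 0 < y"
    by (auto simp: mult_ac)
next
  show "continuous_on {a..b} (\<lambda>r. sg i * Y r)"
    using assms z_unit[of i] z_unit[of "Suc i"]
    by (intro continuous_intros continuous_on_subset[OF cont_Y]) auto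
qed

text \<open>Rolle yields a critical point in each inner nodal interval. In the first and the last
  one the critical point is the end of the unit interval, which is why these two cases are set by
  hand.\<close>

definition s :: "nat \<Rightarrow> real" where
  "s i = (if i = 0 then 0 else if i = k then 1 else SOME r. z i < r \<and> r < z (Suc i) \<and> Y r = 0)"

lemma s_0: "s 0 = 0" and s_last: "s k = 1"
  using k_ge by (auto simp: s_def)

lemma s_inner:
  assumes "0 < i" "i < k"
  shows "z i < s i" "s i < z (Suc i)" "Y (s i) = 0"
proof -
  have "\<exists>r. z i < r \<and> r < z (Suc i) \<and> DERIV w r :> 0"
  proof (rule Rolle)
    show "z i < z (Suc i)" using assms by (intro z_less) auto
    show "w (z i) = w (z (Suc i))" using z_bounds[of i] z_bounds[of "Suc i"] assms by simp
    show "continuous_on {z i..z (Suc i)} w"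
      using assms z_unit[of i] z_unit[of "Suc i"] by (intro continuous_on_subset[OF cont_w]) auto
    show "w differentiable (at r)" if "z i < r" "r < z (Suc i)" for r
      using deriv_w_at[of r] that assms z_unit[of i] z_unit[of "Suc i"]
      by (auto simp: real_differentiable_def)
  qed
  then obtain r where r: "z i < r" "r < z (Suc i)" "DERIV w r :> 0" by blast
  then have "w' r = 0"
    using deriv_w_at[of r] DERIV_unique assms z_unit[of i] z_unit[of "Suc i"] by force
  then have "\<exists>r. z i < r \<and> r < z (Suc i) \<and> Y r = 0"
    using r by (auto simp: Y_def)
  from someI_ex[OF this] show "z i < s i" "s i < z (Suc i)" "Y (s i) = 0"
    using assms by (auto simp: s_def)
qed

lemma z_less_s: "0 < i \<Longrightarrow> i \<le> k \<Longrightarrow> z i < s i"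
  using s_inner[of i] s_last z_bounds[of i] by (cases "i = k") auto

lemma s_less_z: "i < k \<Longrightarrow> s i < z (Suc i)"
  using s_inner[of i] s_0 z_bounds[of 1] k_ge by (cases "i = 0") auto

lemma z_le_s: "i \<le> k \<Longrightarrow> z i \<le> s i"
  using z_less_s[of i] z_0 s_0 by (cases "i = 0") auto

lemma s_le_z: "i \<le> k \<Longrightarrow> s i \<le> z (Suc i)"
  using s_less_z[of i] z_last s_last by (cases "i = k") auto

lemma Y_s: "i \<le> k \<Longrightarrow> Y (s i) = 0"
  using s_inner[of i] s_0 s_last w'_0 w'_1 by (cases "i = 0"; cases "i = k") (auto simp: Y_def)

lemma s_unit: "i \<le> k \<Longrightarrow> 0 \<le> s i \<and> s i \<le> 1"
  using z_le_s[of i] s_le_z[of i] z_unit[of i] z_unit[of "Suc i"] by simp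

lemma Y_zero_iff: "r \<in> {0..1} \<Longrightarrow> Y r = 0 \<longleftrightarrow> w' r = 0"
  using w'_0 by (cases "r = 0") (auto simp: Y_def)

lemma interval_index:
  assumes "r \<in> {0..1}"
  obtains i where "i \<le> k" "z i \<le> r" "r \<le> z (Suc i)"
proof -
  have "\<exists>i\<le>l. z i \<le> r \<and> r \<le> z (Suc i)" if "l \<le> k" "r \<le> z (Suc l)" for l
    using that
  proof (induction l)
    case 0
    then show ?case using assms z_0 by auto
  next
    case (Suc l)
    show ?case
    proof (cases "r \<le> z (Suc l)")
      case True
      then show ?thesis using Suc by (meson Suc_leD le_SucI)
    next
      case False
      then show ?thesis using Suc by (intro exI[of _ "Suc l"]) auto
    qed
  qed
  from this[of k] show ?thesis
    using assms z_last that by auto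
qed

text \<open>A critical point shares a nodal interval with some \<open>s i\<close>, and strict
  monotonicity of the flux lets only one of them exist there.\<close>

lemma critical_eq: "{r \<in> {0..1}. w' r = 0} = s ` {0..k}"
proof
  show "s ` {0..k} \<subseteq> {r \<in> {0..1}. w' r = 0}"
    using s_unit Y_s Y_zero_iff by auto
  show "{r \<in> {0..1}. w' r = 0} \<subseteq> s ` {0..k}"
  proof
    fix r assume "r \<in> {r \<in> {0..1}. w' r = 0}"
    then have r: "r \<in> {0..1}" "Y r = 0" by (auto simp: Y_def)
    obtain i where i: "i \<le> k" "z i \<le> r" "r \<le> z (Suc i)"
      using interval_index[OF r(1)] .
    have "r = s i"
    proof (rule linorder_cases[of r "s i"])
      assume "r < s i"
      then show ?thesis
        using sg_Y_less[of i r "s i"] i s_le_z[of i] Y_s[of i] r by simp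
    next
      assume "s i < r"
      then show ?thesis
        using sg_Y_less[of i "s i" r] i z_le_s[of i] Y_s[of i] r by simp
    qed
    then show "r \<in> s ` {0..k}" using i by auto
  qed
qed

text \<open>Inner critical points lie inside their nodal intervals. The points 0 and 1 are ends of
  theirs, and there the sign of the flux shows that the signed function only grows on the way from
  the midpoint to the end.\<close>

lemma sg_w_s_pos:
  assumes "i \<le> k"
  shows "0 < sg i * w (s i)"
proof -
  define m where "m = (z i + z (Suc i)) / 2"
  have m: "z i < m" "m < z (Suc i)" "0 < m" "m < 1"
    using z_less[of i "Suc i"] assms z_unit[of i] z_unit[of "Suc i"] by (auto simp: m_def)
  have pos: "0 < sg i * w m"
    using sg_w_pos[OF assms m(1,2)] .
  consider "0 < i" "i < k" | "i = 0" | "i = k" "i \<noteq> 0"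
    using assms by linarith
  then show ?thesis
  proof cases
    case 1
    then show ?thesis using s_inner sg_w_pos[of i "s i"] by simp
  next
    case 2
    have "sg i * w m \<le> sg i * w 0"
    proof (rule DERIV_nonpos_imp_decreasing_open[where f = "\<lambda>r. sg i * w r"])
      fix r assume r: "0 < r" "r < m"
      have "0 < sg i * Y r"
        using sg_Y_less[of i 0 r] r m 2 z_0 by (simp add: Y_def w'_0)
      then have "0 < r ^ (n - 1) * - (sg i * w' r)"
        by (simp add: Y_def mult_ac)
      moreover have "0 < r ^ (n - 1)" using r by simp
      ultimately have "0 < - (sg i * w' r)"
        by (rule zero_less_mult_pos)
      then have "sg i * w' r \<le> 0" by simp
      then show "\<exists>y. ((\<lambda>r. sg i * w r) has_real_derivative y) (at r) \<and> y \<le> 0"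
        using r m by (intro exI[of _ "sg i * w' r"]) (auto intro!: DERIV_cmult deriv_w_at)
    qed (use m in \<open>auto intro!: continuous_intros continuous_on_subset[OF cont_w]\<close>)
    then show ?thesis using pos 2 s_0 by simp
  next
    case 3
    have "sg i * w m \<le> sg i * w 1"
    proof (rule DERIV_nonneg_imp_increasing_open[where f = "\<lambda>r. sg i * w r"])
      fix r assume r: "m < r" "r < 1"
      have "sg i * Y r < 0"
        using sg_Y_less[of i r 1] r m 3 z_last by (simp add: Y_def w'_1)
      then have "0 < r ^ (n - 1) * (sg i * w' r)"
        by (simp add: Y_def mult_ac)
      moreover have "0 < r ^ (n - 1)" using r m by simp
      ultimately have "0 < sg i * w' r"
        by (rule zero_less_mult_pos)
      then have "0 \<le> sg i * w' r" by simp
      then show "\<exists>y. ((\<lambda>r. sg i * w r) has_real_derivative y) (at r) \<and> 0 \<le> y"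
        using r m by (intro exI[of _ "sg i * w' r"]) (auto intro!: DERIV_cmult deriv_w_at)
    qed (use m in \<open>auto intro!: continuous_intros continuous_on_subset[OF cont_w]\<close>)
    then show ?thesis using pos 3 s_last by simp
  qed
qed

lemma sg_Y_z_pos:
  assumes "i < k"
  shows "0 < sg i * Y (z (Suc i))"
  using sg_Y_less[of i "s i" "z (Suc i)"] assms z_le_s[of i] s_less_z[of i] Y_s[of i] by simp

text \<open>At the zero the flux, hence the slope, does not vanish, so \<open>w\<close> changes
  sign.\<close>

lemma sg_Suc:
  assumes "i < k"
  shows "sg (Suc i) = - sg i"
proof -
  define \<zeta> where "\<zeta> = z (Suc i)"
  have \<zeta>: "0 < \<zeta>" "\<zeta> < 1" "w \<zeta> = 0"
    using z_bounds[of "Suc i"] assms by (auto simp: \<zeta>_def)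
  have "0 < \<zeta> ^ (n - 1) * - (sg i * w' \<zeta>)"
    using sg_Y_z_pos[OF assms] by (simp add: Y_def \<zeta>_def mult_ac)
  moreover have "0 < \<zeta> ^ (n - 1)" using \<zeta> by simp
  ultimately have "0 < - (sg i * w' \<zeta>)"
    by (rule zero_less_mult_pos)
  then have neg: "sg i * w' \<zeta> < 0" by simp
  obtain d where d: "d > 0" "\<And>h. 0 < h \<Longrightarrow> h < d \<Longrightarrow> sg i * w (\<zeta> + h) < sg i * w \<zeta>"
    using DERIV_neg_dec_right[OF DERIV_cmult[OF deriv_w_at[OF \<zeta>(1,2)], of "sg i"] neg] by blast
  have gap: "\<zeta> < z (Suc (Suc i))"
    using assms by (auto simp: \<zeta>_def intro: z_less)
  define h where "h = min d (z (Suc (Suc i)) - \<zeta>) / 2"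
  have h: "0 < h" "h < d" "\<zeta> + h < z (Suc (Suc i))"
    using d gap by (auto simp: h_def min_def field_simps split: if_splits)
  have "sg i * w (\<zeta> + h) < 0"
    using d(2)[OF h(1,2)] \<zeta> by simp
  moreover have "0 < sg (Suc i) * w (\<zeta> + h)"
    using sg_w_pos[of "Suc i" "\<zeta> + h"] h assms by (simp add: \<zeta>_def)
  ultimately have "sg (Suc i) \<noteq> sg i" by auto
  then show ?thesis
    using sg_cases[of i] sg_cases[of "Suc i"] assms by auto
qed

definition amp :: "nat \<Rightarrow> real" where "amp i = \<bar>w (s i)\<bar>"

definition scale :: "nat \<Rightarrow> real" where "scale i = amp i powr (q / 2)"

definition Vs :: "nat \<Rightarrow> real \<Rightarrow> real" where "Vs i t = sg i * w (t / scale i) / amp i"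

text \<open>The flux of \<open>Vs i\<close>: the weight \<open>t ^ (n - 1)\<close> brings
  \<open>scale i ^ (n - 1)\<close> and the derivative takes one factor away.\<close>

definition Ys :: "nat \<Rightarrow> real \<Rightarrow> real" where "Ys i t = sg i * scale i ^ (n - 2) / amp i * Y (t / scale i)"

lemma amp_pos: "i \<le> k \<Longrightarrow> 0 < amp i"
  using sg_w_s_pos[of i] by (auto simp: amp_def)

lemma scale_pos: "i \<le> k \<Longrightarrow> 0 < scale i"
  using amp_pos[of i] by (simp add: scale_def)

lemma sg_w_s: "i \<le> k \<Longrightarrow> sg i * w (s i) = amp i"
  using sg_w_s_pos[of i] sg_cases[of i] by (auto simp: amp_def)

lemma nodal_arc_rescaled:
  assumes i: "i < k"
  shows "nodal_arc n q (Vs i) (Ys i) (scale i * s i) (scale i * z (Suc i)) (scale i * s (Suc i))"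
proof -
  define a \<mu> \<sigma> where "a = amp i" and "\<mu> = scale i" and "\<sigma> = sg i"
  have a: "0 < a" and \<mu>: "0 < \<mu>" using amp_pos scale_pos i by (auto simp: a_def \<mu>_def)
  have \<sigma>: "\<sigma> = 1 \<or> \<sigma> = -1" using sg_cases[of i] i by (simp add: \<sigma>_def)
  \<comment> \<open>This relation is what preserves the coefficient 1 in the rescaled
    equation.\<close>
  have \<mu>2: "\<mu>\<^sup>2 = a powr q"
    using a by (simp add: \<mu>_def scale_def a_def powr_power)
  have V: "Vs i = (\<lambda>t. \<sigma> * w (t / \<mu>) / a)" and Yv: "Ys i = (\<lambda>t. \<sigma> * \<mu> ^ (n - 2) / a * Y (t / \<mu>))"
    by (auto simp: Vs_def Ys_def a_def \<mu>_def \<sigma>_def)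
  obtain l where l: "n = l + 3"
    using n_ge by (metis add.commute le_Suc_ex)
  have s0: "0 \<le> s i" and s1: "s (Suc i) \<le> 1"
    using s_unit[of i] s_unit[of "Suc i"] i by auto
  have chain: "((\<lambda>t. t / \<mu>) has_real_derivative 1 / \<mu>) (at t)" for t
    using \<mu> by (auto intro!: derivative_eq_intros)
  have img: "(\<lambda>t. t / \<mu>) ` {\<mu> * s i..\<mu> * s (Suc i)} \<subseteq> {0..1}"
    using s0 s1 \<mu> by (auto simp: field_simps intro: order_trans[OF mult_nonneg_nonneg[of \<mu> "s i"]]
        order_trans[OF _ mult_left_le[of "s (Suc i)" \<mu>]])
  have inner: "0 < t / \<mu>" "t / \<mu> < 1" if "\<mu> * s i < t" "t < \<mu> * s (Suc i)" for t
  proof -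
    have "0 < t" using that s0 \<mu> mult_nonneg_nonneg[of \<mu> "s i"] by linarith
    then show "0 < t / \<mu>" using \<mu> by simp
    have "\<mu> * s (Suc i) \<le> \<mu>" using s1 \<mu> by (simp add: mult_left_le)
    then have "t < \<mu>" using that by linarith
    then show "t / \<mu> < 1" using \<mu> by simp
  qed
  show ?thesis
    unfolding \<mu>_def[symmetric]
  proof (unfold_locales)
    show "3 \<le> n" "0 < q" "q \<le> 4 / (real n - 2)" by (fact n_ge q_pos q_sub)+
    show "0 \<le> \<mu> * s i" using s0 \<mu> by simp
    show "\<mu> * s i < \<mu> * z (Suc i)" using s_less_z[OF i] \<mu> by simp
    show "\<mu> * z (Suc i) < \<mu> * s (Suc i)" using z_less_s[of "Suc i"] i \<mu> by simp
    show "continuous_on {\<mu> * s i..\<mu> * s (Suc i)} (Vs i)"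
      unfolding V using \<mu> a by (intro continuous_intros continuous_on_compose2[OF cont_w _ img]) auto
    show "continuous_on {\<mu> * s i..\<mu> * s (Suc i)} (Ys i)"
      unfolding Yv using \<mu> a by (intro continuous_intros continuous_on_compose2[OF cont_Y _ img]) auto
    show "(Vs i has_real_derivative - (Ys i t / t ^ (n - 1))) (at t)"
      if t: "\<mu> * s i < t" "t < \<mu> * s (Suc i)" for t
    proof -
      define r where "r = t / \<mu>"
      have r: "0 < r" "r < 1" "t = \<mu> * r" using inner[OF t] \<mu> by (auto simp: r_def)
      have "(Vs i has_real_derivative \<sigma> * (w' (t / \<mu>) * (1 / \<mu>)) / a) (at t)"
        unfolding V using inner[OF t]
        by (intro DERIV_cdivide DERIV_cmult DERIV_chain2[OF deriv_w_at chain])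
      moreover have "\<sigma> * (w' (t / \<mu>) * (1 / \<mu>)) / a = - (Ys i t / t ^ (n - 1))"
        unfolding Yv r_def[symmetric] Y_def using r \<mu> a by (simp add: l field_simps)
      ultimately show ?thesis by simp
    qed
    show "(Ys i has_real_derivative t ^ (n - 1) * (\<bar>Vs i t\<bar> powr q * Vs i t)) (at t)"
      if t: "\<mu> * s i < t" "t < \<mu> * s (Suc i)" for t
    proof -
      define r where "r = t / \<mu>"
      have r: "0 < r" "r < 1" "t = \<mu> * r" using inner[OF t] \<mu> by (auto simp: r_def)
      have "(Ys i has_real_derivative \<sigma> * \<mu> ^ (n - 2) / a *
          (r ^ (n - 1) * (\<bar>w r\<bar> powr q * w r) * (1 / \<mu>))) (at t)"
        unfolding Yv using inner[OF t] unfolding r_def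
        by (intro DERIV_cmult DERIV_chain2[OF deriv_Y chain])
      moreover have "\<bar>Vs i t\<bar> powr q = \<bar>w r\<bar> powr q / \<mu>\<^sup>2"
        unfolding V r_def[symmetric] \<mu>2 using a \<sigma> by (auto simp: powr_divide abs_mult)
      moreover have "\<sigma> * \<mu> ^ (n - 2) / a * (r ^ (n - 1) * (\<bar>w r\<bar> powr q * w r) * (1 / \<mu>))
          = t ^ (n - 1) * (\<bar>w r\<bar> powr q / \<mu>\<^sup>2 * Vs i t)"
        unfolding V r_def[symmetric] unfolding r(3) using r(1) \<mu> a
        by (simp add: l field_simps power2_eq_square)
      ultimately show ?thesis by simp
    qed
    show "Vs i (\<mu> * s i) = 1"
      unfolding V using \<mu> a sg_w_s[of i] i by (simp add: \<sigma>_def a_def)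
    show "Ys i (\<mu> * s i) = 0" "Ys i (\<mu> * s (Suc i)) = 0"
      unfolding Yv using \<mu> Y_s[of i] Y_s[of "Suc i"] i by auto
    show "Vs i (\<mu> * z (Suc i)) = 0"
      unfolding V using \<mu> z_bounds[of "Suc i"] i by simp
    show "0 < Vs i t" if t: "\<mu> * s i < t" "t < \<mu> * z (Suc i)" for t
    proof -
      have "s i < t / \<mu>" "t / \<mu> < z (Suc i)"
        using t \<mu> by (auto simp: field_simps)
      then have "0 < \<sigma> * w (t / \<mu>)"
        using sg_w_pos[of i "t / \<mu>"] z_le_s[of i] i by (simp add: \<sigma>_def)
      then show ?thesis unfolding V using a by simp
    qed
    show "Vs i t < 0" if t: "\<mu> * z (Suc i) < t" "t \<le> \<mu> * s (Suc i)" for t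
    proof -
      have r: "z (Suc i) < t / \<mu>" "t / \<mu> \<le> s (Suc i)"
        using t \<mu> by (auto simp: field_simps)
      have "0 < sg (Suc i) * w (t / \<mu>)"
      proof (cases "t / \<mu> = s (Suc i)")
        case True
        then show ?thesis using sg_w_s_pos[of "Suc i"] i by simp
      next
        case False
        then show ?thesis
          using sg_w_pos[of "Suc i" "t / \<mu>"] r s_le_z[of "Suc i"] i by simp
      qed
      then have "\<sigma> * w (t / \<mu>) < 0"
        using sg_Suc[OF i] by (simp add: \<sigma>_def)
      then show ?thesis unfolding V using a by (simp add: divide_neg_pos)
    qed
  qed
qed

lemma Vs_abs: "i < k \<Longrightarrow> \<bar>Vs i (scale i * s (Suc i))\<bar> = amp (Suc i) / amp i"
  using scale_pos[of i] amp_pos[of i] sg_cases[of i] by (auto simp: Vs_def amp_def[of "Suc i"] abs_mult)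

lemma w'_z_abs:
  assumes i: "i < k"
  shows "\<bar>w' (z (Suc i))\<bar> = Ys i (scale i * z (Suc i)) / (scale i * z (Suc i)) ^ (n - 1) * amp i * scale i"
proof -
  obtain l where l: "n = l + 3"
    using n_ge by (metis add.commute le_Suc_ex)
  have pos: "0 < z (Suc i)" "0 < scale i" "0 < amp i"
    using z_bounds[of "Suc i"] scale_pos[of i] amp_pos[of i] i by auto
  have "sg i * Y (z (Suc i)) = \<bar>Y (z (Suc i))\<bar>"
    using sg_Y_z_pos[OF i] sg_cases[of i] i by auto
  also have "\<dots> = z (Suc i) ^ (n - 1) * \<bar>w' (z (Suc i))\<bar>"
    using pos by (simp add: Y_def abs_mult)
  finally have "Ys i (scale i * z (Suc i)) = scale i ^ (n - 2) / amp i * (z (Suc i) ^ (n - 1) * \<bar>w' (z (Suc i))\<bar>)"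
    using pos by (simp add: Ys_def mult_ac)
  then show ?thesis
    using pos by (simp add: l field_simps)
qed

lemma w_zeros_eq: "{r \<in> {0..1}. w r = 0} = z ` {1..k}"
proof -
  have "w 0 \<noteq> 0" "w 1 \<noteq> 0"
    using sg_w_s_pos[of 0] sg_w_s_pos[of k] s_0 s_last by auto
  then have "{r \<in> {0..1}. w r = 0} = Z"
    unfolding Z_def by (metis (no_types, lifting) atLeastAtMost_iff greaterThanLessThan_iff less_eq_real_def)
  then show ?thesis by (simp add: Z_eq)
qed

text \<open>The arcs are indexed from the center outwards, against the indexing of the paper.\<close>

lemma nodal_structure:
  obtains s z where "s 0 = 0" "s k = 1" "\<And>i. i < k \<Longrightarrow> s i < z (Suc i)" "\<And>i. i < k \<Longrightarrow> z (Suc i) < s (Suc i)"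
    "{r \<in> {0..1}. w' r = 0} = s ` {0..k}" "{r \<in> {0..1}. w r = 0} = z ` {1..k}"
    "\<And>i. i \<le> k \<Longrightarrow> 0 < \<bar>w (s i)\<bar>"
    "\<And>i. i < k \<Longrightarrow> rescaled_arc n q (\<lambda>i. \<bar>w (s i)\<bar>) s z (\<lambda>i. \<bar>w' (z i)\<bar>) i"
proof (rule that[of s z])
  fix i
  show "s 0 = 0" "s k = 1" by (rule s_0 s_last)+
  show "s i < z (Suc i)" if "i < k" using s_less_z[OF that] .
  show "z (Suc i) < s (Suc i)" if "i < k" using z_less_s[of "Suc i"] that by simp
  show "{r \<in> {0..1}. w' r = 0} = s ` {0..k}" by (rule critical_eq)
  show "{r \<in> {0..1}. w r = 0} = z ` {1..k}" by (rule w_zeros_eq)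
  show "0 < \<bar>w (s i)\<bar>" if "i \<le> k" using amp_pos[OF that] by (simp add: amp_def)
  show "rescaled_arc n q (\<lambda>i. \<bar>w (s i)\<bar>) s z (\<lambda>i. \<bar>w' (z i)\<bar>) i"
    if "i < k"
    using nodal_arc_rescaled[OF that] Vs_abs[OF that] w'_z_abs[OF that]
    unfolding rescaled_arc_def scale_def amp_def by blast
qed

end

lemma neumann_radial_profile:
  fixes u :: "'a::euclidean_space \<Rightarrow> real"
  assumes dim: "3 \<le> DIM('a)" and rad: "radial u" and sol: "neumann_solution q u"
    and q: "0 < q" "q \<le> 4 / (real DIM('a) - 2)" and zeros: "has_interior_zeros u k" "1 \<le> k"
  obtains w' where "radial_profile DIM('a) k q (profile u) w'"
    "critical_points u = {r \<in> {0..1}. w' r = 0}"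
    "\<And>r. r \<in> {0..1} \<Longrightarrow> profile_deriv u r = w' r"
proof -
  obtain e :: 'a where e: "e \<in> Basis" using nonempty_Basis by blast
  have C2: "C2_on (ball 0 1) u" and C1: "C1_on (cball 0 1) u"
    and eq: "\<And>x. x \<in> ball 0 1 \<Longrightarrow> - laplacian u x = \<bar>u x\<bar> powr q * u x"
    and neumann: "\<forall>x\<in>sphere 0 1. ((\<lambda>t. u (x + t *\<^sub>R x)) has_real_derivative 0) (at 0 within {..0})"
    using sol unfolding neumann_solution_def by auto
  obtain w' where w': "\<And>r. r \<in> {0..1} \<Longrightarrow> (profile u has_real_derivative w' r) (at r within {0..1})"
    "continuous_on {0..1} w'" "w' 0 = 0"
    using profile_C1[OF rad C1] by blast
  have w'1: "w' 1 = 0"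
    using profile_deriv_1[OF rad w'(1) neumann] by simp
  have "radial_profile DIM('a) k q (profile u) w'"
  proof (unfold_locales)
    show "(w' has_real_derivative - (\<bar>profile u r\<bar> powr q * profile u r) - (real DIM('a) - 1) / r * w' r) (at r)"
      if r: "0 < r" "r < 1" for r
    proof -
      have "- laplacian u (r *\<^sub>R e) = \<bar>profile u r\<bar> powr q * profile u r"
        using eq[of "r *\<^sub>R e"] r e profile_scaleR[OF rad, of e r] by simp
      then have "laplacian u (r *\<^sub>R e) = - (\<bar>profile u r\<bar> powr q * profile u r)"
        by linarith
      then show ?thesis
        using profile_C2[OF rad C2 w'(1) r e refl] by simp
    qed
  qed (use dim q zeros w' w'1 in \<open>auto simp: has_interior_zeros_def\<close>)
  moreover have unique: "D = w' r" if "(profile u has_real_derivative D) (at r within {0..1})" "r \<in> {0..1}" for r D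
    using vector_derivative_unique_within_closed_interval[of 0 1 r "profile u" D "w' r"] that w'(1)
    by (simp add: has_real_derivative_iff_has_vector_derivative)
  then have "critical_points u = {r \<in> {0..1}. w' r = 0}"
    using w'(1) unfolding critical_points_def by fastforce
  moreover have "profile_deriv u r = w' r" if "r \<in> {0..1}" for r
    unfolding profile_deriv_def using w'(1)[OF that] that
    by (intro vector_derivative_within_closed_interval)
      (auto simp: has_real_derivative_iff_has_vector_derivative)
  ultimately show ?thesis using that by blast
qed

section \<open>Chaining the arcs\<close>

text \<open>\<open>f\<close> is asymptotic to \<open>C * x powr \<alpha>\<close>. Positivity of
  \<open>f\<close> and \<open>C\<close> is included so that products, quotients and real powers can
  be formed without side conditions on them.\<close>

definition pow_asymp :: "(nat \<Rightarrow> real) \<Rightarrow> real \<Rightarrow> real \<Rightarrow> (nat \<Rightarrow> real) \<Rightarrow> bool" where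
  "pow_asymp x \<alpha> C f \<longleftrightarrow> 0 < C \<and> (\<forall>i. 0 < f i) \<and> (\<lambda>i. f i * x i powr - \<alpha>) \<longlonglongrightarrow> C"

lemma pow_asymp_mult:
  assumes "pow_asymp x \<alpha> C f" "pow_asymp x \<beta> D g"
  shows "pow_asymp x (\<alpha> + \<beta>) (C * D) (\<lambda>i. f i * g i)"
proof -
  have "(\<lambda>i. (f i * x i powr - \<alpha>) * (g i * x i powr - \<beta>)) \<longlonglongrightarrow> C * D"
    using assms unfolding pow_asymp_def by (intro tendsto_mult) auto
  moreover have "(f i * x i powr - \<alpha>) * (g i * x i powr - \<beta>) = f i * g i * x i powr - (\<alpha> + \<beta>)" for i
    by (simp add: powr_add powr_diff powr_minus divide_inverse mult_ac)
  ultimately show ?thesis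
    using assms by (simp add: pow_asymp_def)
qed

text \<open>The exponents may vary with the index, as \<open>q\<close> does; the logarithmic
  condition says that replacing them by their limit changes the power of \<open>x\<close> by a
  factor tending to 1.\<close>

lemma pow_asymp_powr:
  assumes f: "pow_asymp x \<alpha> C f" and x: "\<And>i. 0 < x i"
    and \<theta>: "\<theta> \<longlonglongrightarrow> t" and log: "(\<lambda>i. (\<theta> i - t) * ln (x i)) \<longlonglongrightarrow> 0"
  shows "pow_asymp x (\<alpha> * t) (C powr t) (\<lambda>i. f i powr \<theta> i)"
proof -
  have "(\<lambda>i. (f i * x i powr - \<alpha>) powr \<theta> i * exp (\<alpha> * ((\<theta> i - t) * ln (x i)))) \<longlonglongrightarrow> C powr t * exp (\<alpha> * 0)"
    using f \<theta> log unfolding pow_asymp_def by (intro tendsto_intros) auto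
  moreover have "(f i * x i powr - \<alpha>) powr \<theta> i * exp (\<alpha> * ((\<theta> i - t) * ln (x i))) = f i powr \<theta> i * x i powr - (\<alpha> * t)" for i
  proof -
    have "exp (\<alpha> * ((\<theta> i - t) * ln (x i))) = x i powr (\<alpha> * (\<theta> i - t))"
      using x[of i] by (simp add: powr_def)
    moreover have "(f i * x i powr - \<alpha>) powr \<theta> i = f i powr \<theta> i * x i powr (- \<alpha> * \<theta> i)"
      using f by (simp add: pow_asymp_def powr_mult powr_powr less_imp_le)
    moreover have "- \<alpha> * \<theta> i + \<alpha> * (\<theta> i - t) = - (\<alpha> * t)"
      by (simp add: algebra_simps)
    ultimately show ?thesis
      by (simp only: mult.assoc powr_add[symmetric])
  qed
  moreover have "0 < C" "0 < f i" for i
    using f by (auto simp: pow_asymp_def)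
  then have "0 < C powr t" "0 < f i powr \<theta> i" for i
    by (metis less_irrefl powr_gt_zero)+
  ultimately show ?thesis
    by (simp only: pow_asymp_def mult_zero_right exp_zero mult_1_right simp_thms)
qed

lemma pow_asymp_powr_const:
  assumes "pow_asymp x \<alpha> C f" "\<And>i. 0 < x i"
  shows "pow_asymp x (\<alpha> * t) (C powr t) (\<lambda>i. f i powr t)"
  using pow_asymp_powr[OF assms, of "\<lambda>_. t" t] by simp

lemma pow_asymp_divide:
  assumes "pow_asymp x \<alpha> C f" "pow_asymp x \<beta> D g" and x: "\<And>i. 0 < x i"
  shows "pow_asymp x (\<alpha> - \<beta>) (C / D) (\<lambda>i. f i / g i)"
proof -
  have "pow_asymp x (\<alpha> + \<beta> * - 1) (C * D powr - 1) (\<lambda>i. f i * g i powr - 1)"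
    by (intro pow_asymp_mult pow_asymp_powr_const assms)
  moreover have "g i powr - 1 = 1 / g i" "D powr - 1 = 1 / D" for i
    using assms unfolding pow_asymp_def by (auto simp: powr_minus_divide less_imp_le)
  ultimately show ?thesis by simp
qed

section \<open>Recursion over the arcs, from the center outwards\<close>

locale amplitude_family =
  fixes n k :: nat and \<epsilon> :: "nat \<Rightarrow> real" and a s z d :: "nat \<Rightarrow> nat \<Rightarrow> real"
  assumes n_ge: "3 \<le> n" and k_ge: "1 \<le> k"
    and eps_pos: "\<And>i. 0 < \<epsilon> i" and eps_less: "\<And>i. \<epsilon> i < 4 / (real n - 2)" and eps_lim: "\<epsilon> \<longlonglongrightarrow> 0"
    and s_0: "\<And>i. s i 0 = 0" and s_last: "\<And>i. s i k = 1"
    and s_less_z: "\<And>i j. j < k \<Longrightarrow> s i j < z i (Suc j)" and z_less_s: "\<And>i j. j < k \<Longrightarrow> z i (Suc j) < s i (Suc j)"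
    and a_pos: "\<And>i j. j \<le> k \<Longrightarrow> 0 < a i j"
    and arcs: "\<And>i j. j < k \<Longrightarrow> rescaled_arc n (4 / (real n - 2) - \<epsilon> i) (a i) (s i) (z i) (d i) j"
begin

abbreviation nu :: real where "nu \<equiv> real n - 2"
abbreviation N :: real where "N \<equiv> real n * (real n - 2)"
abbreviation q :: "nat \<Rightarrow> real" where "q i \<equiv> 4 / (real n - 2) - \<epsilon> i"
abbreviation x :: "nat \<Rightarrow> real" where "x i \<equiv> kappa n * \<epsilon> i"

definition \<mu> :: "nat \<Rightarrow> nat \<Rightarrow> real" where "\<mu> i j = a i j powr (q i / 2)"

lemma nu_pos: "0 < nu" and N_pos: "0 < N" and n_pos: "0 < real n"
  using n_ge by auto

lemma q_pos: "0 < q i"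
  using eps_less[of i] by simp

lemma x_pos: "0 < x i"
  using kappa_pos[OF n_ge] eps_pos by simp

lemma x_lim: "x \<longlonglongrightarrow> 0"
  using eps_lim by (auto intro!: tendsto_eq_intros)

lemma x_ln_lim: "(\<lambda>i. x i * ln (x i)) \<longlonglongrightarrow> 0"
  by (intro tendsto_mult_ln_zero x_pos x_lim)

lemma q_lim: "q \<longlonglongrightarrow> 4 / nu"
  using eps_lim by (auto intro!: tendsto_eq_intros)

lemma \<mu>_pos: "j \<le> k \<Longrightarrow> 0 < \<mu> i j"
  using a_pos[of j i] by (simp add: \<mu>_def)

text \<open>One arc of every member of the family forms a \<open>nodal_sequence\<close> with
  \<open>j\<close> preceding bubbles. The first conclusion is the hypothesis for the next arc; the
  others are its limits with the scaling undone.\<close>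

lemma step:
  assumes j: "j < k" and tau: "(\<lambda>i. (\<mu> i j * s i j) ^ n / x i) \<longlonglongrightarrow> j * N powr (n / 2)"
  shows "(\<lambda>i. (\<mu> i (Suc j) * s i (Suc j)) ^ n / x i) \<longlonglongrightarrow> Suc j * N powr (n / 2)"
    and "(\<lambda>i. (\<mu> i j * z i (Suc j)) ^ (n - 2) * x i) \<longlonglongrightarrow> N powr (nu / 2) / Suc j"
    and "(\<lambda>i. a i (Suc j) / a i j / x i) \<longlonglongrightarrow> Suc j"
    and "(\<lambda>i. d i (Suc j) * (\<mu> i j * z i (Suc j)) ^ (n - 1) / (a i j * \<mu> i j)) \<longlonglongrightarrow> N powr (n / 2) / n"
proof -
  obtain V Y where VY: "\<And>i. nodal_arc n (q i) (V i) (Y i) (\<mu> i j * s i j) (\<mu> i j * z i (Suc j)) (\<mu> i j * s i (Suc j))"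
    "\<And>i. \<bar>V i (\<mu> i j * s i (Suc j))\<bar> = a i (Suc j) / a i j"
    "\<And>i. d i (Suc j) = Y i (\<mu> i j * z i (Suc j)) / (\<mu> i j * z i (Suc j)) ^ (n - 1) * a i j * \<mu> i j"
    using arcs[OF j] unfolding rescaled_arc_def \<mu>_def by metis
  have seq: "nodal_sequence n \<epsilon> V Y (\<lambda>i. \<mu> i j * s i j) (\<lambda>i. \<mu> i j * z i (Suc j)) (\<lambda>i. \<mu> i j * s i (Suc j)) (real j)"
    by (rule nodal_sequence.intro) (use VY tau eps_pos eps_lim in auto)
  note T_gt_1 = nodal_sequence.T_gt_1[OF seq] and zero_lim = nodal_sequence.zero_lim[OF seq]
    and amplitude_lim = nodal_sequence.amplitude_lim[OF seq] and next_tau_lim = nodal_sequence.next_tau_lim[OF seq]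
    and flux_lim = nodal_sequence.flux_lim[OF seq]
  have pos: "0 < a i j" "0 < a i (Suc j)" "0 < \<mu> i j" for i
    using a_pos[of j i] a_pos[of "Suc j" i] \<mu>_pos[of j i] j by auto
  show "(\<lambda>i. (\<mu> i j * z i (Suc j)) ^ (n - 2) * x i) \<longlonglongrightarrow> N powr (nu / 2) / Suc j"
    using zero_lim by (simp add: add.commute)
  show "(\<lambda>i. a i (Suc j) / a i j / x i) \<longlonglongrightarrow> Suc j"
    using amplitude_lim unfolding VY(2) by (simp only: of_nat_Suc add.commute)
  have "(a i (Suc j) / a i j) powr (q i / 2) * (\<mu> i j * s i (Suc j)) = \<mu> i (Suc j) * s i (Suc j)" for i
  proof -
    have "(a i (Suc j) / a i j) powr (q i / 2) = \<mu> i (Suc j) / \<mu> i j"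
      using pos[of i] by (simp add: powr_divide \<mu>_def less_imp_le)
    then show ?thesis using pos(3)[of i] by simp
  qed
  then show "(\<lambda>i. (\<mu> i (Suc j) * s i (Suc j)) ^ n / x i) \<longlonglongrightarrow> Suc j * N powr (n / 2)"
    using next_tau_lim unfolding VY(2) by (simp only: of_nat_Suc add.commute)
  have "d i (Suc j) * (\<mu> i j * z i (Suc j)) ^ (n - 1) / (a i j * \<mu> i j) = Y i (\<mu> i j * z i (Suc j))" for i
  proof -
    have "0 < \<mu> i j * z i (Suc j)"
      using T_gt_1[of i] by simp
    then have "(\<mu> i j * z i (Suc j)) ^ (n - 1) \<noteq> 0"
      by (metis less_irrefl zero_less_power)
    then show ?thesis
      using pos(1,3)[of i] unfolding VY(3) by (simp del: power_mult_distrib)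
  qed
  then show "(\<lambda>i. d i (Suc j) * (\<mu> i j * z i (Suc j)) ^ (n - 1) / (a i j * \<mu> i j)) \<longlonglongrightarrow> N powr (n / 2) / n"
    using flux_lim by simp
qed

lemma tau_lim: "j \<le> k \<Longrightarrow> (\<lambda>i. (\<mu> i j * s i j) ^ n / x i) \<longlonglongrightarrow> j * N powr (n / 2)"
proof (induction j)
  case 0
  then show ?case using n_ge by (simp add: s_0 zero_power)
next
  case (Suc j)
  then show ?case by (intro step(1)) auto
qed

lemmas steps = step[OF _ tau_lim[OF less_imp_le]]

lemma s_pos: "0 < j \<Longrightarrow> j \<le> k \<Longrightarrow> 0 < s i j"
proof (induction j rule: nat_induct_non_zero)
  case 1
  then show ?case using s_less_z[of 0 i] z_less_s[of 0 i] s_0[of i] by simp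
next
  case (Suc j)
  then show ?case using s_less_z[of j i] z_less_s[of j i] by fastforce
qed

lemma z_pos: "j < k \<Longrightarrow> 0 < z i (Suc j)"
  using s_less_z[of j i] s_pos[of j i] s_0[of i] by (cases "j = 0") auto

lemma tau_asymp:
  assumes j: "0 < j" "j \<le> k"
  shows "pow_asymp x (1 / n) ((j * N powr (n / 2)) powr (1 / n)) (\<lambda>i. \<mu> i j * s i j)"
proof -
  have pos: "0 < \<mu> i j * s i j" for i
    using \<mu>_pos[of j i] s_pos[OF j] j by simp
  have N2: "0 < N powr (n / 2)" using n_ge by simp
  have "pow_asymp x 1 (j * N powr (n / 2)) (\<lambda>i. (\<mu> i j * s i j) ^ n)"
    unfolding pow_asymp_def
    using tau_lim[OF j(2)] x_pos pos j N2 by (simp add: powr_minus_divide less_imp_le zero_less_power del: power_mult_distrib)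
  from pow_asymp_powr_const[OF this x_pos, of "1 / n"]
  have "pow_asymp x (1 / n) ((j * N powr (n / 2)) powr (1 / n)) (\<lambda>i. ((\<mu> i j * s i j) ^ n) powr (1 / n))"
    by simp
  moreover have "((\<mu> i j * s i j) ^ n) powr (1 / n) = \<mu> i j * s i j" for i
  proof -
    have "(\<mu> i j * s i j) ^ n = (\<mu> i j * s i j) powr n"
      using pos[of i] by (simp only: powr_realpow)
    then show ?thesis
      using pos[of i] n_pos by (simp only: powr_powr) simp
  qed
  ultimately show ?thesis by simp
qed

lemma T_asymp:
  assumes j: "j < k"
  shows "pow_asymp x (- 1 / nu) ((N powr (nu / 2) / Suc j) powr (1 / nu)) (\<lambda>i. \<mu> i j * z i (Suc j))"
proof -
  have pos: "0 < \<mu> i j * z i (Suc j)" for i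
    using \<mu>_pos[of j i] z_pos[OF j] j by simp
  have N2: "0 < N powr (nu / 2)" using n_ge by simp
  have "pow_asymp x (- 1) (N powr (nu / 2) / Suc j) (\<lambda>i. (\<mu> i j * z i (Suc j)) ^ (n - 2))"
    unfolding pow_asymp_def
    using steps(2)[OF j j] x_pos pos N2 by (simp add: less_imp_le zero_less_power del: power_mult_distrib of_nat_Suc)
  from pow_asymp_powr_const[OF this x_pos, of "1 / nu"]
  have "pow_asymp x (- 1 / nu) ((N powr (nu / 2) / Suc j) powr (1 / nu)) (\<lambda>i. ((\<mu> i j * z i (Suc j)) ^ (n - 2)) powr (1 / nu))"
    by simp
  moreover have "((\<mu> i j * z i (Suc j)) ^ (n - 2)) powr (1 / nu) = \<mu> i j * z i (Suc j)" for i
  proof -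
    have "(\<mu> i j * z i (Suc j)) ^ (n - 2) = (\<mu> i j * z i (Suc j)) powr nu"
      using powr_realpow[OF pos[of i], of "n - 2"] n_ge by (simp add: of_nat_diff)
    then show ?thesis
      using pos[of i] nu_pos by (simp only: powr_powr) simp
  qed
  ultimately show ?thesis by simp
qed

lemma ratio_asymp:
  assumes j: "j < k"
  shows "pow_asymp x 1 (Suc j) (\<lambda>i. a i (Suc j) / a i j)"
  unfolding pow_asymp_def
  using steps(3)[OF j j] x_pos a_pos[of j] a_pos[of "Suc j"] j
  by (simp add: powr_minus_divide less_imp_le del: of_nat_Suc)

lemma flux_asymp:
  assumes j: "j < k"
  shows "pow_asymp x 0 (N powr (n / 2) / n) (\<lambda>i. d i (Suc j) * (\<mu> i j * z i (Suc j)) ^ (n - 1) / (a i j * \<mu> i j))"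
proof -
  have "0 < d i (Suc j)" for i
  proof -
    obtain V Y where 1: "nodal_arc n (q i) V Y (\<mu> i j * s i j) (\<mu> i j * z i (Suc j)) (\<mu> i j * s i (Suc j))"
      and 2: "d i (Suc j) = Y (\<mu> i j * z i (Suc j)) / (\<mu> i j * z i (Suc j)) ^ (n - 1) * a i j * \<mu> i j"
      using arcs[OF j, of i] unfolding rescaled_arc_def \<mu>_def by blast
    have "0 < Y (\<mu> i j * z i (Suc j))"
      using nodal_arc.Y_pos[OF 1] nodal_arc.tau_less[OF 1] by simp
    then show ?thesis
      unfolding 2 using a_pos[of j i] \<mu>_pos[of j i] z_pos[OF j, of i] j
      by (intro mult_pos_pos divide_pos_pos zero_less_power) auto
  qed
  then have "0 < d i (Suc j) * (\<mu> i j * z i (Suc j)) ^ (n - 1) / (a i j * \<mu> i j)" for i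
    using a_pos[of j i] \<mu>_pos[of j i] z_pos[OF j, of i] j
    by (intro mult_pos_pos divide_pos_pos zero_less_power) auto
  moreover have "0 < N powr (n / 2) / n" using n_ge by simp
  moreover have "x i powr - 0 = 1" for i
    using x_pos[of i] by (metis less_irrefl minus_zero powr_zero_eq_one)
  ultimately show ?thesis
    unfolding pow_asymp_def using steps(4)[OF j j] by (simp only: mult_1_right simp_thms)
qed

definition C0 :: real where "C0 = ((k * N powr (n / 2)) powr (1 / n)) powr (nu / 2)"

text \<open>As \<open>s i k = 1\<close>, the rescaled last critical point is just
  \<open>\<mu> i k\<close>, a power of the amplitude \<open>a i k\<close>. Its known asymptotics can
  be solved for that amplitude, which fixes the scale of the whole solution.\<close>

lemma last_amp_asymp: "pow_asymp x (1 / n * (nu / 2)) C0 (\<lambda>i. a i k)"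
proof -
  have "pow_asymp x (1 / n * (nu / 2)) C0 (\<lambda>i. (\<mu> i k * s i k) powr (2 / q i))"
    unfolding C0_def
  proof (rule pow_asymp_powr[OF tau_asymp x_pos])
    have "(\<lambda>i. 2 / q i) \<longlonglongrightarrow> 2 / (4 / nu)"
      using nu_pos by (intro tendsto_divide q_lim tendsto_const) auto
    moreover have "2 / (4 / d) = d / 2" for d :: real
      by simp
    ultimately show "(\<lambda>i. 2 / q i) \<longlonglongrightarrow> nu / 2" by (simp only:)
    have "(\<lambda>i. nu / 2 / q i / kappa n * (x i * ln (x i))) \<longlonglongrightarrow> nu / 2 / (4 / nu) / kappa n * 0"
      using nu_pos kappa_pos[OF n_ge] by (intro tendsto_mult tendsto_divide q_lim x_ln_lim tendsto_const) auto
    moreover have "nu / 2 / q i / kappa n * (x i * ln (x i)) = (2 / q i - nu / 2) * ln (x i)" for i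
    proof -
      define Q where "Q = q i"
      have Q: "Q \<noteq> 0" using q_pos[of i] by (simp add: Q_def)
      have "\<epsilon> i = 4 / nu - Q" by (simp add: Q_def)
      then have "nu / 2 / Q * \<epsilon> i = 2 / Q - nu / 2"
        using Q nu_pos by (simp only:) (simp add: field_simps)
      moreover have "nu / 2 / Q / kappa n * (x i * ln (x i)) = nu / 2 / Q * \<epsilon> i * ln (x i)"
        using kappa_pos[OF n_ge] by simp
      ultimately show ?thesis
        unfolding Q_def by (simp only:)
    qed
    ultimately show "(\<lambda>i. (2 / q i - nu / 2) * ln (x i)) \<longlonglongrightarrow> 0"
      by (simp only: mult_zero_right)
  qed (use k_ge in auto)
  moreover have "(\<mu> i k * s i k) powr (2 / q i) = a i k" for i
  proof -
    have 1: "q i / 2 * (2 / q i) = 1" using q_pos[of i] by simp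
    show ?thesis
      unfolding \<mu>_def s_last mult_1_right powr_powr 1 using a_pos[of k i] by simp
  qed
  ultimately show ?thesis by simp
qed

text \<open>Descending from the boundary, each step divides by the ratio of neighbouring amplitudes,
  which is asymptotic to \<open>Suc j * x i\<close>. The product of these factors gives the quotient
  of factorials.\<close>

lemma amp_asymp:
  assumes "j \<le> k"
  shows "pow_asymp x (1 / n * (nu / 2) - (real k - real j)) (C0 * fact j / fact k) (\<lambda>i. a i j)"
  using assms
proof (induction j rule: inc_induct)
  case base
  then show ?case using last_amp_asymp by simp
next
  case (step j)
  have "pow_asymp x (1 / n * (nu / 2) - (real k - real (Suc j)) - 1) (C0 * fact (Suc j) / fact k / Suc j)
      (\<lambda>i. a i (Suc j) / (a i (Suc j) / a i j))"
    using step by (intro pow_asymp_divide ratio_asymp x_pos) auto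
  moreover have "a i (Suc j) / (a i (Suc j) / a i j) = a i j" for i
    using a_pos[of j i] a_pos[of "Suc j" i] step by simp
  moreover have "C0 * fact (Suc j) / fact k / Suc j = C0 * fact j / fact k"
    by (simp del: of_nat_Suc)
  moreover have "1 / n * (nu / 2) - (real k - real (Suc j)) - 1 = 1 / n * (nu / 2) - (real k - real j)"
    by simp
  ultimately show ?case by (simp only:)
qed

lemma \<mu>_asymp:
  assumes j: "j \<le> k"
  shows "pow_asymp x ((1 / n * (nu / 2) - (real k - real j)) * (2 / nu)) ((C0 * fact j / fact k) powr (2 / nu)) (\<lambda>i. \<mu> i j)"
  unfolding \<mu>_def
proof (rule pow_asymp_powr[OF amp_asymp[OF j] x_pos])
  have "(\<lambda>i. q i / 2) \<longlonglongrightarrow> 4 / nu / 2"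
    by (intro tendsto_divide q_lim tendsto_const) auto
  moreover have "4 / d / 2 = 2 / d" for d :: real
    by simp
  ultimately show "(\<lambda>i. q i / 2) \<longlonglongrightarrow> 2 / nu" by (simp only:)
  have "(\<lambda>i. - 1 / (2 * kappa n) * (x i * ln (x i))) \<longlonglongrightarrow> - 1 / (2 * kappa n) * 0"
    by (intro tendsto_mult x_ln_lim tendsto_const)
  moreover have "- 1 / (2 * kappa n) * (x i * ln (x i)) = (q i / 2 - 2 / nu) * ln (x i)" for i
  proof -
    have "q i / 2 - 2 / nu = - (\<epsilon> i / 2)" by (simp add: field_simps)
    then show ?thesis using kappa_pos[OF n_ge] by simp
  qed
  ultimately show "(\<lambda>i. (q i / 2 - 2 / nu) * ln (x i)) \<longlonglongrightarrow> 0"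
    by (simp only: mult_zero_right)
qed

lemma s_asymp:
  assumes j: "0 < j" "j \<le> k"
  shows "pow_asymp x (1 / n - (1 / n * (nu / 2) - (real k - real j)) * (2 / nu))
    ((j * N powr (n / 2)) powr (1 / n) / (C0 * fact j / fact k) powr (2 / nu)) (\<lambda>i. s i j)"
proof -
  have "s i j = \<mu> i j * s i j / \<mu> i j" for i
    using \<mu>_pos[of j i] j by simp
  then show ?thesis
    using pow_asymp_divide[OF tau_asymp[OF j] \<mu>_asymp[OF j(2)] x_pos] by simp
qed

lemma z_asymp:
  assumes j: "j < k"
  shows "pow_asymp x (- 1 / nu - (1 / n * (nu / 2) - (real k - real j)) * (2 / nu))
    ((N powr (nu / 2) / Suc j) powr (1 / nu) / (C0 * fact j / fact k) powr (2 / nu)) (\<lambda>i. z i (Suc j))"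
proof -
  have "z i (Suc j) = \<mu> i j * z i (Suc j) / \<mu> i j" for i
    using \<mu>_pos[of j i] j by simp
  then show ?thesis
    using pow_asymp_divide[OF T_asymp[OF j] \<mu>_asymp[OF less_imp_le[OF j]] x_pos] by simp
qed

lemma d_asymp:
  assumes j: "j < k"
  defines "\<alpha> \<equiv> 1 / n * (nu / 2) - (real k - real j)" and "A \<equiv> C0 * fact j / fact k"
  shows "pow_asymp x (0 - - 1 / nu * (real n - 1) + (\<alpha> + \<alpha> * (2 / nu)))
    (N powr (n / 2) / n / ((N powr (nu / 2) / Suc j) powr (1 / nu)) powr (real n - 1) * (A * A powr (2 / nu)))
    (\<lambda>i. d i (Suc j))"
proof -
  have pos: "0 < \<mu> i j * z i (Suc j)" "0 < a i j * \<mu> i j" for i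
    using \<mu>_pos[of j i] a_pos[of j i] z_pos[OF j] j by auto
  have "d i (Suc j) = d i (Suc j) * (\<mu> i j * z i (Suc j)) ^ (n - 1) / (a i j * \<mu> i j)
      / (\<mu> i j * z i (Suc j)) powr (real n - 1) * (a i j * \<mu> i j)" for i
  proof -
    have "(\<mu> i j * z i (Suc j)) ^ (n - 1) = (\<mu> i j * z i (Suc j)) powr (real n - 1)"
      using powr_realpow[OF pos(1)[of i], of "n - 1"] n_ge by (simp add: of_nat_diff)
    moreover have "0 < (\<mu> i j * z i (Suc j)) powr (real n - 1)"
      using pos(1)[of i] by (metis less_irrefl powr_gt_zero)
    moreover have "x = x * p / y / p * y" if "0 < y" "0 < p" for x p y :: real
      using that by simp
    note this[OF pos(2)[of i]]
    ultimately show ?thesis by (simp only:)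
  qed
  moreover have "pow_asymp x (0 - - 1 / nu * (real n - 1) + (\<alpha> + \<alpha> * (2 / nu)))
    (N powr (n / 2) / n / ((N powr (nu / 2) / Suc j) powr (1 / nu)) powr (real n - 1) * (A * A powr (2 / nu)))
    (\<lambda>i. d i (Suc j) * (\<mu> i j * z i (Suc j)) ^ (n - 1) / (a i j * \<mu> i j)
      / (\<mu> i j * z i (Suc j)) powr (real n - 1) * (a i j * \<mu> i j))"
    unfolding \<alpha>_def A_def
    by (intro pow_asymp_mult[OF pow_asymp_divide] flux_asymp pow_asymp_powr_const T_asymp
        pow_asymp_mult[OF amp_asymp \<mu>_asymp] j x_pos less_imp_le[OF j])
  ultimately show ?thesis by simp
qed

end

section \<open>From sequences back to the limit in \<epsilon>\<close>

lemma decreasing_enum_image: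
  fixes f :: "nat \<Rightarrow> real"
  assumes mono: "\<And>i j. i < j \<Longrightarrow> j < l \<Longrightarrow> f i < f j" and k: "1 \<le> k" "k \<le> l"
  shows "decreasing_enum (f ` {..<l}) k = f (l - k)"
proof -
  define xs where "xs = map f [0..<l]"
  have "sorted_wrt (<) xs"
    unfolding xs_def using mono by (simp add: sorted_wrt_iff_nth_less)
  then have "sorted xs" "distinct xs"
    by (auto simp: strict_sorted_iff)
  then have "sorted_list_of_set (set xs) = xs"
    by (rule sorted_list_of_set.idem_if_sorted_distinct)
  moreover have "set xs = f ` {..<l}"
    by (simp add: xs_def lessThan_atLeast0)
  ultimately have "decreasing_enum (f ` {..<l}) k = rev xs ! (k - 1)"
    by (simp add: decreasing_enum_def)
  also have "\<dots> = xs ! (length xs - Suc (k - 1))"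
    using k by (intro rev_nth) (simp add: xs_def)
  also have "\<dots> = f (l - k)"
    using k by (simp add: xs_def)
  finally show ?thesis .
qed

lemma card_strict_image:
  fixes f :: "nat \<Rightarrow> real"
  assumes "\<And>i j. i < j \<Longrightarrow> j < l \<Longrightarrow> f i < f j"
  shows "card (f ` {..<l}) = l"
proof -
  have "inj_on f {..<l}"
    using assms by (intro linorder_inj_onI) (auto dest: less_imp_neq)
  then show ?thesis by (simp add: card_image)
qed

lemma tendsto_at_right_0_sequentially:
  fixes f :: "real \<Rightarrow> real"
  assumes c: "0 < c"
    and seq: "\<And>X. (\<And>i. 0 < X i) \<Longrightarrow> (\<And>i. X i < c) \<Longrightarrow> X \<longlonglongrightarrow> 0 \<Longrightarrow> (\<lambda>i. f (X i)) \<longlonglongrightarrow> L"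
  shows "(f \<longlongrightarrow> L) (at_right 0)"
proof -
  \<comment> \<open>The sequences must stay strictly below \<open>c\<close>; halving ensures this on
    a closed interval and does not change the filter at 0.\<close>
  have "(f \<longlongrightarrow> L) (at 0 within {0..c / 2})"
    unfolding tendsto_at_iff_sequentially
  proof (intro allI impI)
    fix X :: "nat \<Rightarrow> real"
    assume X: "\<forall>i. X i \<in> {0..c / 2} - {0}" "X \<longlonglongrightarrow> 0"
    have "0 < X i" "X i < c" for i
      using X(1)[rule_format, of i] c by auto
    then show "(f \<circ> X) \<longlonglongrightarrow> L"
      using seq X(2) by (simp add: o_def)
  qed
  moreover have "at (0::real) within {0..c / 2} = at_right 0"
    using c by (intro at_within_Icc_at_right) simp
  ultimately show ?thesis by simp
qed

lemma sim_orderI: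
  assumes lim: "((\<lambda>\<epsilon>. \<bar>f \<epsilon>\<bar> * (c * \<epsilon>) powr e) \<longlongrightarrow> L) (at_right 0)"
    and "0 < c" "0 < L" and e: "e' = - e"
  shows "sim_order f (\<lambda>\<epsilon>. \<epsilon> powr e')"
proof -
  have "((\<lambda>\<epsilon>. \<bar>f \<epsilon>\<bar> * (c * \<epsilon>) powr e / c powr e) \<longlongrightarrow> L / c powr e) (at_right 0)"
    using assms by (intro tendsto_divide lim tendsto_const) auto
  moreover have "\<forall>\<^sub>F \<epsilon> in at_right 0. \<bar>f \<epsilon>\<bar> * (c * \<epsilon>) powr e / c powr e = \<bar>f \<epsilon>\<bar> / \<epsilon> powr e'"
    using eventually_at_right_less[of 0]
  proof eventually_elim
    case (elim \<epsilon>)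
    then show ?case
      using assms by (simp add: powr_mult powr_minus_divide)
  qed
  ultimately have "((\<lambda>\<epsilon>. \<bar>f \<epsilon>\<bar> / \<epsilon> powr e') \<longlongrightarrow> L / c powr e) (at_right 0)"
    by (rule Lim_transform_eventually)
  moreover have "0 < L / c powr e" using assms by simp
  ultimately show ?thesis
    unfolding sim_order_def by blast
qed

lemma sim_orderI_nonneg:
  assumes lim: "((\<lambda>\<epsilon>. f \<epsilon> * (c * \<epsilon>) powr e) \<longlongrightarrow> L) (at_right 0)"
    and "0 < c" "0 < L" and e: "e' = - e"
  shows "sim_order f (\<lambda>\<epsilon>. \<epsilon> powr e')"
proof (rule sim_orderI[OF _ assms(2-4)])
  have "((\<lambda>\<epsilon>. \<bar>f \<epsilon> * (c * \<epsilon>) powr e\<bar>) \<longlongrightarrow> \<bar>L\<bar>) (at_right 0)"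
    by (rule tendsto_rabs[OF lim])
  then show "((\<lambda>\<epsilon>. \<bar>f \<epsilon>\<bar> * (c * \<epsilon>) powr e) \<longlongrightarrow> L) (at_right 0)"
    using assms by (simp add: abs_mult)
qed

text \<open>The coefficients are products of real powers; after taking logarithms their identities
  become linear in a few logarithms.\<close>

lemma ln_eqD: "0 < x \<Longrightarrow> 0 < y \<Longrightarrow> ln x = ln y \<Longrightarrow> x = (y::real)"
  by simp

lemma D_coeff_pos: "3 \<le> n \<Longrightarrow> 2 \<le> m \<Longrightarrow> k \<le> m \<Longrightarrow> 0 < D_coeff n k m"
  unfolding D_coeff_def by (intro mult_pos_pos divide_pos_pos Gamma_real_pos) auto

lemma other_coeffs_pos:
  assumes "2 \<le> m" "k < m"
  shows d_coeff_pos: "0 < d_coeff n k m" and z_coeff_pos: "0 < z_coeff n k m"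
    and Z_coeff_pos: "3 \<le> n \<Longrightarrow> 0 < Z_coeff n k m"
proof -
  have g: "0 < Gamma (real m)" "0 < Gamma (real m - real k + 1)"
    using assms by (auto intro!: Gamma_real_pos)
  show "0 < d_coeff n k m" "0 < z_coeff n k m" "3 \<le> n \<Longrightarrow> 0 < Z_coeff n k m"
    unfolding d_coeff_def z_coeff_def Z_coeff_def 
    using assms g[THEN less_imp_neq, symmetric] by (auto intro!: mult_pos_pos)
qed

lemma Gamma_Suc_nat: "Gamma (real j + 1) = fact j"
  using Gamma_fact[of j] by (simp add: add.commute)

section \<open>Identification of exponents and coefficients\<close>

context amplitude_family
begin

lemma C0_pos: "0 < C0"
  using last_amp_asymp by (simp add: pow_asymp_def)

text \<open>Names for both \<open>n\<close> and \<open>n - 2\<close> let simplification clear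
  denominators with atoms on either side, before \<open>w = v + 2\<close> is used.\<close>

lemma obtain_nu:
  obtains v w where "real n = w" "w - 2 = v" "w = v + 2" "0 < v" "0 < w"
  using that[of "real n" nu] nu_pos by simp

lemma ln_C0: "ln C0 = (ln k + n / 2 * (ln n + ln nu)) / n * (nu / 2)"
  unfolding C0_def using k_ge n_ge by (simp add: ln_powr ln_mult mult_ac)

text \<open>The critical point with index \<open>j\<close> from the center is number
  \<open>Suc k - j\<close> from the boundary, as there are \<open>Suc k\<close> of them.\<close>

lemma D_coeff_eq:
  assumes "j \<le> k"
  shows "C0 * fact j / fact k = D_coeff n (Suc k - j) (Suc k)"
proof (rule ln_eqD)
  show "0 < C0 * fact j / fact k" using C0_pos by simp
  show "0 < D_coeff n (Suc k - j) (Suc k)" using n_ge k_ge by (intro D_coeff_pos) auto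
  have g: "Gamma (real (Suc k) - real (Suc k - j) + 1) = fact j" "Gamma (real (Suc k)) = fact k"
    using assms Gamma_Suc_nat[of j] Gamma_Suc_nat[of k] by (auto simp: of_nat_diff algebra_simps)
  obtain v w where v: "real n = w" "w - 2 = v" "w = v + 2" "0 < v" "0 < w" by (rule obtain_nu)
  show "ln (C0 * fact j / fact k) = ln (D_coeff n (Suc k - j) (Suc k))"
    unfolding D_coeff_def g using C0_pos k_ge v(4,5)
    by (simp add: ln_mult ln_div ln_powr ln_C0 v(1,2), (simp add: field_simps)?, (simp add: v(3) algebra_simps)?)
qed

lemma d_coeff_eq:
  assumes "0 < j" "j \<le> k"
  shows "(j * N powr (n / 2)) powr (1 / n) / (C0 * fact j / fact k) powr (2 / nu) = d_coeff n (Suc k - j) (Suc k)"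
proof (rule ln_eqD)
  show "0 < (j * N powr (n / 2)) powr (1 / n) / (C0 * fact j / fact k) powr (2 / nu)"
    using C0_pos n_ge assms by simp
  show "0 < d_coeff n (Suc k - j) (Suc k)" using k_ge assms by (intro d_coeff_pos) auto
  have g: "Gamma (real (Suc k) - real (Suc k - j) + 1) = fact j" "Gamma (real (Suc k)) = fact k"
    using assms Gamma_Suc_nat[of j] Gamma_Suc_nat[of k] by (auto simp: of_nat_diff algebra_simps)
  have 1: "real (Suc k) - real (Suc k - j) = real j" "real (Suc k) - 1 = real k"
    using assms by (auto simp: of_nat_diff)
  obtain v w where v: "real n = w" "w - 2 = v" "w = v + 2" "0 < v" "0 < w" by (rule obtain_nu)
  show "ln ((j * N powr (n / 2)) powr (1 / n) / (C0 * fact j / fact k) powr (2 / nu))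
      = ln (d_coeff n (Suc k - j) (Suc k))"
    unfolding d_coeff_def g unfolding 1 using C0_pos k_ge assms v(4,5)
    by (simp add: ln_mult ln_div ln_powr ln_C0 v(1,2), (simp add: field_simps)?, (simp add: v(3) algebra_simps)?)
qed

text \<open>The zero with index \<open>Suc j\<close> from the center is number \<open>k - j\<close>
  from the boundary.\<close>

lemma z_coeff_eq:
  assumes "j < k"
  shows "(N powr (nu / 2) / Suc j) powr (1 / nu) / (C0 * fact j / fact k) powr (2 / nu) = z_coeff n (k - j) (Suc k)"
proof (rule ln_eqD)
  show "0 < (N powr (nu / 2) / Suc j) powr (1 / nu) / (C0 * fact j / fact k) powr (2 / nu)"
    using C0_pos n_ge assms by (simp del: of_nat_Suc)
  show "0 < z_coeff n (k - j) (Suc k)" using k_ge assms by (intro z_coeff_pos) auto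
  obtain J where J: "real (Suc j) = J" "0 < J" using that[of "real (Suc j)"] by simp
  have g: "Gamma (real (Suc k) - real (k - j) + 1) = J * fact j" "Gamma (real (Suc k)) = fact k"
    using assms Gamma_Suc_nat[of "Suc j"] Gamma_Suc_nat[of k] J(1) by (auto simp: of_nat_diff algebra_simps)
  have 1: "real (Suc k) - real (k - j) = J" "real (Suc k) - 1 = real k"
    using assms J(1) by (auto simp: of_nat_diff)
  obtain v w where v: "real n = w" "w - 2 = v" "w = v + 2" "0 < v" "0 < w" by (rule obtain_nu)
  show "ln ((N powr (nu / 2) / Suc j) powr (1 / nu) / (C0 * fact j / fact k) powr (2 / nu))
      = ln (z_coeff n (k - j) (Suc k))"
    unfolding z_coeff_def g unfolding 1 J(1) using C0_pos k_ge v(4,5) J(2)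
    by (simp add: ln_mult ln_div ln_powr ln_C0 v(1,2), (simp add: field_simps)?, (simp add: v(3) algebra_simps)?)
qed

lemma Z_coeff_eq:
  assumes "j < k" and A: "A = C0 * fact j / fact k"
  shows "N powr (n / 2) / n / ((N powr (nu / 2) / Suc j) powr (1 / nu)) powr (real n - 1) * (A * A powr (2 / nu))
    = Z_coeff n (k - j) (Suc k)"
proof (rule ln_eqD)
  have A0: "0 < A" using C0_pos by (simp add: A)
  have lnA: "ln A = ln C0 + ln (fact j) - ln (fact k)"
    unfolding A using C0_pos by (simp add: ln_mult ln_div)
  show "0 < N powr (n / 2) / n / ((N powr (nu / 2) / Suc j) powr (1 / nu)) powr (real n - 1) * (A * A powr (2 / nu))"
    using A0 n_ge by (intro mult_pos_pos divide_pos_pos) (auto simp del: of_nat_Suc)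
  show "0 < Z_coeff n (k - j) (Suc k)" using n_ge k_ge assms by (intro Z_coeff_pos) auto
  obtain J where J: "real (Suc j) = J" "0 < J" using that[of "real (Suc j)"] by simp
  have g: "Gamma (real (Suc k) - real (k - j) + 1) = J * fact j" "Gamma (real (Suc k)) = fact k"
    using assms Gamma_Suc_nat[of "Suc j"] Gamma_Suc_nat[of k] J(1) by (auto simp: of_nat_diff algebra_simps)
  have 1: "real (Suc k) - real (k - j) = J" "real (Suc k) - 1 = real k"
    using assms J(1) by (auto simp: of_nat_diff)
  obtain v w where v: "real n = w" "w - 2 = v" "w = v + 2" "0 < v" "0 < w" by (rule obtain_nu)
  show "ln (N powr (n / 2) / n / ((N powr (nu / 2) / Suc j) powr (1 / nu)) powr (real n - 1) * (A * A powr (2 / nu)))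
    = ln (Z_coeff n (k - j) (Suc k))"
    unfolding Z_coeff_def g unfolding 1 J(1) using A0 k_ge v(4,5) J(2)
    by (simp add: ln_mult ln_div ln_powr lnA ln_C0 v(1,2), (simp add: field_simps)?, (simp add: v(3) algebra_simps)?)
qed

theorem amplitude_limit:
  assumes "1 \<le> l" "l \<le> Suc k"
  shows "(\<lambda>i. a i (Suc k - l) * (kappa n * \<epsilon> i) powr ((2 * real l * real n - 3 * real n + 2) / (2 * real n)))
    \<longlonglongrightarrow> D_coeff n l (Suc k)"
proof -
  define j where "j = Suc k - l"
  have j: "j \<le> k" "Suc k - j = l" "real k - real j = real l - 1"
    using assms by (auto simp: j_def of_nat_diff)
  have "- (1 / n * (nu / 2) - (real l - 1)) = (2 * real l * real n - 3 * real n + 2) / (2 * real n)"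
    using n_ge by (simp add: field_simps)
  moreover have "(\<lambda>i. a i j * x i powr - (1 / n * (nu / 2) - (real l - 1))) \<longlonglongrightarrow> D_coeff n l (Suc k)"
    using amp_asymp[OF j(1)] unfolding pow_asymp_def D_coeff_eq[OF j(1)] j(2,3) by blast
  ultimately show ?thesis
    unfolding j_def by (simp only:)
qed

theorem critical_limit:
  assumes "2 \<le> l" "l \<le> k"
  shows "(\<lambda>i. s i (Suc k - l) * (kappa n * \<epsilon> i) powr (- (2 * (real l - 1) / (real n - 2))))
    \<longlonglongrightarrow> d_coeff n l (Suc k)"
proof -
  define j where "j = Suc k - l"
  have j: "0 < j" "j \<le> k" "Suc k - j = l" "real k - real j = real l - 1"
    using assms by (auto simp: j_def of_nat_diff)
  have "- (1 / n - (1 / n * (nu / 2) - (real l - 1)) * (2 / nu)) = - (2 * (real l - 1) / (real n - 2))"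
    using n_ge by (simp add: field_simps)
  then show ?thesis
    using s_asymp[OF j(1,2)] unfolding pow_asymp_def d_coeff_eq[OF j(1,2)] j(3,4) by (simp add: j_def)
qed

theorem zero_limit:
  assumes "1 \<le> l" "l \<le> k"
  shows "(\<lambda>i. z i (Suc k - l) * (kappa n * \<epsilon> i) powr
      (- ((2 * real l * real n - 2 * real n + 2) / (real n * (real n - 2)))))
    \<longlonglongrightarrow> z_coeff n l (Suc k)"
proof -
  define j where "j = k - l"
  have j: "j < k" "k - j = l" "real k - real j = real l" "Suc k - l = Suc j"
    using assms by (auto simp: j_def of_nat_diff)
  obtain v w where v: "real n = w" "w - 2 = v" "w = v + 2" "0 < v" "0 < w" by (rule obtain_nu)
  have "- (- 1 / nu - (1 / n * (nu / 2) - real l) * (2 / nu))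
      = - ((2 * real l * real n - 2 * real n + 2) / (real n * (real n - 2)))"
    unfolding v(1) using v(4,5) by (simp add: v(2) field_simps, (simp add: v(3) algebra_simps)?)
  then show ?thesis
    using z_asymp[OF j(1)] unfolding pow_asymp_def z_coeff_eq[OF j(1)] j(2,3,4) by simp
qed

theorem slope_limit:
  assumes "1 \<le> l" "l \<le> k"
  shows "(\<lambda>i. d i (Suc k - l) * (kappa n * \<epsilon> i) powr
      ((2 * real l * real n - 3 * real n + 4) / (2 * (real n - 2))))
    \<longlonglongrightarrow> Z_coeff n l (Suc k)"
proof -
  define j where "j = k - l"
  have j: "j < k" "k - j = l" "real k - real j = real l" "Suc k - l = Suc j"
    using assms by (auto simp: j_def of_nat_diff)
  obtain v w where v: "real n = w" "w - 2 = v" "w = v + 2" "0 < v" "0 < w" by (rule obtain_nu)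
  have "- (0 - - 1 / nu * (real n - 1) + (1 / n * (nu / 2) - real l + (1 / n * (nu / 2) - real l) * (2 / nu)))
      = (2 * real l * real n - 3 * real n + 4) / (2 * (real n - 2))"
    unfolding v(1) using v(4,5) by (simp add: v(2) field_simps, (simp add: v(3) algebra_simps)?)
  then show ?thesis
    using d_asymp[OF j(1)] unfolding pow_asymp_def Z_coeff_eq[OF j(1) refl] j(2,3,4) by simp
qed

end

text \<open>All that is needed of a single solution, gathered in one predicate so that
  \<open>s\<close> and \<open>z\<close> can be chosen simultaneously for all \<epsilon>. The index
  \<open>Suc k - l\<close> converts counting from the boundary into counting from the
  center.\<close>

definition nodal_data :: "nat \<Rightarrow> real \<Rightarrow> nat \<Rightarrow> ('a::real_normed_vector \<Rightarrow> real) \<Rightarrow> (nat \<Rightarrow> real) \<Rightarrow> (nat \<Rightarrow> real) \<Rightarrow> bool" where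
  "nodal_data n q k u s z \<longleftrightarrow> s 0 = 0 \<and> s k = 1 \<and>
     (\<forall>i<k. s i < z (Suc i) \<and> z (Suc i) < s (Suc i)) \<and>
     finite (critical_points u) \<and> card (critical_points u) = Suc k \<and> finite (zeros u) \<and> card (zeros u) = k \<and>
     (\<forall>l\<in>{1..Suc k}. decreasing_enum (critical_points u) l = s (Suc k - l)) \<and>
     (\<forall>l\<in>{1..k}. decreasing_enum (zeros u) l = z (Suc k - l)) \<and>
     (\<forall>i\<le>k. 0 < \<bar>profile u (s i)\<bar>) \<and>
     (\<forall>i<k. rescaled_arc n q (\<lambda>i. \<bar>profile u (s i)\<bar>) s z (\<lambda>i. \<bar>profile_deriv u (z i)\<bar>) i)"

lemma ex_nodal_data:
  fixes u :: "'a::euclidean_space \<Rightarrow> real"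
  assumes dim: "3 \<le> DIM('a)" and rad: "radial u" and sol: "neumann_solution q u"
    and q: "0 < q" "q \<le> 4 / (real DIM('a) - 2)" and zeros: "has_interior_zeros u k" "1 \<le> k"
  shows "\<exists>s z. nodal_data DIM('a) q k u s z"
proof -
  obtain w' where w': "radial_profile DIM('a) k q (profile u) w'"
    "critical_points u = {r \<in> {0..1}. w' r = 0}"
    "\<And>r. r \<in> {0..1} \<Longrightarrow> profile_deriv u r = w' r"
    using neumann_radial_profile[OF assms] by blast
  interpret radial_profile "DIM('a)" k q "profile u" w' by (rule w'(1))
  obtain s z where sz: "s 0 = 0" "s k = 1" "\<And>i. i < k \<Longrightarrow> s i < z (Suc i)" "\<And>i. i < k \<Longrightarrow> z (Suc i) < s (Suc i)"
    "{r \<in> {0..1}. w' r = 0} = s ` {0..k}" "{r \<in> {0..1}. profile u r = 0} = z ` {1..k}"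
    "\<And>i. i \<le> k \<Longrightarrow> 0 < \<bar>profile u (s i)\<bar>"
    "\<And>i. i < k \<Longrightarrow> rescaled_arc DIM('a) q (\<lambda>i. \<bar>profile u (s i)\<bar>) s z (\<lambda>i. \<bar>w' (z i)\<bar>) i"
    by (rule nodal_structure) blast
  have s_mono: "s i < s j" if "i < j" "j < Suc k" for i j
    using that
  proof (induction j)
    case (Suc j)
    have "s j < s (Suc j)" using sz(3,4)[of j] Suc.prems by simp
    then show ?case using Suc by (cases "i = j") auto
  qed simp
  have z_mono: "z (Suc i) < z (Suc j)" if "i < j" "j < k" for i j
    using s_mono[of "Suc i" j] sz(4)[of i] sz(3)[of j] that by (cases "j = Suc i") auto
  have crit: "critical_points u = s ` {..<Suc k}"
    unfolding w'(2) sz(5) by (simp add: lessThan_Suc_atMost atMost_atLeast0)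
  have zer: "zeros u = (\<lambda>i. z (Suc i)) ` {..<k}"
  proof -
    have "{1..k} = Suc ` {..<k}"
      by (simp add: lessThan_atLeast0 image_Suc_atLeastLessThan atLeastLessThanSuc_atLeastAtMost)
    then show ?thesis
      unfolding zeros_def sz(6) by (simp add: image_image)
  qed
  have slope: "\<bar>profile_deriv u (z (Suc i))\<bar> = \<bar>w' (z (Suc i))\<bar>" if "i < k" for i
  proof -
    have "z (Suc i) \<in> {r \<in> {0..1}. profile u r = 0}"
      unfolding sz(6) using that by auto
    then show ?thesis
      using w'(3) by simp
  qed
  have "nodal_data DIM('a) q k u s z"
    unfolding nodal_data_def
  proof (intro conjI allI impI ballI)
    show "card (critical_points u) = Suc k" unfolding crit by (rule card_strict_image[OF s_mono])
    show "card (zeros u) = k" unfolding zer by (rule card_strict_image[OF z_mono])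
    show "decreasing_enum (critical_points u) l = s (Suc k - l)" if "l \<in> {1..Suc k}" for l
      unfolding crit using decreasing_enum_image[of "Suc k" s l, OF s_mono] that by simp
    show "decreasing_enum (zeros u) l = z (Suc k - l)" if "l \<in> {1..k}" for l
      unfolding zer using decreasing_enum_image[of k "\<lambda>i. z (Suc i)" l, OF z_mono] that by (simp add: Suc_diff_le)
    show "rescaled_arc DIM('a) q (\<lambda>i. \<bar>profile u (s i)\<bar>) s z (\<lambda>i. \<bar>profile_deriv u (z i)\<bar>) i" if "i < k" for i
      using sz(8)[OF that] slope[OF that] by (simp add: rescaled_arc_def)
    show "finite (critical_points u)" "finite (zeros u)"
      unfolding crit zer by simp_all
  qed (fact sz(1,2) | rule sz(3,4,7); assumption)+
  then show ?thesis by blast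
qed

theorem theorem1p2:
  fixes u :: "real \<Rightarrow> real ^ 'n \<Rightarrow> real"
    and n m :: nat
    and \<delta> \<rho> :: "nat \<Rightarrow> real \<Rightarrow> real"
  assumes n_eq: "n = CARD('n)" and n_ge: "n \<ge> 3" and m_ge: "m \<ge> 2"
    and sol: "\<And>\<epsilon>. \<epsilon> \<in> {0<..<4 / (real n - 2)} \<Longrightarrow>
          radial (u \<epsilon>) \<and> neumann_solution (4 / (real n - 2) - \<epsilon>) (u \<epsilon>) \<and>
          has_interior_zeros (u \<epsilon>) (m - 1)"
    and delta_def: "\<And>k \<epsilon>. \<delta> k \<epsilon> = decreasing_enum (critical_points (u \<epsilon>)) k"
    and rho_def: "\<And>k \<epsilon>. \<rho> k \<epsilon> = decreasing_enum (zeros (u \<epsilon>)) k"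
  shows "(\<forall>\<epsilon>\<in>{0<..<4 / (real n - 2)}.
            finite (critical_points (u \<epsilon>)) \<and> card (critical_points (u \<epsilon>)) = m \<and>
            finite (zeros (u \<epsilon>)) \<and> card (zeros (u \<epsilon>)) = m - 1 \<and>
            \<delta> m \<epsilon> = 0 \<and> \<delta> 1 \<epsilon> = 1 \<and>
            (\<forall>k\<in>{1..m - 1}. \<delta> (k + 1) \<epsilon> < \<rho> k \<epsilon> \<and> \<rho> k \<epsilon> < \<delta> k \<epsilon>)) \<and>
         (\<forall>k\<in>{1..m}.
            ((\<lambda>\<epsilon>. \<bar>profile (u \<epsilon>) (\<delta> k \<epsilon>)\<bar> *
                  (kappa n * \<epsilon>) powr ((2 * real k * real n - 3 * real n + 2) / (2 * real n)))
              \<longlongrightarrow> D_coeff n k m) (at_right 0)) \<and>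
         (\<forall>k\<in>{2..m - 1}.
            ((\<lambda>\<epsilon>. \<delta> k \<epsilon> * (kappa n * \<epsilon>) powr (- (2 * (real k - 1) / (real n - 2))))
              \<longlongrightarrow> d_coeff n k m) (at_right 0)) \<and>
         (\<forall>k\<in>{1..m - 1}.
            ((\<lambda>\<epsilon>. \<bar>profile_deriv (u \<epsilon>) (\<rho> k \<epsilon>)\<bar> *
                  (kappa n * \<epsilon>) powr ((2 * real k * real n - 3 * real n + 4) / (2 * (real n - 2))))
              \<longlongrightarrow> Z_coeff n k m) (at_right 0)) \<and>
         (\<forall>k\<in>{1..m - 1}.
            ((\<lambda>\<epsilon>. \<rho> k \<epsilon> *
                  (kappa n * \<epsilon>) powr
                    (- ((2 * real k * real n - 2 * real n + 2) / (real n * (real n - 2)))))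
              \<longlongrightarrow> z_coeff n k m) (at_right 0)) \<and>
         (\<forall>k\<in>{1..m}.
            sim_order (\<lambda>\<epsilon>. profile (u \<epsilon>) (\<delta> k \<epsilon>))
              (\<lambda>\<epsilon>. \<epsilon> powr ((real n - 2) / (2 * real n) - (real k - 1)))) \<and>
         (\<forall>k\<in>{2..m - 1}.
            sim_order (\<lambda>\<epsilon>. \<delta> k \<epsilon>) (\<lambda>\<epsilon>. \<epsilon> powr (2 * (real k - 1) / (real n - 2)))) \<and>
         (\<forall>k\<in>{1..m - 1}.
            sim_order (\<lambda>\<epsilon>. profile_deriv (u \<epsilon>) (\<rho> k \<epsilon>))
              (\<lambda>\<epsilon>. \<epsilon> powr ((real n - 4) / (2 * (real n - 2)) - real n * (real k - 1) / (real n - 2)))) \<and>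
         (\<forall>k\<in>{1..m - 1}.
            sim_order (\<lambda>\<epsilon>. \<rho> k \<epsilon>)
              (\<lambda>\<epsilon>. \<epsilon> powr (2 / (real n * (real n - 2)) + 2 * (real k - 1) / (real n - 2))))"
proof -
  define k where "k = m - 1"
  have m: "m = Suc k" and k: "1 \<le> k" using m_ge by (auto simp: k_def)
  define c where "c = 4 / (real n - 2)"
  have c: "0 < c" using n_ge by (simp add: c_def)
  have dim: "DIM(real ^ 'n) = n" by (simp add: n_eq)
  have kappa: "0 < kappa n" using n_ge by (rule kappa_pos)
  have "\<exists>s z. nodal_data n (c - \<epsilon>) k (u \<epsilon>) s z" if \<epsilon>: "0 < \<epsilon>" "\<epsilon> < c" for \<epsilon>
  proof -
    have "radial (u \<epsilon>)" "neumann_solution (c - \<epsilon>) (u \<epsilon>)" "has_interior_zeros (u \<epsilon>) k"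
      using sol[of \<epsilon>] \<epsilon> by (auto simp: c_def k_def)
    moreover have "3 \<le> DIM(real ^ 'n)" "0 < c - \<epsilon>" "c - \<epsilon> \<le> 4 / (real DIM(real ^ 'n) - 2)"
      unfolding dim using n_ge \<epsilon> by (auto simp: c_def)
    ultimately have "\<exists>s z. nodal_data DIM(real ^ 'n) (c - \<epsilon>) k (u \<epsilon>) s z"
      using k by (intro ex_nodal_data)
    then show ?thesis by (simp only: dim)
  qed
  then obtain s z where data: "\<And>\<epsilon>. 0 < \<epsilon> \<Longrightarrow> \<epsilon> < c \<Longrightarrow> nodal_data n (c - \<epsilon>) k (u \<epsilon>) (s \<epsilon>) (z \<epsilon>)"
    by metis
  note sz = data[unfolded nodal_data_def]
  \<comment> \<open>The chosen data along an arbitrary null sequence \<open>X\<close> in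
    \<open>(0, c)\<close>.\<close>
  have family: "amplitude_family n k X (\<lambda>i j. \<bar>profile (u (X i)) (s (X i) j)\<bar>) (\<lambda>i. s (X i)) (\<lambda>i. z (X i))
      (\<lambda>i j. \<bar>profile_deriv (u (X i)) (z (X i) j)\<bar>)"
    if X: "\<And>i. 0 < X i" "\<And>i. X i < c" "X \<longlonglongrightarrow> 0" for X
  proof
    fix i
    note P = sz[OF X(1,2), of i]
    show "X i < 4 / (real n - 2)" using X(2) by (simp add: c_def)
    show "s (X i) 0 = 0" "s (X i) k = 1" using P by blast+
    fix j
    show "s (X i) j < z (X i) (Suc j)" "z (X i) (Suc j) < s (X i) (Suc j)" if "j < k" using P that by blast+
    show "0 < \<bar>profile (u (X i)) (s (X i) j)\<bar>" if "j \<le> k" using P that by blast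
    show "rescaled_arc n (4 / (real n - 2) - X i) (\<lambda>j. \<bar>profile (u (X i)) (s (X i) j)\<bar>) (s (X i)) (z (X i))
        (\<lambda>j. \<bar>profile_deriv (u (X i)) (z (X i) j)\<bar>) j" if "j < k"
      using P that unfolding c_def by blast
  qed (fact n_ge k X)+
  have sz_delta: "\<delta> l \<epsilon> = s \<epsilon> (Suc k - l)" if "0 < \<epsilon>" "\<epsilon> < c" "1 \<le> l" "l \<le> Suc k" for l \<epsilon>
  proof -
    have "\<forall>l\<in>{1..Suc k}. decreasing_enum (critical_points (u \<epsilon>)) l = s \<epsilon> (Suc k - l)"
      using sz[OF that(1,2)] by blast
    then show ?thesis using that by (simp add: delta_def)
  qed
  have sz_rho: "\<rho> l \<epsilon> = z \<epsilon> (Suc k - l)" if "0 < \<epsilon>" "\<epsilon> < c" "1 \<le> l" "l \<le> k" for l \<epsilon>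
  proof -
    have "\<forall>l\<in>{1..k}. decreasing_enum (zeros (u \<epsilon>)) l = z \<epsilon> (Suc k - l)"
      using sz[OF that(1,2)] by blast
    then show ?thesis using that by (simp add: rho_def)
  qed
  let ?order = "\<lambda>\<epsilon>. finite (critical_points (u \<epsilon>)) \<and> card (critical_points (u \<epsilon>)) = m \<and>
            finite (zeros (u \<epsilon>)) \<and> card (zeros (u \<epsilon>)) = m - 1 \<and>
            \<delta> m \<epsilon> = 0 \<and> \<delta> 1 \<epsilon> = 1 \<and>
            (\<forall>k\<in>{1..m - 1}. \<delta> (k + 1) \<epsilon> < \<rho> k \<epsilon> \<and> \<rho> k \<epsilon> < \<delta> k \<epsilon>)"
  have order: "\<forall>\<epsilon>\<in>{0<..<4 / (real n - 2)}. ?order \<epsilon>"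
  proof
    fix \<epsilon> assume "\<epsilon> \<in> {0<..<4 / (real n - 2)}"
    then have \<epsilon>: "0 < \<epsilon>" "\<epsilon> < c" by (auto simp: c_def)
    note P = sz[OF \<epsilon>]
    have "\<delta> (l + 1) \<epsilon> < \<rho> l \<epsilon> \<and> \<rho> l \<epsilon> < \<delta> l \<epsilon>" if "l \<in> {1..m - 1}" for l
    proof -
      have l: "1 \<le> l" "l \<le> k" using that by (auto simp: k_def)
      then have "Suc k - l = Suc (k - l)" "k - l < k" by auto
      moreover have "s \<epsilon> (k - l) < z \<epsilon> (Suc (k - l))" "z \<epsilon> (Suc (k - l)) < s \<epsilon> (Suc (k - l))"
        using P \<open>k - l < k\<close> by blast+
      ultimately show ?thesis
        using sz_delta[OF \<epsilon>, of l] sz_delta[OF \<epsilon>, of "l + 1"] sz_rho[OF \<epsilon>, of l] l by simp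
    qed
    moreover have "s \<epsilon> 0 = 0" "s \<epsilon> k = 1" using P by blast+
    then have "\<delta> m \<epsilon> = 0" "\<delta> 1 \<epsilon> = 1"
      using sz_delta[OF \<epsilon>, of m] sz_delta[OF \<epsilon>, of 1] m by simp_all
    moreover have "finite (critical_points (u \<epsilon>))" "card (critical_points (u \<epsilon>)) = m"
      "finite (zeros (u \<epsilon>))" "card (zeros (u \<epsilon>)) = m - 1"
      using P m unfolding k_def[symmetric] by blast+
    ultimately show "?order \<epsilon>"
      by blast
  qed
  have amp_lim: "((\<lambda>\<epsilon>. \<bar>profile (u \<epsilon>) (\<delta> l \<epsilon>)\<bar> *
                  (kappa n * \<epsilon>) powr ((2 * real l * real n - 3 * real n + 2) / (2 * real n)))
              \<longlongrightarrow> D_coeff n l m) (at_right 0)" (is "(?f \<longlongrightarrow> ?L) _") if "l \<in> {1..m}" for l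
  proof (rule tendsto_at_right_0_sequentially[OF c])
    fix X :: "nat \<Rightarrow> real" assume X: "\<And>i. 0 < X i" "\<And>i. X i < c" "X \<longlonglongrightarrow> 0"
    show "(\<lambda>i. ?f (X i)) \<longlonglongrightarrow> ?L"
      using amplitude_family.amplitude_limit[OF family[OF X], of l] that sz_delta[OF X(1,2), of l] m by simp
  qed
  have crit_lim: "((\<lambda>\<epsilon>. \<delta> l \<epsilon> * (kappa n * \<epsilon>) powr (- (2 * (real l - 1) / (real n - 2))))
              \<longlongrightarrow> d_coeff n l m) (at_right 0)" (is "(?f \<longlongrightarrow> ?L) _") if "l \<in> {2..m - 1}" for l
  proof (rule tendsto_at_right_0_sequentially[OF c])
    fix X :: "nat \<Rightarrow> real" assume X: "\<And>i. 0 < X i" "\<And>i. X i < c" "X \<longlonglongrightarrow> 0"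
    show "(\<lambda>i. ?f (X i)) \<longlonglongrightarrow> ?L"
      using amplitude_family.critical_limit[OF family[OF X], of l] that sz_delta[OF X(1,2), of l] m by simp
  qed
  have slope_lim: "((\<lambda>\<epsilon>. \<bar>profile_deriv (u \<epsilon>) (\<rho> l \<epsilon>)\<bar> *
                  (kappa n * \<epsilon>) powr ((2 * real l * real n - 3 * real n + 4) / (2 * (real n - 2))))
              \<longlongrightarrow> Z_coeff n l m) (at_right 0)" (is "(?f \<longlongrightarrow> ?L) _") if "l \<in> {1..m - 1}" for l
  proof (rule tendsto_at_right_0_sequentially[OF c])
    fix X :: "nat \<Rightarrow> real" assume X: "\<And>i. 0 < X i" "\<And>i. X i < c" "X \<longlonglongrightarrow> 0"
    show "(\<lambda>i. ?f (X i)) \<longlonglongrightarrow> ?L"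
      using amplitude_family.slope_limit[OF family[OF X], of l] that sz_rho[OF X(1,2), of l] m by simp
  qed
  have zero_lim: "((\<lambda>\<epsilon>. \<rho> l \<epsilon> *
                  (kappa n * \<epsilon>) powr
                    (- ((2 * real l * real n - 2 * real n + 2) / (real n * (real n - 2)))))
              \<longlongrightarrow> z_coeff n l m) (at_right 0)" (is "(?f \<longlongrightarrow> ?L) _") if "l \<in> {1..m - 1}" for l
  proof (rule tendsto_at_right_0_sequentially[OF c])
    fix X :: "nat \<Rightarrow> real" assume X: "\<And>i. 0 < X i" "\<And>i. X i < c" "X \<longlonglongrightarrow> 0"
    show "(\<lambda>i. ?f (X i)) \<longlonglongrightarrow> ?L"
      using amplitude_family.zero_limit[OF family[OF X], of l] that sz_rho[OF X(1,2), of l] m by simp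
  qed
  obtain v where v: "real n = v + 2" "0 < v"
    using n_ge that[of "real n - 2"] by simp
  have "sim_order (\<lambda>\<epsilon>. profile (u \<epsilon>) (\<delta> l \<epsilon>)) (\<lambda>\<epsilon>. \<epsilon> powr ((real n - 2) / (2 * real n) - (real l - 1)))"
    if l: "l \<in> {1..m}" for l
  proof (rule sim_orderI[OF amp_lim[OF l] kappa])
    show "0 < D_coeff n l m" using l n_ge m_ge by (intro D_coeff_pos) auto
    show "(real n - 2) / (2 * real n) - (real l - 1) = - ((2 * real l * real n - 3 * real n + 2) / (2 * real n))"
      using n_ge by (simp add: field_simps)
  qed
  moreover have "sim_order (\<lambda>\<epsilon>. \<delta> l \<epsilon>) (\<lambda>\<epsilon>. \<epsilon> powr (2 * (real l - 1) / (real n - 2)))"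
    if l: "l \<in> {2..m - 1}" for l
  proof (rule sim_orderI_nonneg[OF crit_lim[OF l] kappa])
    show "0 < d_coeff n l m" using l m_ge by (intro d_coeff_pos) auto
  qed simp
  moreover have "sim_order (\<lambda>\<epsilon>. profile_deriv (u \<epsilon>) (\<rho> l \<epsilon>))
      (\<lambda>\<epsilon>. \<epsilon> powr ((real n - 4) / (2 * (real n - 2)) - real n * (real l - 1) / (real n - 2)))"
    if l: "l \<in> {1..m - 1}" for l
  proof (rule sim_orderI[OF slope_lim[OF l] kappa])
    show "0 < Z_coeff n l m" using l n_ge m_ge by (intro Z_coeff_pos) auto
    show "(real n - 4) / (2 * (real n - 2)) - real n * (real l - 1) / (real n - 2)
        = - ((2 * real l * real n - 3 * real n + 4) / (2 * (real n - 2)))"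
      unfolding v(1) using v(2) by (simp add: field_simps)
  qed
  moreover have "sim_order (\<lambda>\<epsilon>. \<rho> l \<epsilon>)
      (\<lambda>\<epsilon>. \<epsilon> powr (2 / (real n * (real n - 2)) + 2 * (real l - 1) / (real n - 2)))"
    if l: "l \<in> {1..m - 1}" for l
  proof (rule sim_orderI_nonneg[OF zero_lim[OF l] kappa])
    show "0 < z_coeff n l m" using l m_ge by (intro z_coeff_pos) auto
    have "2 / (w * v) + 2 * (real l - 1) / v = (2 * real l * w - 2 * w + 2) / (w * v)" if "0 < w" for w
      using that v(2) by (simp add: field_simps)
    from this[of "real n"]
    show "2 / (real n * (real n - 2)) + 2 * (real l - 1) / (real n - 2)
        = - (- ((2 * real l * real n - 2 * real n + 2) / (real n * (real n - 2))))"
      using n_ge v(1) by simp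
  qed
  ultimately show ?thesis
    using order amp_lim crit_lim slope_lim zero_lim by (intro conjI ballI; simp only:)
qed

end
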